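(* Let $k$ be an algebraically closed field of characteristic not equal to $2$. Let $\mathcal{A}$ be a unital commutative $k$-algebra generated by a finite-dimensional subspace $V \subseteq \mathcal{A}$ that is quadratically independent. Let $\mathcal{Q}$ be a Hopf algebra over $k$ that coacts on $\mathcal{A}$ inner-faithfully, via a coaction $\alpha:\mathcal{A}\to \mathcal{A}\otimes\mathcal{Q}$ leaving $V$ invariant, i.e. $\alpha(V)\subseteq V\otimes \mathcal{Q}$. Suppose that one of the following conditions holds: (i) the coaction of $\mathcal{Q}$ preserves a non-degenerate bilinear form on $V$; or (ii) $k$ has characteristic $0$ and $\mathcal{Q}$ is co-semisimple and finite-dimensional. Then $\mathcal{Q}$ is a commutative Hopf algebra.
   Context: A coaction of a Hopf algebra $\mathcal{Q}$ on an algebra $\mathcal{A}$ means a right comodule algebra structure: a unital algebra homomorphism $\alpha:\mathcal{A}\to\mathcal{A}\otimes\mathcal{Q}$ that makes $\mathcal{A}$ a right $\mathcal{Q}$-comodule. In Sweedler notation, $\alpha(a)=a_0\otimes a_1$. Quadratic independence: for a unital commutative $k$-algebra $\mathcal{A}$ generated by a finite-dimensional subspace $V\subseteq\mathcal{A}$, $V$ is quadratically independent if the natural linear map $S^2V:=(V\otimes V)/(v\otimes w-w\otimes v)_{v,w\in V}\to\mathcal{A}$ sending the class of $v\otimes w$ to $vw=wv$ is injective. Inner-faithful: the coaction $\alpha$ does not factor through the coaction of a proper Hopf subalgebra, i.e. there is no proper Hopf subalgebra $\mathcal{Q}'\subsetneq\mathcal{Q}$ with $\alpha(\mathcal{A})\subseteq\mathcal{A}\otimes\mathcal{Q}'$.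 The coaction preserves a bilinear form $B:V\times V\to k$ if $B(a_0,b_0)\,a_1b_1=B(a,b)\,1_{\mathcal{Q}}$ for all $a,b\in V$. No $\ast$-structures are assumed. *)

theory Defs
  imports
    "HOL-Library.Function_Algebras"
    "HOL-Computational_Algebra.Polynomial"
begin

section \<open>Tensor products of vector spaces\<close>

definition bilinear_on ::
  "('k::field \<Rightarrow> 'a::ab_group_add \<Rightarrow> 'a) \<Rightarrow> ('k \<Rightarrow> 'b::ab_group_add \<Rightarrow> 'b) \<Rightarrow>
   ('k \<Rightarrow> 'c::ab_group_add \<Rightarrow> 'c) \<Rightarrow> 'a set \<Rightarrow> 'b set \<Rightarrow> ('a \<Rightarrow> 'b \<Rightarrow> 'c) \<Rightarrow> bool" where
  "bilinear_on s1 s2 s3 U W \<beta> \<longleftrightarrow>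
     (\<forall>u\<in>U. \<forall>u'\<in>U. \<forall>w\<in>W. \<beta> (u + u') w = \<beta> u w + \<beta> u' w) \<and>
     (\<forall>u\<in>U. \<forall>w\<in>W. \<forall>w'\<in>W. \<beta> u (w + w') = \<beta> u w + \<beta> u w') \<and>
     (\<forall>c. \<forall>u\<in>U. \<forall>w\<in>W. \<beta> (s1 c u) w = s3 c (\<beta> u w)) \<and>
     (\<forall>c. \<forall>u\<in>U. \<forall>w\<in>W. \<beta> u (s2 c w) = s3 c (\<beta> u w))"

text \<open>
  The tensor product of two vector spaces is realised inside the dual of the space of bilinear
  forms: the pure tensor of \<open>a\<close> and \<open>b\<close> is evaluation at \<open>(a, b)\<close>, and the tensor product is the
  span of the pure tensors. Forms that are not bilinear are sent to \<open>0\<close>, so that a tensor is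
  determined by its values on bilinear forms. Over a field this is a tensor product; its universal
  property is proved below (\<open>tensor_bilinear\<close>, \<open>tensor_lift_tensor\<close>, \<open>tensor_lift_add\<close>,
  \<open>tensor_lift_scale\<close>, \<open>tensor_space_unique\<close>).
\<close>

type_synonym ('a, 'b, 'k) tensor = "('a \<Rightarrow> 'b \<Rightarrow> 'k) \<Rightarrow> 'k"

definition fscale :: "'k::field \<Rightarrow> ('x \<Rightarrow> 'k) \<Rightarrow> ('x \<Rightarrow> 'k)" where
  "fscale c f = (\<lambda>x. c * f x)"

definition tensor ::
  "('k::field \<Rightarrow> 'a::ab_group_add \<Rightarrow> 'a) \<Rightarrow> ('k \<Rightarrow> 'b::ab_group_add \<Rightarrow> 'b) \<Rightarrow>
   'a \<Rightarrow> 'b \<Rightarrow> ('a, 'b, 'k) tensor" where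
  "tensor s1 s2 a b = (\<lambda>\<beta>. if bilinear_on s1 s2 (*) UNIV UNIV \<beta> then \<beta> a b else 0)"

text \<open>
  For subspaces \<open>U\<close> and \<open>W\<close>, \<open>tensor_space s1 s2 U W\<close> is the tensor product of \<open>U\<close> and \<open>W\<close>,
  as a subspace of the tensor product of the ambient spaces.
\<close>

definition tensor_space ::
  "('k::field \<Rightarrow> 'a::ab_group_add \<Rightarrow> 'a) \<Rightarrow> ('k \<Rightarrow> 'b::ab_group_add \<Rightarrow> 'b) \<Rightarrow>
   'a set \<Rightarrow> 'b set \<Rightarrow> ('a, 'b, 'k) tensor set" where
  "tensor_space s1 s2 U W = module.span fscale {tensor s1 s2 u w | u w. u \<in> U \<and> w \<in> W}"

text \<open>
  The linear map on \<open>tensor_space s1 s2 U W\<close> induced by a map \<open>\<beta>\<close> bilinear on \<open>U\<close> and \<open>W\<close>: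
  if \<open>t\<close> is the sum of the \<open>tensor s1 s2 u\<^sub>i w\<^sub>i\<close>, the value is the sum of the \<open>\<beta> u\<^sub>i w\<^sub>i\<close>. In Sweedler
  notation, \<open>tensor_lift s1 s2 U W \<beta> t\<close> is \<open>\<beta> t\<^sub>0 t\<^sub>1\<close>.
\<close>

definition tensor_lift ::
  "('k::field \<Rightarrow> 'a::ab_group_add \<Rightarrow> 'a) \<Rightarrow> ('k \<Rightarrow> 'b::ab_group_add \<Rightarrow> 'b) \<Rightarrow>
   'a set \<Rightarrow> 'b set \<Rightarrow> ('a \<Rightarrow> 'b \<Rightarrow> 'c::ab_group_add) \<Rightarrow> ('a, 'b, 'k) tensor \<Rightarrow> 'c" where
  "tensor_lift s1 s2 U W \<beta> t =
     (THE z. \<exists>xs. set xs \<subseteq> U \<times> W \<and> t = (\<Sum>(u, w)\<leftarrow>xs. tensor s1 s2 u w) \<and>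
                  z = (\<Sum>(u, w)\<leftarrow>xs. \<beta> u w))"

lemma vector_space_fscale: "vector_space fscale"
  by unfold_locales (auto simp: fscale_def fun_eq_iff algebra_simps)

lemma tensor_bilinear: "bilinear_on s1 s2 fscale UNIV UNIV (tensor s1 s2)"
  by (auto simp: bilinear_on_def tensor_def fscale_def fun_eq_iff)

lemma bilinear_onD:
  assumes "bilinear_on s1 s2 s3 U W \<beta>" "u \<in> U" "w \<in> W"
  shows "u' \<in> U \<Longrightarrow> \<beta> (u + u') w = \<beta> u w + \<beta> u' w"
    and "w' \<in> W \<Longrightarrow> \<beta> u (w + w') = \<beta> u w + \<beta> u w'"
    and "\<beta> (s1 c u) w = s3 c (\<beta> u w)"
    and "\<beta> u (s2 c w) = s3 c (\<beta> u w)"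
  using assms unfolding bilinear_on_def by auto

lemma subspace_projection:
  assumes "vector_space s" "module.subspace s U"
  obtains p where "Vector_Spaces.linear s s p" "range p \<subseteq> U" "\<And>u. u \<in> U \<Longrightarrow> p u = u"
proof -
  interpret vector_space_pair s s using assms(1) by (simp add: vector_space_pair_def)
  have "\<exists>g. g ` UNIV \<subseteq> U \<and> Vector_Spaces.linear s s g \<and> (\<forall>v\<in>U. g (id v) = v)"
    using linear_exists_left_inverse_on[OF vs1.linear_id assms(2)] by auto
  with that show thesis by auto
qed

lemma tensor_list_zero:
  assumes vs: "vector_space s1" "vector_space s2" "vector_space s3"
    and sub: "module.subspace s1 U" "module.subspace s2 W"
    and bil: "bilinear_on s1 s2 s3 U W \<beta>"
    and xs: "set xs \<subseteq> U \<times> W" and zero: "(\<Sum>(u, w)\<leftarrow>xs. tensor s1 s2 u w) = 0"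
  shows "(\<Sum>(u, w)\<leftarrow>xs. \<beta> u w) = 0"
proof (rule ccontr)
  define y where "y = (\<Sum>(u, w)\<leftarrow>xs. \<beta> u w)"
  assume "(\<Sum>(u, w)\<leftarrow>xs. \<beta> u w) \<noteq> 0"
  hence "y \<noteq> 0" by (simp add: y_def)
  have vsk: "vector_space ((*) :: 'a \<Rightarrow> 'a \<Rightarrow> 'a)"
    by unfold_locales (simp_all add: algebra_simps)
  interpret vector_space_pair s3 "(*) :: 'a \<Rightarrow> 'a \<Rightarrow> 'a"
    using vs(3) vsk by (simp add: vector_space_pair_def)
  have "vs1.independent {y}" using \<open>y \<noteq> 0\<close> by simp
  then obtain \<phi> where \<phi>: "Vector_Spaces.linear s3 (*) \<phi>" and "\<phi> y = 1"
    using linear_independent_extend[of "{y}" "\<lambda>_. 1"] by auto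
  obtain p where p: "Vector_Spaces.linear s1 s1 p" "range p \<subseteq> U" "\<And>u. u \<in> U \<Longrightarrow> p u = u"
    using subspace_projection[OF vs(1) sub(1)] by blast
  obtain q where q: "Vector_Spaces.linear s2 s2 q" "range q \<subseteq> W" "\<And>u. u \<in> W \<Longrightarrow> q u = u"
    using subspace_projection[OF vs(2) sub(2)] by blast
  have pU: "p a \<in> U" and qW: "q b \<in> W" for a b using p(2) q(2) by auto
  define \<gamma> where "\<gamma> = (\<lambda>a b. \<phi> (\<beta> (p a) (q b)))"
  note hom = module_hom.add module_hom.scale
  have bg: "bilinear_on s1 s2 (*) UNIV UNIV \<gamma>"
    using \<phi> p(1) q(1) unfolding bilinear_on_def \<gamma>_def module_hom_iff_linear[symmetric]
    by (simp add: hom bilinear_onD[OF bil] pU qW)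
  have "(\<Sum>(u, w)\<leftarrow>xs. tensor s1 s2 u w) \<gamma> = (\<Sum>(u, w)\<leftarrow>xs. \<gamma> u w)" for xs
    using bg by (induction xs) (auto simp: tensor_def)
  moreover have "(\<Sum>(u, w)\<leftarrow>xs. \<gamma> u w) = \<phi> (\<Sum>(u, w)\<leftarrow>xs. \<beta> u w)"
    if "set xs \<subseteq> U \<times> W" for xs
    using that \<phi> unfolding module_hom_iff_linear[symmetric]
    by (induction xs) (auto simp: \<gamma>_def p(3) q(3) hom module_hom.zero)
  ultimately have "\<phi> y = (\<Sum>(u, w)\<leftarrow>xs. tensor s1 s2 u w) \<gamma>"
    using xs unfolding y_def by presburger
  also have "\<dots> = 0" unfolding zero by simp
  finally show False using \<open>\<phi> y = 1\<close> by simp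
qed

lemma tensor_lift_eq:
  assumes vs: "vector_space s1" "vector_space s2" "vector_space s3"
    and sub: "module.subspace s1 U" "module.subspace s2 W"
    and bil: "bilinear_on s1 s2 s3 U W \<beta>"
    and xs: "set xs \<subseteq> U \<times> W"
  shows "tensor_lift s1 s2 U W \<beta> (\<Sum>(u, w)\<leftarrow>xs. tensor s1 s2 u w) = (\<Sum>(u, w)\<leftarrow>xs. \<beta> u w)"
  unfolding tensor_lift_def
proof (rule the_equality)
  fix z
  assume "\<exists>ys. set ys \<subseteq> U \<times> W \<and>
            (\<Sum>(u, w)\<leftarrow>xs. tensor s1 s2 u w) = (\<Sum>(u, w)\<leftarrow>ys. tensor s1 s2 u w) \<and>
            z = (\<Sum>(u, w)\<leftarrow>ys. \<beta> u w)"
  then obtain ys where ys: "set ys \<subseteq> U \<times> W"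
    and eq: "(\<Sum>(u, w)\<leftarrow>xs. tensor s1 s2 u w) = (\<Sum>(u, w)\<leftarrow>ys. tensor s1 s2 u w)"
    and z: "z = (\<Sum>(u, w)\<leftarrow>ys. \<beta> u w)" by blast
  interpret v1: vector_space s1 by fact
  interpret v3: vector_space s3 by fact
  interpret vt: vector_space fscale by (rule vector_space_fscale)
  have neg_tensor: "tensor s1 s2 (- u) w = - tensor s1 s2 u w" for u w
    using bilinear_onD(3)[OF tensor_bilinear[of s1 s2], of u w "-1"] by simp
  have neg_\<beta>: "\<beta> (- u) w = - \<beta> u w" if "u \<in> U" "w \<in> W" for u w
    using bilinear_onD(3)[OF bil that, of "-1"] by simp
  define ns where "ns = map (\<lambda>(u, w). (- u, w)) ys"
  have ns: "set ns \<subseteq> U \<times> W"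
    using ys by (auto simp: ns_def intro!: v1.subspace_neg[OF sub(1)])
  have "(\<Sum>(u, w)\<leftarrow>ns. tensor s1 s2 u w) = - (\<Sum>(u, w)\<leftarrow>ys. tensor s1 s2 u w)"
    unfolding ns_def by (induction ys) (auto simp: neg_tensor)
  hence "(\<Sum>(u, w)\<leftarrow>xs @ ns. tensor s1 s2 u w) = 0"
    by (simp only: map_append sum_list_append eq right_minus)
  moreover have "set (xs @ ns) \<subseteq> U \<times> W" using xs ns by auto
  ultimately have "(\<Sum>(u, w)\<leftarrow>xs @ ns. \<beta> u w) = 0"
    by (intro tensor_list_zero[OF vs sub bil])
  moreover have "(\<Sum>(u, w)\<leftarrow>ns. \<beta> u w) = - (\<Sum>(u, w)\<leftarrow>ys. \<beta> u w)"
    using ys unfolding ns_def by (induction ys) (auto simp: neg_\<beta>)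
  ultimately show "z = (\<Sum>(u, w)\<leftarrow>xs. \<beta> u w)"
    by (simp add: z)
qed (use xs in blast)

lemma tensor_space_list:
  assumes vs: "vector_space s1" and sub: "module.subspace s1 U"
    and t: "t \<in> tensor_space s1 s2 U W"
  obtains xs where "set xs \<subseteq> U \<times> W" "t = (\<Sum>(u, w)\<leftarrow>xs. tensor s1 s2 u w)"
proof -
  interpret v1: vector_space s1 by fact
  interpret vt: vector_space fscale by (rule vector_space_fscale)
  have "\<exists>xs. set xs \<subseteq> U \<times> W \<and> t = (\<Sum>(u, w)\<leftarrow>xs. tensor s1 s2 u w)"
    using t unfolding tensor_space_def
  proof (induction rule: vt.span_induct_alt)
    case base
    show ?case by (intro exI[of _ "[]"]) simp
  next
    case (step c x y)
    then obtain u w xs where "u \<in> U" "w \<in> W" "x = tensor s1 s2 u w"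
      "set xs \<subseteq> U \<times> W" "y = (\<Sum>(u, w)\<leftarrow>xs. tensor s1 s2 u w)" by blast
    moreover have "fscale c (tensor s1 s2 u w) = tensor s1 s2 (s1 c u) w"
      by (simp add: bilinear_onD(3)[OF tensor_bilinear])
    ultimately show ?case
      using v1.subspace_scale[OF sub, of u c] by (intro exI[of _ "(s1 c u, w) # xs"]) auto
  qed
  with that show thesis by blast
qed

lemma tensor_in_tensor_space:
  "u \<in> U \<Longrightarrow> w \<in> W \<Longrightarrow> tensor s1 s2 u w \<in> tensor_space s1 s2 U W"
  unfolding tensor_space_def
  using vector_space_fscale[folded module_iff_vector_space] by (auto intro!: module.span_base)

context
  fixes s1 :: "'k::field \<Rightarrow> 'a::ab_group_add \<Rightarrow> 'a"
    and s2 :: "'k \<Rightarrow> 'b::ab_group_add \<Rightarrow> 'b"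
    and s3 :: "'k \<Rightarrow> 'c::ab_group_add \<Rightarrow> 'c"
    and U W \<beta>
  assumes vs: "vector_space s1" "vector_space s2" "vector_space s3"
    and sub: "module.subspace s1 U" "module.subspace s2 W"
    and bil: "bilinear_on s1 s2 s3 U W \<beta>"
begin

lemma tensor_lift_tensor:
  assumes "u \<in> U" "w \<in> W"
  shows "tensor_lift s1 s2 U W \<beta> (tensor s1 s2 u w) = \<beta> u w"
  using tensor_lift_eq[OF vs sub bil, of "[(u, w)]"] assms by simp

lemma tensor_lift_add:
  assumes "t \<in> tensor_space s1 s2 U W" "t' \<in> tensor_space s1 s2 U W"
  shows "tensor_lift s1 s2 U W \<beta> (t + t') =
         tensor_lift s1 s2 U W \<beta> t + tensor_lift s1 s2 U W \<beta> t'"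
proof -
  obtain xs where xs: "set xs \<subseteq> U \<times> W" and t: "t = (\<Sum>(u, w)\<leftarrow>xs. tensor s1 s2 u w)"
    using assms(1) by (rule tensor_space_list[OF vs(1) sub(1)])
  obtain ys where ys: "set ys \<subseteq> U \<times> W" and t': "t' = (\<Sum>(u, w)\<leftarrow>ys. tensor s1 s2 u w)"
    using assms(2) by (rule tensor_space_list[OF vs(1) sub(1)])
  have "set (xs @ ys) \<subseteq> U \<times> W" using xs ys by simp
  from tensor_lift_eq[OF vs sub bil this] show ?thesis
    unfolding t t' tensor_lift_eq[OF vs sub bil xs] tensor_lift_eq[OF vs sub bil ys]
    unfolding map_append sum_list_append .
qed

lemma tensor_lift_scale:
  assumes "t \<in> tensor_space s1 s2 U W"
  shows "tensor_lift s1 s2 U W \<beta> (fscale c t) = s3 c (tensor_lift s1 s2 U W \<beta> t)"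
proof -
  interpret v1: vector_space s1 by (rule vs)
  interpret v3: vector_space s3 by (rule vs)
  interpret vt: vector_space fscale by (rule vector_space_fscale)
  obtain xs where xs: "set xs \<subseteq> U \<times> W" and t: "t = (\<Sum>(u, w)\<leftarrow>xs. tensor s1 s2 u w)"
    using assms by (rule tensor_space_list[OF vs(1) sub(1)])
  define cs where "cs = map (\<lambda>(u, w). (s1 c u, w)) xs"
  have cs: "set cs \<subseteq> U \<times> W"
    using xs by (auto simp: cs_def intro!: v1.subspace_scale[OF sub(1)])
  have "(\<Sum>(u, w)\<leftarrow>cs. tensor s1 s2 u w) = fscale c (\<Sum>(u, w)\<leftarrow>xs. tensor s1 s2 u w)"
    unfolding cs_def
    by (induction xs)
       (auto simp: bilinear_onD(3)[OF tensor_bilinear] fscale_def fun_eq_iff distrib_left)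
  moreover have "(\<Sum>(u, w)\<leftarrow>cs. \<beta> u w) = s3 c (\<Sum>(u, w)\<leftarrow>xs. \<beta> u w)"
    using xs unfolding cs_def
    by (induction xs) (auto simp: bilinear_onD(3)[OF bil] v3.scale_right_distrib)
  ultimately show ?thesis
    using tensor_lift_eq[OF vs sub bil cs] tensor_lift_eq[OF vs sub bil xs] unfolding t by metis
qed

lemma tensor_space_unique:
  assumes "Vector_Spaces.linear fscale s3 f" "Vector_Spaces.linear fscale s3 g"
    and "\<And>u w. u \<in> U \<Longrightarrow> w \<in> W \<Longrightarrow> f (tensor s1 s2 u w) = g (tensor s1 s2 u w)"
    and "t \<in> tensor_space s1 s2 U W"
  shows "f t = g t"
proof -
  have "vector_space_pair (fscale :: 'k \<Rightarrow> ('a, 'b, 'k) tensor \<Rightarrow> _) s3"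
    using vector_space_fscale vs(3) by (rule vector_space_pair.intro)
  from vector_space_pair.linear_eq_on[OF this assms(1,2) assms(4)[unfolded tensor_space_def]]
  show ?thesis using assms(3) by blast
qed

end


section \<open>Algebras\<close>

text \<open>
  The sort \<open>{ring, monoid_mult}\<close> is that of unital associative rings in which \<open>0 = 1\<close> is allowed,
  so the zero algebra is included.
\<close>

locale k_algebra = vector_space scale
  for scale :: "'k::field \<Rightarrow> 'a::{ring, monoid_mult} \<Rightarrow> 'a" +
  assumes scale_mult_left: "scale c x * y = scale c (x * y)"
    and scale_mult_right: "x * scale c y = scale c (x * y)"

definition subalgebra :: "('k::field \<Rightarrow> 'a::{ring, monoid_mult} \<Rightarrow> 'a) \<Rightarrow> 'a set \<Rightarrow> bool" where
  "subalgebra s R \<longleftrightarrow> module.subspace s R \<and> 1 \<in> R \<and> (\<forall>x\<in>R. \<forall>y\<in>R. x * y \<in> R)"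

definition generates_algebra ::
  "('k::field \<Rightarrow> 'a::{ring, monoid_mult} \<Rightarrow> 'a) \<Rightarrow> 'a set \<Rightarrow> bool" where
  "generates_algebra s V \<longleftrightarrow> \<Inter>{R. subalgebra s R \<and> V \<subseteq> R} = UNIV"

definition fin_dim :: "('k::field \<Rightarrow> 'a::ab_group_add \<Rightarrow> 'a) \<Rightarrow> 'a set \<Rightarrow> bool" where
  "fin_dim s V \<longleftrightarrow> (\<exists>B. finite B \<and> module.span s B = V)"

text \<open>The product \<open>(a \<otimes> q) (b \<otimes> r) = a b \<otimes> q r\<close> of a tensor product of algebras.\<close>

definition tensor_mult ::
  "('k::field \<Rightarrow> 'a::{ring, monoid_mult} \<Rightarrow> 'a) \<Rightarrow> ('k \<Rightarrow> 'b::{ring, monoid_mult} \<Rightarrow> 'b) \<Rightarrow>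
   ('a, 'b, 'k) tensor \<Rightarrow> ('a, 'b, 'k) tensor \<Rightarrow> ('a, 'b, 'k) tensor" where
  "tensor_mult s1 s2 t t' =
     tensor_lift s1 s2 UNIV UNIV
       (\<lambda>a q. tensor_lift s1 s2 UNIV UNIV (\<lambda>b r. tensor s1 s2 (a * b) (q * r)) t') t"


section \<open>Quadratic independence\<close>

definition commutators ::
  "('k::field \<Rightarrow> 'a::ab_group_add \<Rightarrow> 'a) \<Rightarrow> 'a set \<Rightarrow> ('a, 'a, 'k) tensor set" where
  "commutators s V = module.span fscale {tensor s s v w - tensor s s w v | v w. v \<in> V \<and> w \<in> V}"

text \<open>The symmetric square, as a set of cosets in the tensor square.\<close>

definition sym_square ::
  "('k::field \<Rightarrow> 'a::ab_group_add \<Rightarrow> 'a) \<Rightarrow> 'a set \<Rightarrow> ('a, 'a, 'k) tensor set set" where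
  "sym_square s V =
     tensor_space s s V V //
       {(t, t'). t \<in> tensor_space s s V V \<and> t' \<in> tensor_space s s V V \<and> t - t' \<in> commutators s V}"

definition sym_square_mult ::
  "('k::field \<Rightarrow> 'a::{comm_ring, comm_monoid_mult} \<Rightarrow> 'a) \<Rightarrow> 'a set \<Rightarrow>
   ('a, 'a, 'k) tensor set \<Rightarrow> 'a" where
  "sym_square_mult s V X = the_elem (tensor_lift s s V V (*) ` X)"

definition quadratically_independent ::
  "('k::field \<Rightarrow> 'a::{comm_ring, comm_monoid_mult} \<Rightarrow> 'a) \<Rightarrow> 'a set \<Rightarrow> bool" where
  "quadratically_independent s V \<longleftrightarrow> inj_on (sym_square_mult s V) (sym_square s V)"


section \<open>Coalgebras and Hopf algebras\<close>

text \<open>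
  Both sides of coassociativity are written in \<open>C \<otimes> (C \<otimes> C)\<close>: the left one is
  \<open>c\<^sub>1\<^sub>1 \<otimes> (c\<^sub>1\<^sub>2 \<otimes> c\<^sub>2)\<close>, the image of \<open>(\<Delta> \<otimes> id) (\<Delta> c)\<close> under the canonical
  isomorphism, the right one is \<open>(id \<otimes> \<Delta>) (\<Delta> c)\<close>.
\<close>

locale k_coalgebra = vector_space scale
  for scale :: "'k::field \<Rightarrow> 'c::ab_group_add \<Rightarrow> 'c" +
  fixes \<Delta> :: "'c \<Rightarrow> ('c, 'c, 'k) tensor" and \<epsilon> :: "'c \<Rightarrow> 'k"
  assumes comult_linear: "Vector_Spaces.linear scale fscale \<Delta>"
    and comult_in: "\<Delta> c \<in> tensor_space scale scale UNIV UNIV"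
    and counit_linear: "Vector_Spaces.linear scale (*) \<epsilon>"
    and coassoc:
      "tensor_lift scale scale UNIV UNIV
         (\<lambda>x y. tensor_lift scale scale UNIV UNIV
            (\<lambda>x1 x2. tensor scale fscale x1 (tensor scale scale x2 y)) (\<Delta> x)) (\<Delta> c) =
       tensor_lift scale scale UNIV UNIV (\<lambda>x y. tensor scale fscale x (\<Delta> y)) (\<Delta> c)"
    and counit_left: "tensor_lift scale scale UNIV UNIV (\<lambda>x y. scale (\<epsilon> x) y) (\<Delta> c) = c"
    and counit_right: "tensor_lift scale scale UNIV UNIV (\<lambda>x y. scale (\<epsilon> y) x) (\<Delta> c) = c"

definition subcoalgebra ::
  "('k::field \<Rightarrow> 'c::ab_group_add \<Rightarrow> 'c) \<Rightarrow> ('c \<Rightarrow> ('c, 'c, 'k) tensor) \<Rightarrow> 'c set \<Rightarrow> bool" where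
  "subcoalgebra s \<Delta> D \<longleftrightarrow> module.subspace s D \<and> \<Delta> ` D \<subseteq> tensor_space s s D D"

definition simple_subcoalgebra ::
  "('k::field \<Rightarrow> 'c::ab_group_add \<Rightarrow> 'c) \<Rightarrow> ('c \<Rightarrow> ('c, 'c, 'k) tensor) \<Rightarrow> 'c set \<Rightarrow> bool" where
  "simple_subcoalgebra s \<Delta> D \<longleftrightarrow>
     subcoalgebra s \<Delta> D \<and> D \<noteq> {0} \<and>
     (\<forall>E. subcoalgebra s \<Delta> E \<longrightarrow> E \<subseteq> D \<longrightarrow> E = {0} \<or> E = D)"

text \<open>A coalgebra is co-semisimple if it is the sum of its simple subcoalgebras.\<close>

definition cosemisimple ::
  "('k::field \<Rightarrow> 'c::ab_group_add \<Rightarrow> 'c) \<Rightarrow> ('c \<Rightarrow> ('c, 'c, 'k) tensor) \<Rightarrow> bool" where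
  "cosemisimple s \<Delta> \<longleftrightarrow> module.span s (\<Union>{D. simple_subcoalgebra s \<Delta> D}) = UNIV"

locale hopf_algebra = k_algebra scale + k_coalgebra scale \<Delta> \<epsilon>
  for scale :: "'k::field \<Rightarrow> 'q::{ring, monoid_mult} \<Rightarrow> 'q" and \<Delta> \<epsilon> +
  fixes S :: "'q \<Rightarrow> 'q"
  assumes comult_mult: "\<Delta> (x * y) = tensor_mult scale scale (\<Delta> x) (\<Delta> y)"
    and comult_one: "\<Delta> 1 = tensor scale scale 1 1"
    and counit_mult: "\<epsilon> (x * y) = \<epsilon> x * \<epsilon> y"
    and counit_one: "\<epsilon> 1 = 1"
    and antipode_linear: "Vector_Spaces.linear scale scale S"
    and antipode_left:
      "tensor_lift scale scale UNIV UNIV (\<lambda>x y. S x * y) (\<Delta> h) = scale (\<epsilon> h) 1"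
    and antipode_right:
      "tensor_lift scale scale UNIV UNIV (\<lambda>x y. x * S y) (\<Delta> h) = scale (\<epsilon> h) 1"

definition hopf_subalgebra ::
  "('k::field \<Rightarrow> 'q::{ring, monoid_mult} \<Rightarrow> 'q) \<Rightarrow> ('q \<Rightarrow> ('q, 'q, 'k) tensor) \<Rightarrow> ('q \<Rightarrow> 'q) \<Rightarrow>
   'q set \<Rightarrow> bool" where
  "hopf_subalgebra s \<Delta> S P \<longleftrightarrow> subalgebra s P \<and> subcoalgebra s \<Delta> P \<and> S ` P \<subseteq> P"


section \<open>Coactions\<close>

text \<open>
  As for coalgebras, both sides of \<open>coaction_coassoc\<close> are written in \<open>A \<otimes> (Q \<otimes> Q)\<close>.
\<close>

locale hopf_coaction = A: k_algebra scaleA + Q: hopf_algebra scaleQ \<Delta> \<epsilon> S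
  for scaleA :: "'k::field \<Rightarrow> 'a::{ring, monoid_mult} \<Rightarrow> 'a"
    and scaleQ :: "'k \<Rightarrow> 'q::{ring, monoid_mult} \<Rightarrow> 'q" and \<Delta> \<epsilon> S +
  fixes \<alpha> :: "'a \<Rightarrow> ('a, 'q, 'k) tensor"
  assumes coaction_linear: "Vector_Spaces.linear scaleA fscale \<alpha>"
    and coaction_in: "\<alpha> a \<in> tensor_space scaleA scaleQ UNIV UNIV"
    and coaction_mult: "\<alpha> (a * b) = tensor_mult scaleA scaleQ (\<alpha> a) (\<alpha> b)"
    and coaction_one: "\<alpha> 1 = tensor scaleA scaleQ 1 1"
    and coaction_coassoc:
      "tensor_lift scaleA scaleQ UNIV UNIV
         (\<lambda>x q. tensor_lift scaleA scaleQ UNIV UNIV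
            (\<lambda>y r. tensor scaleA fscale y (tensor scaleQ scaleQ r q)) (\<alpha> x)) (\<alpha> a) =
       tensor_lift scaleA scaleQ UNIV UNIV (\<lambda>x q. tensor scaleA fscale x (\<Delta> q)) (\<alpha> a)"
    and coaction_counit:
      "tensor_lift scaleA scaleQ UNIV UNIV (\<lambda>x q. scaleA (\<epsilon> q) x) (\<alpha> a) = a"

definition inner_faithful ::
  "('k::field \<Rightarrow> 'a::{ring, monoid_mult} \<Rightarrow> 'a) \<Rightarrow> ('k \<Rightarrow> 'q::{ring, monoid_mult} \<Rightarrow> 'q) \<Rightarrow>
   ('q \<Rightarrow> ('q, 'q, 'k) tensor) \<Rightarrow> ('q \<Rightarrow> 'q) \<Rightarrow> ('a \<Rightarrow> ('a, 'q, 'k) tensor) \<Rightarrow> bool" where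
  "inner_faithful sA sQ \<Delta> S \<alpha> \<longleftrightarrow>
     \<not> (\<exists>P. hopf_subalgebra sQ \<Delta> S P \<and> P \<noteq> UNIV \<and> range \<alpha> \<subseteq> tensor_space sA sQ UNIV P)"

text \<open>
  Bilinear forms on \<open>V\<close> are functions on the ambient type of which only the values on \<open>V\<close> matter.
\<close>

definition bilinear_form_on ::
  "('k::field \<Rightarrow> 'a::ab_group_add \<Rightarrow> 'a) \<Rightarrow> 'a set \<Rightarrow> ('a \<Rightarrow> 'a \<Rightarrow> 'k) \<Rightarrow> bool" where
  "bilinear_form_on s V B \<longleftrightarrow> bilinear_on s s (*) V V B"

definition nondegenerate_on :: "'a::ab_group_add set \<Rightarrow> ('a \<Rightarrow> 'a \<Rightarrow> 'k::field) \<Rightarrow> bool" where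
  "nondegenerate_on V B \<longleftrightarrow>
     (\<forall>v\<in>V. (\<forall>w\<in>V. B v w = 0) \<longrightarrow> v = 0) \<and> (\<forall>w\<in>V. (\<forall>v\<in>V. B v w = 0) \<longrightarrow> w = 0)"

definition preserves_form ::
  "('k::field \<Rightarrow> 'a::ab_group_add \<Rightarrow> 'a) \<Rightarrow> ('k \<Rightarrow> 'q::{ring, monoid_mult} \<Rightarrow> 'q) \<Rightarrow>
   ('a \<Rightarrow> ('a, 'q, 'k) tensor) \<Rightarrow> 'a set \<Rightarrow> ('a \<Rightarrow> 'a \<Rightarrow> 'k) \<Rightarrow> bool" where
  "preserves_form sA sQ \<alpha> V B \<longleftrightarrow>
     (\<forall>a\<in>V. \<forall>b\<in>V.
        tensor_lift sA sQ V UNIV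
          (\<lambda>a0 a1. tensor_lift sA sQ V UNIV (\<lambda>b0 b1. sQ (B a0 b0) (a1 * b1)) (\<alpha> b)) (\<alpha> a) =
        sQ (B a b) 1)"

end

(*
  The coefficients q_ij of the coaction on a basis of V form a comatrix. Comparing the coactions on
  v_i v_j and v_j v_i, quadratic independence gives
    (1) [q_ki, q_lj] = [q_kj, q_li].
  If all q_ij commute and the algebra they generate is stable under the antipode, that algebra is a
  commutative Hopf subalgebra through which the coaction factors, so it is everything.

  (i) For an invariant form with Gram matrix G we have q^T G q = G, so q^T G = G S(q). Applying S to (1)
  and substituting gives [q_ki, q_lj] = [q_li, q_kj]; adding (1) yields 2 [q_ki, q_lj] = 0.

  (ii) Fix two rows x_i = q_ki and y_i = q_li. By (1) the elements x_i + y_i t of the dual numbers over Q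
  commute, so they generate a commutative algebra D, whose image B under t = 0 is a commutative right
  coideal subalgebra of Q. The Haar functional h is nondegenerate on B: its radical I is an ideal of B
  and stable under the coaction, hence either I = 0 or I Q = Q, and the latter is impossible by Nakayama.
  For dual bases e_a, e^a of B, the sum of the e_a e^a is then the scalar dim B, which is invertible. With
  lifts e^a + d^a t to D, the sum w of the e_a d^a is coinvariant modulo the centralizer Z of B, hence
  lies in Z. The usual argument for derivations on separable algebras gives (dim B) b' = b w - w b modulo
  Z for b + b' t in D, so that b' is in Z. In particular every y_j commutes with every x_i.
*)

theory Submission
  imports Defs
begin

section \<open>Computing with tensors\<close>

text \<open>Relation (1) alone does not give commutativity: it exchanges column indices only. For k
  = l it makes the entries of a row commute, because 2 is invertible; for two rows it says that
  moving the first row along the second stays commutative to first order. A second symmetry has to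
  come from elsewhere. In (i) it comes from S, which reverses products and so yields the relation
  with the row indices exchanged. In (ii) V carries no form, but h(xy) is an invariant form on every
  right coideal subalgebra B, and its nondegeneracy follows from the commutativity of B. The
  alternative I = 0 or I Q = Q rests on the counit: a nonzero I contains some x with \<epsilon> x
  nonzero, and x_1 S(x_2) = \<epsilon>(x) 1. Nakayama then puts 1 into I, against h(1) = 1. The
  scalar dim B is the sum of the h(e^a e_a); this is where characteristic 0 enters. Stability under
  S: in (i) the equation G S(q) = q^T G is solved for S(q); in (ii) the same is done with the Haar
  form of the algebra generated by the q_ij, which by then is known to be commutative.\<close>

lemma vector_space_mult: "vector_space ((*) :: 'k::field \<Rightarrow> 'k \<Rightarrow> 'k)"
  by unfold_locales (simp_all add: algebra_simps)

lemma linear_iff_add_scale: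
  assumes "vector_space s1" "vector_space s2"
  shows "Vector_Spaces.linear s1 s2 f \<longleftrightarrow>
    (\<forall>x y. f (x + y) = f x + f y) \<and> (\<forall>c x. f (s1 c x) = s2 c (f x))"
  using assms by (auto simp: Vector_Spaces.linear_iff)

lemma lin_sum:
  "Vector_Spaces.linear s1 s2 f \<Longrightarrow> f (\<Sum>i\<in>I. g i) = (\<Sum>i\<in>I. f (g i))"
  by (auto simp: module_hom_iff_linear[symmetric] module_hom.sum)

lemma lin_sum_list:
  "Vector_Spaces.linear s1 s2 f \<Longrightarrow> f (\<Sum>i\<leftarrow>xs. g i) = (\<Sum>i\<leftarrow>xs. f (g i))"
  by (induction xs) (auto simp: module_hom_iff_linear[symmetric] module_hom.zero module_hom.add)

lemma lin_add: "Vector_Spaces.linear s1 s2 f \<Longrightarrow> f (x + y) = f x + f y"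
  by (auto simp: module_hom_iff_linear[symmetric] module_hom.add)

lemma lin_scale: "Vector_Spaces.linear s1 s2 f \<Longrightarrow> f (s1 c x) = s2 c (f x)"
  by (auto simp: module_hom_iff_linear[symmetric] module_hom.scale)

lemma lin_zero: "Vector_Spaces.linear s1 s2 f \<Longrightarrow> f 0 = 0"
  by (auto simp: module_hom_iff_linear[symmetric] module_hom.zero)

lemma lin_diff: "Vector_Spaces.linear s1 s2 f \<Longrightarrow> f (x - y) = f x - f y"
  by (auto simp: module_hom_iff_linear[symmetric] module_hom.diff)

lemma separating_functional:
  fixes s :: "'k::field \<Rightarrow> 'a::ab_group_add \<Rightarrow> 'a"
  assumes "vector_space s" "module.subspace s W" "x \<notin> W"
  obtains f where "Vector_Spaces.linear s (*) f" "\<And>w. w \<in> W \<Longrightarrow> f w = 0" "f x = 1"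
proof -
  interpret vector_space_pair s "(*) :: 'k \<Rightarrow> 'k \<Rightarrow> 'k"
    using assms(1) vector_space_mult by (simp add: vector_space_pair_def)
  obtain E where E: "E \<subseteq> W" "vs1.independent E" "W \<subseteq> vs1.span E"
    using vs1.maximal_independent_subset by blast
  have sE: "vs1.span E = W"
    using E(1,3) assms(2) by (rule vs1.span_subspace)
  hence "vs1.independent (insert x E)"
    using E(2) assms(3) by (simp add: vs1.independent_insertI)
  then obtain f where f: "Vector_Spaces.linear s (*) f" "\<forall>y\<in>insert x E. f y = (if y = x then 1 else 0)"
    using linear_independent_extend[of "insert x E" "\<lambda>y. if y = x then 1 else 0"] by blast
  have "f w = 0" if "w \<in> W" for w
  proof (rule vs1.span_induct[of w E "\<lambda>w. f w = 0"])
    show "w \<in> vs1.span E" using that sE by simp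
    show "vs1.subspace (Collect (\<lambda>w. f w = 0))"
      by (intro vs1.subspaceI) (simp_all add: lin_zero[OF f(1)] lin_add[OF f(1)] lin_scale[OF f(1)])
    show "f y = 0" if "y \<in> E" for y
      using that f(2) E(1) assms(3) by auto
  qed
  with f that show thesis by simp
qed

text \<open>Converts an identity with coefficients in Q into identities over k, where quadratic
  independence and the cancellation of a Gram matrix are available.\<close>

corollary eq_if_functionals_eq:
  fixes s :: "'k::field \<Rightarrow> 'a::ab_group_add \<Rightarrow> 'a"
  assumes "vector_space s" "\<And>f. Vector_Spaces.linear s (*) f \<Longrightarrow> f x = f y"
  shows "x = y"
proof (rule ccontr)
  interpret vector_space s by fact
  assume "x \<noteq> y"
  hence "x - y \<notin> {0}" by simp
  then obtain f where "Vector_Spaces.linear s (*) f" "f (x - y) = 1"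
    using separating_functional[OF assms(1) subspace_single_0] by blast
  with assms(2)[of f] lin_diff[of s "(*)" f x y] show False by simp
qed

section \<open>Linear maps induced on tensor products, and coefficients with respect to a
  basis\<close>

abbreviation tlift ::
  "('k::field \<Rightarrow> 'a::ab_group_add \<Rightarrow> 'a) \<Rightarrow> ('k \<Rightarrow> 'b::ab_group_add \<Rightarrow> 'b) \<Rightarrow>
   ('a \<Rightarrow> 'b \<Rightarrow> 'c::ab_group_add) \<Rightarrow> ('a, 'b, 'k) tensor \<Rightarrow> 'c" where
  "tlift s1 s2 \<equiv> tensor_lift s1 s2 UNIV UNIV"

abbreviation tspace ::
  "('k::field \<Rightarrow> 'a::ab_group_add \<Rightarrow> 'a) \<Rightarrow> ('k \<Rightarrow> 'b::ab_group_add \<Rightarrow> 'b) \<Rightarrow>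
   ('a, 'b, 'k) tensor set" where
  "tspace s1 s2 \<equiv> tensor_space s1 s2 UNIV UNIV"

lemma subspace_tensor_space: "module.subspace fscale (tensor_space s1 s2 U W)"
  unfolding tensor_space_def
  using vector_space_fscale[folded module_iff_vector_space] by (rule module.subspace_span)

lemma module_fscale: "module fscale"
  using vector_space_fscale by (simp add: module_iff_vector_space)

lemma tensor_space_sum:
  "(\<And>i. i \<in> I \<Longrightarrow> f i \<in> tensor_space s1 s2 U W) \<Longrightarrow> (\<Sum>i\<in>I. f i) \<in> tensor_space s1 s2 U W"
  by (rule module.subspace_sum[OF module_fscale subspace_tensor_space])

lemma tensor_space_zero: "0 \<in> tensor_space s1 s2 U W"
  by (rule module.subspace_0[OF module_fscale subspace_tensor_space])

lemma tensor_space_add: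
  "t \<in> tensor_space s1 s2 U W \<Longrightarrow> t' \<in> tensor_space s1 s2 U W \<Longrightarrow> t + t' \<in> tensor_space s1 s2 U W"
  by (rule module.subspace_add[OF module_fscale subspace_tensor_space])

lemma tensor_space_scale:
  "t \<in> tensor_space s1 s2 U W \<Longrightarrow> fscale c t \<in> tensor_space s1 s2 U W"
  by (rule module.subspace_scale[OF module_fscale subspace_tensor_space])

lemma tensor_space_sum_list:
  "(\<And>i. i \<in> set xs \<Longrightarrow> f i \<in> tensor_space s1 s2 U W) \<Longrightarrow> (\<Sum>i\<leftarrow>xs. f i) \<in> tensor_space s1 s2 U W"
  by (induction xs) (auto simp: tensor_space_zero tensor_space_add)

lemma tensor_space_mono: "U \<subseteq> U' \<Longrightarrow> W \<subseteq> W' \<Longrightarrow> tensor_space s1 s2 U W \<subseteq> tensor_space s1 s2 U' W'"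
  unfolding tensor_space_def by (intro module.span_mono[OF module_fscale]) blast

lemma linear_tensor_left:
  "vector_space s1 \<Longrightarrow> Vector_Spaces.linear s1 fscale (\<lambda>u. tensor s1 s2 u w)"
  using tensor_bilinear[of s1 s2]
  by (simp add: linear_iff_add_scale vector_space_fscale bilinear_on_def)

lemma linear_tensor_right:
  "vector_space s2 \<Longrightarrow> Vector_Spaces.linear s2 fscale (tensor s1 s2 u)"
  using tensor_bilinear[of s1 s2]
  by (simp add: linear_iff_add_scale vector_space_fscale bilinear_on_def)

lemma bilinear_onI:
  assumes "vector_space s1" "vector_space s2" "vector_space s3"
    and "\<And>w. Vector_Spaces.linear s1 s3 (\<lambda>u. \<beta> u w)" "\<And>u. Vector_Spaces.linear s2 s3 (\<beta> u)"
  shows "bilinear_on s1 s2 s3 U W \<beta>"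
  using assms by (auto simp: bilinear_on_def linear_iff_add_scale)

lemma bilinear_on_linear:
  assumes "vector_space s1" "vector_space s2" "vector_space s3" "bilinear_on s1 s2 s3 UNIV UNIV \<beta>"
  shows "Vector_Spaces.linear s1 s3 (\<lambda>u. \<beta> u w)" "Vector_Spaces.linear s2 s3 (\<beta> u)"
  using assms by (auto simp: bilinear_on_def linear_iff_add_scale)

lemma bilinear_on_compose:
  assumes "bilinear_on s1 s2 s3 UNIV UNIV \<beta>" "Vector_Spaces.linear s3 s4 f"
  shows "bilinear_on s1 s2 s4 UNIV UNIV (\<lambda>u w. f (\<beta> u w))"
  using assms by (auto simp: bilinear_on_def lin_add lin_scale)

context
  fixes s1 :: "'k::field \<Rightarrow> 'a::ab_group_add \<Rightarrow> 'a"
    and s2 :: "'k \<Rightarrow> 'b::ab_group_add \<Rightarrow> 'b"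
    and s3 :: "'k \<Rightarrow> 'c::ab_group_add \<Rightarrow> 'c"
    and U W \<beta>
  assumes vs: "vector_space s1" "vector_space s2" "vector_space s3"
    and sub: "module.subspace s1 U" "module.subspace s2 W"
    and bil: "bilinear_on s1 s2 s3 U W \<beta>"
begin

lemma tensor_lift_zero: "tensor_lift s1 s2 U W \<beta> 0 = 0"
  using tensor_lift_eq[OF vs sub bil, of "[]"] by simp

lemma tensor_lift_sum:
  assumes "\<And>i. i \<in> I \<Longrightarrow> t i \<in> tensor_space s1 s2 U W"
  shows "tensor_lift s1 s2 U W \<beta> (\<Sum>i\<in>I. t i) = (\<Sum>i\<in>I. tensor_lift s1 s2 U W \<beta> (t i))"
  using assms
  by (induction I rule: infinite_finite_induct)
     (simp_all add: tensor_lift_zero tensor_lift_add[OF vs sub bil] tensor_space_sum)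

lemma tensor_lift_sum_list:
  assumes "\<And>i. i \<in> set xs \<Longrightarrow> t i \<in> tensor_space s1 s2 U W"
  shows "tensor_lift s1 s2 U W \<beta> (\<Sum>i\<leftarrow>xs. t i) = (\<Sum>i\<leftarrow>xs. tensor_lift s1 s2 U W \<beta> (t i))"
  using assms
  by (induction xs)
     (simp_all add: tensor_lift_zero tensor_lift_add[OF vs sub bil] tensor_space_sum_list)

lemma tensor_lift_sum_tensor:
  assumes "\<And>i. i \<in> I \<Longrightarrow> u i \<in> U" "\<And>i. i \<in> I \<Longrightarrow> w i \<in> W"
  shows "tensor_lift s1 s2 U W \<beta> (\<Sum>i\<in>I. tensor s1 s2 (u i) (w i)) = (\<Sum>i\<in>I. \<beta> (u i) (w i))"
  by (subst tensor_lift_sum)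
     (auto simp: assms tensor_in_tensor_space tensor_lift_tensor[OF vs sub bil] intro!: sum.cong)

end

context
  fixes s1 :: "'k::field \<Rightarrow> 'a::ab_group_add \<Rightarrow> 'a"
    and s2 :: "'k \<Rightarrow> 'b::ab_group_add \<Rightarrow> 'b"
  assumes vs: "vector_space s1" "vector_space s2"
begin

lemma subspace_UNIVs: "module.subspace s1 UNIV" "module.subspace s2 UNIV"
  using vs by (simp_all add: module.subspace_UNIV module_iff_vector_space)

lemmas ts_list = tensor_space_list[OF vs(1) subspace_UNIVs(1), of _ s2 UNIV, simplified]

lemma linear_tl:
  assumes "vector_space s3" "bilinear_on s1 s2 s3 UNIV UNIV \<beta>" "Vector_Spaces.linear s3 s4 f"
    and "vector_space s4" "t \<in> tspace s1 s2"
  shows "f (tlift s1 s2 \<beta> t) = tlift s1 s2 (\<lambda>u w. f (\<beta> u w)) t"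
proof -
  obtain xs where t: "t = (\<Sum>(u, w)\<leftarrow>xs. tensor s1 s2 u w)" using ts_list[OF assms(5)] by metis
  have b: "bilinear_on s1 s2 s4 UNIV UNIV (\<lambda>u w. f (\<beta> u w))"
    using assms(2,3) by (rule bilinear_on_compose)
  show ?thesis
    unfolding t tensor_lift_eq[OF vs assms(1) subspace_UNIVs assms(2) subset_UNIV[of "set xs", folded UNIV_Times_UNIV]]
      tensor_lift_eq[OF vs assms(4) subspace_UNIVs b subset_UNIV[of "set xs", folded UNIV_Times_UNIV]]
    by (simp add: lin_sum_list[OF assms(3)] case_prod_unfold)
qed

text \<open>In a nested Sweedler expression the inner lift depends on a variable of the outer one.
  This gives linearity in that variable, without which the outer lift could not be
  evaluated.\<close>

lemma linear_tl_param:
  assumes "vector_space s3" "vector_space s4"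
    and "\<And>q. bilinear_on s1 s2 s3 UNIV UNIV (\<gamma> q)"
    and "\<And>u w. Vector_Spaces.linear s4 s3 (\<lambda>q. \<gamma> q u w)" and "t \<in> tspace s1 s2"
  shows "Vector_Spaces.linear s4 s3 (\<lambda>q. tlift s1 s2 (\<gamma> q) t)"
proof -
  obtain xs where t: "t = (\<Sum>(u, w)\<leftarrow>xs. tensor s1 s2 u w)" using ts_list[OF assms(5)] by metis
  interpret v3: vector_space s3 by fact
  have "Vector_Spaces.linear s4 s3 (\<lambda>q. \<Sum>(u, w)\<leftarrow>xs. \<gamma> q u w)"
    using assms(4)
    by (induction xs)
       (auto simp: linear_iff_add_scale[OF assms(2,1)] v3.scale_right_distrib add_ac)
  thus ?thesis
    unfolding t tensor_lift_eq[OF vs assms(1) subspace_UNIVs assms(3) subset_UNIV[of "set xs", folded UNIV_Times_UNIV]] .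
qed

lemma linear_tl_arg:
  assumes "vector_space s3" "vector_space s4" "bilinear_on s1 s2 s3 UNIV UNIV \<beta>"
    and "Vector_Spaces.linear s4 fscale \<alpha>" "\<And>x. \<alpha> x \<in> tspace s1 s2"
  shows "Vector_Spaces.linear s4 s3 (\<lambda>x. tlift s1 s2 \<beta> (\<alpha> x))"
  using assms
  by (simp add: linear_iff_add_scale lin_add lin_scale tensor_lift_add[OF vs(1,2) assms(1) subspace_UNIVs assms(3)]
      tensor_lift_scale[OF vs(1,2) assms(1) subspace_UNIVs assms(3)])

text \<open>Source of all matrix coefficients below. Spanning is enough for existence; independence
  of \<open>E\<close> is what \<open>tensor_coeff_unique\<close> adds.\<close>

lemma tensor_space_span_rep:
  assumes "finite E" "module.subspace s2 W" "t \<in> tensor_space s1 s2 (module.span s1 E) W"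
  obtains c where "\<And>e. c e \<in> W" "t = (\<Sum>e\<in>E. tensor s1 s2 e (c e))"
proof -
  interpret v1: vector_space s1 by fact
  interpret v2: vector_space s2 by fact
  obtain xs where "set xs \<subseteq> v1.span E \<times> W" and t: "t = (\<Sum>(u, w)\<leftarrow>xs. tensor s1 s2 u w)"
    using tensor_space_list[OF vs(1) v1.subspace_span assms(3)] by metis
  hence "\<exists>c. (\<forall>e. c e \<in> W) \<and> (\<Sum>(u, w)\<leftarrow>xs. tensor s1 s2 u w) = (\<Sum>e\<in>E. tensor s1 s2 e (c e))"
  proof (induction xs arbitrary: t)
    case Nil
    show ?case
      by (rule exI[of _ "\<lambda>_. 0"]) (simp add: lin_zero[OF linear_tensor_right[OF vs(2)]] v2.subspace_0[OF assms(2)])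
  next
    case (Cons x xs)
    obtain u w where x: "x = (u, w)" by force
    obtain c where c: "\<forall>e. c e \<in> W"
      and eq: "(\<Sum>(u, w)\<leftarrow>xs. tensor s1 s2 u w) = (\<Sum>e\<in>E. tensor s1 s2 e (c e))"
      using Cons by force
    have "u \<in> v1.span E" "w \<in> W" using Cons.prems x by auto
    then obtain g where u: "u = (\<Sum>e\<in>E. s1 (g e) e)" using v1.span_finite[OF assms(1)] by auto
    have "tensor s1 s2 u w = (\<Sum>e\<in>E. tensor s1 s2 e (s2 (g e) w))"
      unfolding u
      by (simp add: lin_sum[OF linear_tensor_left[OF vs(1)]] lin_scale[OF linear_tensor_left[OF vs(1)]]
          lin_scale[OF linear_tensor_right[OF vs(2)]])
    moreover have "s2 (g e) w + c e \<in> W" for e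
      using c \<open>w \<in> W\<close> assms(2) v2.subspace_add v2.subspace_scale by metis
    ultimately show ?case
      by (intro exI[of _ "\<lambda>e. s2 (g e) w + c e"] conjI allI)
         (simp_all only: x eq lin_add[OF linear_tensor_right[OF vs(2)]] sum.distrib list.map
           sum_list.Cons prod.case)
  qed
  with t that show thesis by auto
qed

text \<open>Pairing the first leg with the coordinate functional of \<open>e\<close> isolates the
  coefficient at \<open>e\<close>.\<close>

lemma tensor_coeff_unique:
  assumes "finite E" "\<not> module.dependent s1 E" "e \<in> E"
    and eq: "(\<Sum>e\<in>E. tensor s1 s2 e (c e)) = (\<Sum>e\<in>E. tensor s1 s2 e (c' e))"
  shows "c e = c' e"
proof -
  interpret vector_space_pair s1 "(*) :: 'k \<Rightarrow> 'k \<Rightarrow> 'k"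
    using vs(1) vector_space_mult by (simp add: vector_space_pair_def)
  interpret v2: vector_space s2 by (rule vs)
  obtain f where f: "Vector_Spaces.linear s1 (*) f" and fe: "\<forall>x\<in>E. f x = (if x = e then 1 else 0)"
    using linear_independent_extend[OF assms(2), of "\<lambda>x. if x = e then 1 else 0"] by blast
  define \<beta> where "\<beta> = (\<lambda>u w. s2 (f u) w)"
  have b: "bilinear_on s1 s2 s2 UNIV UNIV \<beta>"
    using f by (auto simp: \<beta>_def bilinear_on_def lin_add lin_scale v2.scale_left_distrib
        v2.scale_right_distrib mult_ac)
  have "tlift s1 s2 \<beta> (\<Sum>e\<in>E. tensor s1 s2 e (d e)) = d e" for d
  proof -
    have "tlift s1 s2 \<beta> (\<Sum>e\<in>E. tensor s1 s2 e (d e)) = (\<Sum>x\<in>E. if x = e then d x else 0)"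
      using fe by (subst tensor_lift_sum_tensor[OF vs vs(2) subspace_UNIVs b]) (auto simp: \<beta>_def intro!: sum.cong)
    thus ?thesis using assms by simp
  qed
  from this[of c] this[of c'] eq show ?thesis by simp
qed

end

lemma sum_list_map_concat:
  "(\<Sum>x\<leftarrow>concat xss. f x) = (\<Sum>xs\<leftarrow>xss. \<Sum>x\<leftarrow>xs. f x)"
  by (induction xss) auto

lemma tensor_mult_tensor_list:
  assumes "k_algebra s1" "k_algebra s2"
  shows "tensor_mult s1 s2 (\<Sum>(a, b)\<leftarrow>xs. tensor s1 s2 a b) (\<Sum>(c, d)\<leftarrow>ys. tensor s1 s2 c d) =
    (\<Sum>(a, b)\<leftarrow>xs. \<Sum>(c, d)\<leftarrow>ys. tensor s1 s2 (a * c) (b * d))"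
proof -
  interpret A: k_algebra s1 by fact
  interpret B: k_algebra s2 by fact
  note vs = A.vector_space_axioms B.vector_space_axioms vector_space_fscale
  note sub = subspace_UNIVs[OF vs(1,2)]
  note lin = linear_tensor_left[OF vs(1), of s2] linear_tensor_right[OF vs(2), of s1]
  have bil2: "bilinear_on s1 s2 fscale UNIV UNIV (\<lambda>c d. tensor s1 s2 (a * c) (b * d))" for a b
    using lin[THEN lin_add] lin[THEN lin_scale]
    by (auto simp: bilinear_on_def algebra_simps A.scale_mult_right B.scale_mult_right)
  define \<beta> where "\<beta> = (\<lambda>a b. \<Sum>(c, d)\<leftarrow>ys. tensor s1 s2 (a * c) (b * d))"
  have bil: "bilinear_on s1 s2 fscale UNIV UNIV \<beta>"
    unfolding \<beta>_def
    by (induction ys) (auto simp: bilinear_on_def A.scale_mult_left B.scale_mult_left algebra_simps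
        lin[THEN lin_add] lin[THEN lin_scale] fscale_def fun_eq_iff distrib_left)
  show ?thesis
    unfolding tensor_mult_def tensor_lift_eq[OF vs sub bil2 subset_UNIV[THEN order_trans], simplified]
    using tensor_lift_eq[OF vs sub bil, of xs] by (simp add: \<beta>_def)
qed

lemma tensor_mult_sum_tensor:
  assumes "k_algebra s1" "k_algebra s2" "finite I" "finite J"
  shows "tensor_mult s1 s2 (\<Sum>i\<in>I. tensor s1 s2 (a i) (b i)) (\<Sum>j\<in>J. tensor s1 s2 (c j) (d j)) =
    (\<Sum>i\<in>I. \<Sum>j\<in>J. tensor s1 s2 (a i * c j) (b i * d j))"
proof -
  obtain xs where xs: "distinct xs" "set xs = I" using finite_distinct_list[OF assms(3)] by blast
  obtain ys where ys: "distinct ys" "set ys = J" using finite_distinct_list[OF assms(4)] by blast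
  show ?thesis
    using tensor_mult_tensor_list[OF assms(1,2), of "map (\<lambda>i. (a i, b i)) xs" "map (\<lambda>i. (c i, d i)) ys"]
    unfolding xs(2)[symmetric] ys(2)[symmetric] sum.distinct_set_conv_list[OF xs(1)]
      sum.distinct_set_conv_list[OF ys(1)]
    by (simp add: comp_def)
qed

section \<open>Comatrices and the antipode\<close>

context hopf_algebra
begin

abbreviation tn where "tn \<equiv> tensor scale scale"
text \<open>In Sweedler notation, \<open>sw \<beta> x\<close> is \<open>\<beta> x\<^sub>1 x\<^sub>2\<close>.\<close>

abbreviation sw where "sw \<beta> x \<equiv> tlift scale scale \<beta> (\<Delta> x)"

lemmas vsQ = vector_space_axioms

lemma k_algebraQ: "k_algebra scale"
  by unfold_locales

lemma linear_mult_left: "Vector_Spaces.linear scale scale (\<lambda>x. x * y)"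
  by (simp add: linear_iff_add_scale vsQ distrib_right scale_mult_left)

lemma linear_mult_right: "Vector_Spaces.linear scale scale (\<lambda>x. y * x)"
  by (simp add: linear_iff_add_scale vsQ distrib_left scale_mult_right)

lemma linear_scale_left: "Vector_Spaces.linear (*) scale (\<lambda>c. scale c y)"
  by (simp add: linear_iff_add_scale vsQ vector_space_mult scale_left_distrib)

lemma lin_comp:
  "Vector_Spaces.linear s1 s2 f \<Longrightarrow> Vector_Spaces.linear s2 s3 g \<Longrightarrow> Vector_Spaces.linear s1 s3 (\<lambda>x. g (f x))"
  using Vector_Spaces.linear_compose[of s1 s2 f s3 g] by (simp add: comp_def)

lemma bilinear_onQI:
  assumes "vector_space s3"
    and "\<And>w. Vector_Spaces.linear scale s3 (\<lambda>u. \<beta> u w)" "\<And>u. Vector_Spaces.linear scale s3 (\<beta> u)"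
  shows "bilinear_on scale scale s3 UNIV UNIV \<beta>"
  using bilinear_onI[OF vsQ vsQ assms] .

lemmas bilinear_onQ_linear = bilinear_on_linear[OF vsQ vsQ]

lemma sw_sum:
  assumes "vector_space s3" "bilinear_on scale scale s3 UNIV UNIV \<beta>"
    and "\<Delta> x = (\<Sum>i\<in>I. tn (u i) (w i))"
  shows "sw \<beta> x = (\<Sum>i\<in>I. \<beta> (u i) (w i))"
  unfolding assms(3)
  by (rule tensor_lift_sum_tensor[OF vsQ vsQ assms(1) subspace_UNIV subspace_UNIV assms(2)]) auto

lemma linear_sw:
  "vector_space s3 \<Longrightarrow> bilinear_on scale scale s3 UNIV UNIV \<beta> \<Longrightarrow> Vector_Spaces.linear scale s3 (sw \<beta>)"
  using linear_tl_arg[OF vsQ vsQ _ vsQ _ comult_linear comult_in] by blast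

lemma linear_sw_param:
  assumes "vector_space s3" "vector_space s4"
    and "\<And>q. bilinear_on scale scale s3 UNIV UNIV (\<gamma> q)"
    and "\<And>u w. Vector_Spaces.linear s4 s3 (\<lambda>q. \<gamma> q u w)"
  shows "Vector_Spaces.linear s4 s3 (\<lambda>q. sw (\<gamma> q) x)"
  using linear_tl_param[OF vsQ vsQ assms comult_in] .

lemma map_sw:
  assumes "vector_space s3" "bilinear_on scale scale s3 UNIV UNIV \<beta>" "vector_space s4"
    and "Vector_Spaces.linear s3 s4 f"
  shows "f (sw \<beta> x) = sw (\<lambda>u w. f (\<beta> u w)) x"
  using linear_tl[OF vsQ vsQ assms(1,2,4,3) comult_in] .

lemma comult_obtain:
  obtains xs where "\<Delta> x = (\<Sum>(a, b)\<leftarrow>xs. tn a b)"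
  using ts_list[OF vsQ vsQ comult_in] by metis

text \<open>The axiom \<open>coassoc\<close> is an equation in Q \<otimes> (Q \<otimes> Q). Applying
  to it the linear map \<open>F\<close> induced by \<gamma> gives the form in which Sweedler
  calculations use it.\<close>

lemma sw_coassoc:
  assumes "vector_space s3"
    and l1: "\<And>b c. Vector_Spaces.linear scale s3 (\<lambda>a. \<gamma> a b c)"
    and l2: "\<And>a c. Vector_Spaces.linear scale s3 (\<lambda>b. \<gamma> a b c)"
    and l3: "\<And>a b. Vector_Spaces.linear scale s3 (\<lambda>c. \<gamma> a b c)"
  shows "sw (\<lambda>a b. sw (\<lambda>a1 a2. \<gamma> a1 a2 b) a) x = sw (\<lambda>a b. sw (\<lambda>b1 b2. \<gamma> a b1 b2) b) x"
proof -
  note vsT = vector_space_fscale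
  note sQ = subspace_UNIV
  define T where "T = (tensor scale fscale :: 'q \<Rightarrow> ('q, 'q, 'k) tensor \<Rightarrow> _)"
  have T1: "Vector_Spaces.linear scale fscale (\<lambda>u. T u t)" for t
    unfolding T_def by (rule linear_tensor_left[OF vsQ])
  have T2: "Vector_Spaces.linear fscale fscale (T u)" for u
    unfolding T_def by (rule linear_tensor_right[OF vsT])
  have t1: "Vector_Spaces.linear scale fscale (\<lambda>u. tn u w)" for w
    by (rule linear_tensor_left[OF vsQ])
  have t2: "Vector_Spaces.linear scale fscale (tn u)" for u
    by (rule linear_tensor_right[OF vsQ])
  \<comment> \<open>The lift of \<open>\<gamma> u\<close> is linear on genuine tensors only, not on
    all functions of that type. Hence the second factor is restricted to
    \<open>tspace scale scale\<close>, and membership has to be tracked from here on.\<close>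
  define F where "F = tensor_lift scale fscale UNIV (tspace scale scale) (\<lambda>u t. tlift scale scale (\<gamma> u) t)"
  have bg: "bilinear_on scale scale s3 UNIV UNIV (\<gamma> a)" for a
    by (rule bilinear_onQI) (use assms in auto)
  have bF: "bilinear_on scale fscale s3 UNIV (tspace scale scale) (\<lambda>u t. tlift scale scale (\<gamma> u) t)"
    using linear_tl_param[OF vsQ vsQ assms(1) vsQ bg l1]
    unfolding bilinear_on_def linear_iff_add_scale[OF vsQ assms(1)]
    by (simp add: tensor_lift_add[OF vsQ vsQ assms(1) sQ sQ bg] tensor_lift_scale[OF vsQ vsQ assms(1) sQ sQ bg])
  note Fprems = vsQ vsT assms(1) sQ subspace_tensor_space bF
  have F_T: "F (T u t) = tlift scale scale (\<gamma> u) t" if "t \<in> tspace scale scale" for u t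
    unfolding F_def T_def using tensor_lift_tensor[OF Fprems _ that] by simp
  have in_T: "T u t \<in> tensor_space scale fscale UNIV (tspace scale scale)" if "t \<in> tspace scale scale" for u t
    unfolding T_def using that by (simp add: tensor_in_tensor_space)
  have F_sum: "F (\<Sum>i\<leftarrow>xs. f i) = (\<Sum>i\<leftarrow>xs. F (f i))"
    if "\<And>i. i \<in> set xs \<Longrightarrow> f i \<in> tensor_space scale fscale UNIV (tspace scale scale)" for xs f
    unfolding F_def by (rule tensor_lift_sum_list[OF Fprems that])
  define \<tau> where "\<tau> = (\<lambda>q x1 x2. T x1 (tn x2 q))"
  have b\<tau>: "bilinear_on scale scale fscale UNIV UNIV (\<tau> q)" for q
    unfolding \<tau>_def by (rule bilinear_onQI[OF vsT T1 lin_comp[OF t1 T2]])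
  have b1: "bilinear_on scale scale fscale UNIV UNIV (\<lambda>x q. sw (\<tau> q) x)"
    by (rule bilinear_onQI[OF vsT linear_sw[OF vsT b\<tau>] linear_sw_param[OF vsT vsQ b\<tau>]])
       (simp add: \<tau>_def lin_comp[OF t2 T2])
  have b2: "bilinear_on scale scale fscale UNIV UNIV (\<lambda>x y. T x (\<Delta> y))"
    by (rule bilinear_onQI[OF vsT T1 lin_comp[OF comult_linear T2]])
  have b3: "bilinear_on scale scale s3 UNIV UNIV (\<lambda>a1 a2. \<gamma> a1 a2 b)" for b
    by (rule bilinear_onQI) (use assms in auto)
  have b4: "bilinear_on scale scale s3 UNIV UNIV (\<lambda>a b. sw (\<lambda>a1 a2. \<gamma> a1 a2 b) a)"
    by (rule bilinear_onQI[OF assms(1) linear_sw[OF assms(1) b3] linear_sw_param[OF assms(1) vsQ b3 l3]])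
  have b5: "bilinear_on scale scale s3 UNIV UNIV (\<lambda>a b. sw (\<gamma> a) b)"
    by (rule bilinear_onQI[OF assms(1) linear_sw_param[OF assms(1) vsQ bg l1] linear_sw[OF assms(1) bg]])
  have tl_list: "tlift scale scale \<beta> (\<Sum>(u, w)\<leftarrow>xs. tn u w) = (\<Sum>(u, w)\<leftarrow>xs. \<beta> u w)"
    if "vector_space s" "bilinear_on scale scale s UNIV UNIV \<beta>"
    for s :: "'k \<Rightarrow> 'z::ab_group_add \<Rightarrow> 'z" and \<beta> xs
    by (rule tensor_lift_eq[OF vsQ vsQ that(1) sQ sQ that(2)]) auto
  obtain xs where xs: "\<Delta> x = (\<Sum>(a, b)\<leftarrow>xs. tn a b)" by (rule comult_obtain)
  have F\<tau>: "F (sw (\<tau> q) a) = sw (\<lambda>a1 a2. \<gamma> a1 a2 q) a" "sw (\<tau> q) a \<in> tensor_space scale fscale UNIV (tspace scale scale)" for a q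
  proof -
    obtain ys where ys: "\<Delta> a = (\<Sum>(a, b)\<leftarrow>ys. tn a b)" by (rule comult_obtain)
    have eq: "sw (\<tau> q) a = (\<Sum>p\<leftarrow>ys. T (fst p) (tn (snd p) q))"
      unfolding ys tl_list[OF vsT b\<tau>] by (simp add: \<tau>_def case_prod_unfold)
    have in_ts: "tn v w \<in> tspace scale scale" for v w by (simp add: tensor_in_tensor_space)
    show "F (sw (\<tau> q) a) = sw (\<lambda>a1 a2. \<gamma> a1 a2 q) a"
      unfolding eq F_sum[OF in_T[OF in_ts]] F_T[OF in_ts]
        tensor_lift_tensor[OF vsQ vsQ assms(1) sQ sQ bg UNIV_I UNIV_I]
      unfolding ys tl_list[OF assms(1) b3] by (simp add: case_prod_unfold)
    show "sw (\<tau> q) a \<in> tensor_space scale fscale UNIV (tspace scale scale)"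
      unfolding eq by (intro tensor_space_sum_list in_T in_ts)
  qed
  have "sw (\<lambda>a b. sw (\<lambda>a1 a2. \<gamma> a1 a2 b) a) x = (\<Sum>p\<leftarrow>xs. F (sw (\<tau> (snd p)) (fst p)))"
    unfolding xs tl_list[OF assms(1) b4] F\<tau> by (simp add: case_prod_unfold)
  also have "\<dots> = F (sw (\<lambda>x q. sw (\<tau> q) x) x)"
    unfolding xs tl_list[OF vsT b1] by (simp add: F_sum F\<tau>(2) case_prod_unfold)
  also have "sw (\<lambda>x q. sw (\<tau> q) x) x = sw (\<lambda>x y. T x (\<Delta> y)) x"
    using coassoc[of x] by (simp add: \<tau>_def T_def)
  also have "F \<dots> = (\<Sum>p\<leftarrow>xs. F (T (fst p) (\<Delta> (snd p))))"
    unfolding xs tl_list[OF vsT b2] by (simp add: F_sum in_T comult_in case_prod_unfold)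
  also have "\<dots> = sw (\<lambda>a b. sw (\<gamma> a) b) x"
    unfolding F_T[OF comult_in] xs tl_list[OF assms(1) b5] by (simp add: case_prod_unfold)
  finally show ?thesis .
qed

lemma linear_antipode_mult: "Vector_Spaces.linear scale scale (\<lambda>x. S x * y)" "Vector_Spaces.linear scale scale (\<lambda>x. y * S x)"
  by (auto intro: lin_comp[OF antipode_linear] linear_mult_left linear_mult_right)

lemma linear_counit_scale: "Vector_Spaces.linear scale scale (\<lambda>x. scale (\<epsilon> x) y)"
  by (auto intro: lin_comp[OF counit_linear] linear_scale_left)

lemma linear_scaleR: "Vector_Spaces.linear scale scale (scale c)"
  by (simp add: linear_iff_add_scale vsQ scale_right_distrib mult.commute)

lemmas bil_antipode_left = bilinear_onQI[OF vsQ linear_antipode_mult(1) linear_mult_right]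
lemmas bil_antipode_right = bilinear_onQI[OF vsQ linear_mult_left linear_antipode_mult(2)]
lemmas bil_counit_left = bilinear_onQI[OF vsQ linear_counit_scale linear_scaleR]
lemmas bil_counit_right = bilinear_onQI[OF vsQ linear_scaleR linear_counit_scale]

lemma one_neq_zero: "(1 :: 'q) \<noteq> 0"
  using counit_one lin_zero[OF counit_linear] by auto

lemma antipode_one: "S 1 = 1"
proof -
  have "sw (\<lambda>x y. S x * y) 1 = S 1 * 1"
    using sw_sum[OF vsQ bil_antipode_left, of 1 "\<lambda>_. 1" "\<lambda>_. 1" "{()}"] comult_one by simp
  thus ?thesis using antipode_left[of 1] by (simp add: counit_one)
qed

text \<open>The matrix coefficients of a right comodule with basis \<open>E\<close>: column
  \<open>j\<close> holds the second legs of the coaction on \<open>j\<close>.\<close>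

definition comatrix :: "'i set \<Rightarrow> ('i \<Rightarrow> 'i \<Rightarrow> 'q) \<Rightarrow> bool" where
  "comatrix E p \<longleftrightarrow> finite E \<and>
     (\<forall>i\<in>E. \<forall>j\<in>E. \<Delta> (p i j) = (\<Sum>k\<in>E. tn (p i k) (p k j)) \<and> \<epsilon> (p i j) = (if i = j then 1 else 0))"

text \<open>The antipode axioms at \<open>p i j\<close>: applying S to each entry inverts the matrix
  \<open>p\<close>.\<close>

lemma
  assumes "comatrix E p" "i \<in> E" "j \<in> E"
  shows comatrix_antipode_left: "(\<Sum>k\<in>E. S (p i k) * p k j) = (if i = j then 1 else 0)"
    and comatrix_antipode_right: "(\<Sum>k\<in>E. p i k * S (p k j)) = (if i = j then 1 else 0)"
proof -
  have D: "\<Delta> (p i j) = (\<Sum>k\<in>E. tn (p i k) (p k j))" and e: "\<epsilon> (p i j) = (if i = j then 1 else 0)"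
    using assms by (auto simp: comatrix_def)
  show "(\<Sum>k\<in>E. S (p i k) * p k j) = (if i = j then 1 else 0)"
    using antipode_left[of "p i j"] unfolding sw_sum[OF vsQ bil_antipode_left D] e by simp
  show "(\<Sum>k\<in>E. p i k * S (p k j)) = (if i = j then 1 else 0)"
    using antipode_right[of "p i j"] unfolding sw_sum[OF vsQ bil_antipode_right D] e by simp
qed

text \<open>Compare the coefficients of the basis vectors in the comodule axioms. The module is kept
  general because the lemma serves both \<alpha> on \<open>V\<close> and \<Delta> on a coideal of Q;
  \<open>E\<close> need not span the whole type, so the axioms are required at elements of
  \<open>E\<close> only.\<close>

lemma comatrix_of_comodule:
  fixes sM :: "'k \<Rightarrow> 'm::ab_group_add \<Rightarrow> 'm"
  assumes vsM: "vector_space sM" and "finite E" and ind: "\<not> module.dependent sM E"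
    and \<rho>_lin: "Vector_Spaces.linear sM fscale \<rho>" and \<rho>_in: "\<And>x. \<rho> x \<in> tspace sM scale"
    and \<rho>: "\<And>e. e \<in> E \<Longrightarrow> \<rho> e = (\<Sum>i\<in>E. tensor sM scale i (p i e))"
    and coas: "\<And>e. e \<in> E \<Longrightarrow> tlift sM scale
         (\<lambda>x q. tlift sM scale (\<lambda>y r. tensor sM fscale y (tn r q)) (\<rho> x)) (\<rho> e) =
       tlift sM scale (\<lambda>x q. tensor sM fscale x (\<Delta> q)) (\<rho> e)"
    and coun: "\<And>e. e \<in> E \<Longrightarrow> tlift sM scale (\<lambda>x q. sM (\<epsilon> q) x) (\<rho> e) = e"
  shows "comatrix E p"
proof -
  interpret M: vector_space sM by fact
  note vsT = vector_space_fscale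
  define T where "T = (tensor sM fscale :: 'm \<Rightarrow> ('q, 'q, 'k) tensor \<Rightarrow> _)"
  have T1: "Vector_Spaces.linear sM fscale (\<lambda>u. T u t)" for t
    unfolding T_def by (rule linear_tensor_left[OF vsM])
  have T2: "Vector_Spaces.linear fscale fscale (T u)" for u
    unfolding T_def by (rule linear_tensor_right[OF vsT])
  have t1: "Vector_Spaces.linear scale fscale (\<lambda>u. tn u w)" for w
    by (rule linear_tensor_left[OF vsQ])
  have t2: "Vector_Spaces.linear scale fscale (tn u)" for u
    by (rule linear_tensor_right[OF vsQ])
  define \<tau> where "\<tau> = (\<lambda>q x1 x2. T x1 (tn x2 q))"
  have b\<tau>: "bilinear_on sM scale fscale UNIV UNIV (\<tau> q)" for q
    unfolding \<tau>_def by (rule bilinear_onI[OF vsM vsQ vsT T1 lin_comp[OF t1 T2]])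
  have b1: "bilinear_on sM scale fscale UNIV UNIV (\<lambda>x q. tlift sM scale (\<tau> q) (\<rho> x))"
    by (rule bilinear_onI[OF vsM vsQ vsT linear_tl_arg[OF vsM vsQ vsT vsM b\<tau> \<rho>_lin \<rho>_in]
          linear_tl_param[OF vsM vsQ vsT vsQ b\<tau> _ \<rho>_in]])
       (simp add: \<tau>_def lin_comp[OF t2 T2])
  have b2: "bilinear_on sM scale fscale UNIV UNIV (\<lambda>x q. T x (\<Delta> q))"
    by (rule bilinear_onI[OF vsM vsQ vsT T1 lin_comp[OF comult_linear T2]])
  have b3: "bilinear_on sM scale sM UNIV UNIV (\<lambda>x q. sM (\<epsilon> q) x)"
    using counit_linear by (auto simp: bilinear_on_def M.scale_right_distrib M.scale_left_distrib
        lin_add lin_scale mult.commute)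
  note tls = tensor_lift_sum_tensor[OF vsM vsQ _ M.subspace_UNIV subspace_UNIV _ UNIV_I UNIV_I]
  show ?thesis
    unfolding comatrix_def
  proof (intro conjI ballI)
    fix i e assume "i \<in> E" "e \<in> E"
    have "(\<Sum>j\<in>E. T j (\<Sum>i\<in>E. tn (p j i) (p i e))) = (\<Sum>j\<in>E. \<Sum>i\<in>E. T j (tn (p j i) (p i e)))"
      by (simp add: lin_sum[OF T2])
    also have "\<dots> = (\<Sum>i\<in>E. \<Sum>j\<in>E. T j (tn (p j i) (p i e)))"
      by (rule sum.swap)
    also have "\<dots> = (\<Sum>i\<in>E. tlift sM scale (\<tau> (p i e)) (\<rho> i))"
      by (intro sum.cong refl) (simp add: \<rho> tls[OF vsT b\<tau>], simp add: \<tau>_def)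
    also have "\<dots> = tlift sM scale (\<lambda>x q. tlift sM scale (\<tau> q) (\<rho> x)) (\<rho> e)"
      unfolding \<rho>[OF \<open>e \<in> E\<close>] tls[OF vsT b1] ..
    also have "\<dots> = tlift sM scale (\<lambda>x q. T x (\<Delta> q)) (\<rho> e)"
      using coas[OF \<open>e \<in> E\<close>] by (simp add: \<tau>_def T_def)
    also have "\<dots> = (\<Sum>j\<in>E. T j (\<Delta> (p j e)))"
      unfolding \<rho>[OF \<open>e \<in> E\<close>] tls[OF vsT b2] ..
    finally show "\<Delta> (p i e) = (\<Sum>k\<in>E. tn (p i k) (p k e))"
      unfolding T_def by (rule tensor_coeff_unique[OF vsM vsT \<open>finite E\<close> ind \<open>i \<in> E\<close> sym])
    have "(\<Sum>i\<in>E. sM (\<epsilon> (p i e)) i) = e"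
      using coun[OF \<open>e \<in> E\<close>] unfolding \<rho>[OF \<open>e \<in> E\<close>] tls[OF vsM b3] .
    moreover have "(\<Sum>i\<in>E. sM (if i = e then 1 else 0) i) = (\<Sum>i\<in>E. if i = e then i else 0)"
      by (intro sum.cong) auto
    ultimately have "(\<Sum>i\<in>E. sM (\<epsilon> (p i e) - (if i = e then 1 else 0)) i) = 0"
      using \<open>finite E\<close> \<open>e \<in> E\<close> by (simp add: M.scale_left_diff_distrib sum_subtractf)
    from M.independentD[OF ind \<open>finite E\<close> order_refl this \<open>i \<in> E\<close>]
    show "\<epsilon> (p i e) = (if i = e then 1 else 0)" by simp
  qed fact
qed

lemma comult_mult_list:
  assumes "\<Delta> x = (\<Sum>(a, b)\<leftarrow>xs. tn a b)" "\<Delta> y = (\<Sum>(a, b)\<leftarrow>ys. tn a b)"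
  shows "\<Delta> (x * y) = (\<Sum>(a, b)\<leftarrow>xs. \<Sum>(c, d)\<leftarrow>ys. tn (a * c) (b * d))"
  unfolding comult_mult assms by (rule tensor_mult_tensor_list[OF k_algebraQ k_algebraQ])

lemma comult_mult_sum:
  assumes "finite I" "finite J"
    and "\<Delta> x = (\<Sum>i\<in>I. tn (a i) (b i))" "\<Delta> y = (\<Sum>j\<in>J. tn (c j) (d j))"
  shows "\<Delta> (x * y) = (\<Sum>i\<in>I. \<Sum>j\<in>J. tn (a i * c j) (b i * d j))"
  unfolding comult_mult assms by (rule tensor_mult_sum_tensor[OF k_algebraQ k_algebraQ assms(1,2)])

lemma sw_list:
  assumes "vector_space s3" "bilinear_on scale scale s3 UNIV UNIV \<beta>" "\<Delta> x = (\<Sum>(a, b)\<leftarrow>xs. tn a b)"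
  shows "sw \<beta> x = (\<Sum>(a, b)\<leftarrow>xs. \<beta> a b)"
  unfolding assms(3)
  by (rule tensor_lift_eq[OF vsQ vsQ assms(1) subspace_UNIV subspace_UNIV assms(2)]) auto

lemma sw_comatrix_mult:
  assumes "vector_space s3" "bilinear_on scale scale s3 UNIV UNIV \<beta>"
    and "comatrix E p" "i \<in> E" "j \<in> E"
  shows "sw \<beta> (p i j * y) = (\<Sum>k\<in>E. sw (\<lambda>a b. \<beta> (p i k * a) (p k j * b)) y)"
proof -
  obtain ys where ys: "\<Delta> y = (\<Sum>(a, b)\<leftarrow>ys. tn a b)" by (rule comult_obtain)
  obtain es where es: "distinct es" "set es = E"
    using finite_distinct_list assms(3) unfolding comatrix_def by blast
  have "\<Delta> (p i j) = (\<Sum>(a, b)\<leftarrow>map (\<lambda>k. (p i k, p k j)) es. tn a b)"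
    using assms(3-5) unfolding comatrix_def es(2)[symmetric] sum.distinct_set_conv_list[OF es(1)]
    by (simp add: comp_def)
  from comult_mult_list[OF this ys]
  have D: "\<Delta> (p i j * y) = (\<Sum>(a, b)\<leftarrow>concat (map (\<lambda>k. map (\<lambda>(c, d). (p i k * c, p k j * d)) ys) es). tn a b)"
    by (simp add: comp_def sum_list_map_concat case_prod_unfold)
  have b: "bilinear_on scale scale s3 UNIV UNIV (\<lambda>a b. \<beta> (p i k * a) (p k j * b))" for k
    by (intro bilinear_onQI assms(1) lin_comp[OF linear_mult_right bilinear_onQ_linear(1)[OF assms(1,2)]]
         lin_comp[OF linear_mult_right bilinear_onQ_linear(2)[OF assms(1,2)]])
  show ?thesis
    unfolding sw_list[OF assms(1,2) D] sw_list[OF assms(1) b ys] unfolding es(2)[symmetric] sum.distinct_set_conv_list[OF es(1)]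
    by (simp add: comp_def sum_list_map_concat case_prod_unfold)
qed

text \<open>
  The sum over \<open>j\<close> of \<open>S (p\<^sub>i\<^sub>j y\<^sub>1) p\<^sub>j\<^sub>k y\<^sub>2 S y\<^sub>3\<close> is evaluated in two ways.
\<close>

lemma antipode_comatrix_mult:
  assumes p: "comatrix E p" and i: "i \<in> E" and l: "l \<in> E"
  shows "S (p i l * y) = S y * S (p i l)"
proof -
  have "finite E" using p by (simp add: comatrix_def)
  \<comment> \<open>As matrices: the entries \<open>S (p i j * y)\<close> times \<open>p\<close>
    give the diagonal matrix with entries \<open>S y\<close>. Multiplying on the right by the
    inverse S(p) then yields the claim.\<close>
  have key: "(\<Sum>j\<in>E. S (p i j * y) * p j k) = (if i = k then S y else 0)" if k: "k \<in> E" for k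
  proof -
    define \<gamma> where "\<gamma> = (\<lambda>a b c. \<Sum>j\<in>E. S (p i j * a) * (p j k * b) * S c)"
    have lin_sumI: "Vector_Spaces.linear scale scale (\<lambda>x. \<Sum>j\<in>E. f j x)"
      if "\<And>j. Vector_Spaces.linear scale scale (f j)" for f :: "_ \<Rightarrow> 'q \<Rightarrow> 'q"
      using that by (simp add: linear_iff_add_scale vsQ sum.distrib scale_sum_right)
    have l1: "Vector_Spaces.linear scale scale (\<lambda>a. \<gamma> a b c)" for b c
      unfolding \<gamma>_def by (intro lin_sumI lin_comp[OF _ linear_mult_left] lin_comp[OF linear_mult_right antipode_linear])
    have l2: "Vector_Spaces.linear scale scale (\<lambda>b. \<gamma> a b c)" for a c
      unfolding \<gamma>_def by (intro lin_sumI lin_comp[OF _ linear_mult_left] lin_comp[OF linear_mult_right linear_mult_right])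
    have l3: "Vector_Spaces.linear scale scale (\<lambda>c. \<gamma> a b c)" for a b
      unfolding \<gamma>_def by (intro lin_sumI linear_antipode_mult)
    \<comment> \<open>Splitting the first leg: the sum over \<open>j\<close> is the coproduct of
      \<open>p i k * a\<close>, so the left antipode axiom applies to it.\<close>
    have "sw (\<lambda>a b. sw (\<lambda>a1 a2. \<gamma> a1 a2 b) a) y = (if i = k then S y else 0)"
    proof -
      have "sw (\<lambda>a1 a2. \<gamma> a1 a2 b) a = (if i = k then scale (\<epsilon> a) (S b) else 0)" for a b
      proof -
        have bb: "bilinear_on scale scale scale UNIV UNIV (\<lambda>u v. S (p i j * u) * (p j k * v))" for j
          by (intro bilinear_onQI vsQ lin_comp[OF _ linear_mult_left] lin_comp[OF linear_mult_right antipode_linear]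
              lin_comp[OF linear_mult_right linear_mult_right])
        have "sw (\<lambda>a1 a2. \<gamma> a1 a2 b) a = (\<Sum>j\<in>E. sw (\<lambda>u v. S (p i j * u) * (p j k * v)) a) * S b"
        proof -
          obtain as where as: "\<Delta> a = (\<Sum>(a, b)\<leftarrow>as. tn a b)" by (rule comult_obtain)
          have b\<gamma>: "bilinear_on scale scale scale UNIV UNIV (\<lambda>a1 a2. \<gamma> a1 a2 b)"
            by (rule bilinear_onQI[OF vsQ l1 l2])
          have bs: "bilinear_on scale scale scale UNIV UNIV (\<lambda>u v. \<Sum>j\<in>E. S (p i j * u) * (p j k * v))"
            by (intro bilinear_onQI vsQ lin_sumI bilinear_onQ_linear[OF vsQ bb])
          show ?thesis
            unfolding sw_list[OF vsQ b\<gamma> as] sw_list[OF vsQ bb as]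
            by (simp add: \<gamma>_def case_prod_unfold sum_list_mult_const[symmetric] sum_distrib_right
                sum_list_sum_nth sum.swap[of _ E])
        qed
        also have "(\<Sum>j\<in>E. sw (\<lambda>u v. S (p i j * u) * (p j k * v)) a) = sw (\<lambda>u v. S u * v) (p i k * a)"
          by (rule sw_comatrix_mult[OF vsQ bil_antipode_left p i k, symmetric])
        also have "\<dots> = scale (\<epsilon> (p i k) * \<epsilon> a) 1" by (simp add: antipode_left counit_mult)
        also have "\<epsilon> (p i k) = (if i = k then 1 else 0)" using p i k by (simp add: comatrix_def)
        finally show ?thesis by (simp add: scale_mult_left)
      qed
      moreover have "sw (\<lambda>a b. scale (\<epsilon> a) (S b)) y = S y"
        using map_sw[OF vsQ bil_counit_left vsQ antipode_linear, of y]
        by (simp add: counit_left lin_scale[OF antipode_linear])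
      moreover have "sw (\<lambda>a b. 0 :: 'q) y = 0"
      proof -
        have b0: "bilinear_on scale scale scale UNIV UNIV (\<lambda>a b. 0 :: 'q)" by (simp add: bilinear_on_def)
        obtain ys where ys: "\<Delta> y = (\<Sum>(a, b)\<leftarrow>ys. tn a b)" by (rule comult_obtain)
        show ?thesis unfolding sw_list[OF vsQ b0 ys] by (simp add: case_prod_unfold)
      qed
      ultimately show ?thesis by simp
    qed
    \<comment> \<open>Splitting the second leg: the right antipode axiom removes the last two
      factors.\<close>
    moreover have "sw (\<lambda>a b. sw (\<lambda>b1 b2. \<gamma> a b1 b2) b) y = (\<Sum>j\<in>E. S (p i j * y) * p j k)"
    proof -
      define c where "c = (\<lambda>a. \<Sum>j\<in>E. S (p i j * a) * p j k)"
      have c: "Vector_Spaces.linear scale scale c"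
        unfolding c_def by (intro lin_sumI lin_comp[OF _ linear_mult_left] lin_comp[OF linear_mult_right antipode_linear])
      have "\<gamma> a = (\<lambda>u v. c a * (u * S v))" for a
        by (simp add: \<gamma>_def c_def sum_distrib_right mult.assoc fun_eq_iff)
      hence "sw (\<gamma> a) b = scale (\<epsilon> b) (c a)" for a b
        using map_sw[OF vsQ bil_antipode_right vsQ linear_mult_right, of "c a" b, symmetric]
        by (simp add: antipode_right scale_mult_right)
      moreover have "sw (\<lambda>a b. scale (\<epsilon> b) (c a)) y = c y"
        using map_sw[OF vsQ bil_counit_right vsQ c, of y]
        by (simp add: counit_right lin_scale[OF c])
      ultimately show ?thesis by (simp add: c_def)
    qed
    ultimately show ?thesis using sw_coassoc[OF vsQ l1 l2 l3, of y] by simp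
  qed
  have "S y * S (p i l) = (\<Sum>k\<in>E. (if i = k then S y else 0) * S (p k l))"
    using i \<open>finite E\<close> by (simp add: if_distrib[of "\<lambda>x. x * _"] cong: if_cong)
  also have "\<dots> = (\<Sum>k\<in>E. \<Sum>j\<in>E. S (p i j * y) * (p j k * S (p k l)))"
    by (intro sum.cong refl) (simp add: key[symmetric] sum_distrib_right mult.assoc)
  also have "\<dots> = (\<Sum>j\<in>E. S (p i j * y) * (\<Sum>k\<in>E. p j k * S (p k l)))"
    by (subst sum.swap) (simp add: sum_distrib_left)
  also have "\<dots> = (\<Sum>j\<in>E. if j = l then S (p i j * y) else 0)"
    by (intro sum.cong refl) (simp add: comatrix_antipode_right[OF p _ l])
  also have "\<dots> = S (p i l * y)" using l \<open>finite E\<close> by simp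
  finally show ?thesis ..
qed

end

text \<open>Nakayama's lemma for the ring as a left module over a commutative subring R. In place of
  a determinant, the generators are eliminated one at a time, each by means of an element congruent
  to 1 modulo I.\<close>

lemma nakayama:
  fixes R I :: "'r::{ring, monoid_mult} set"
  assumes R: "\<And>x y. x \<in> R \<Longrightarrow> y \<in> R \<Longrightarrow> x + y \<in> R" "\<And>x y. x \<in> R \<Longrightarrow> y \<in> R \<Longrightarrow> x - y \<in> R"
      "\<And>x y. x \<in> R \<Longrightarrow> y \<in> R \<Longrightarrow> x * y \<in> R" "1 \<in> R" "\<And>x y. x \<in> R \<Longrightarrow> y \<in> R \<Longrightarrow> x * y = y * x"
    and I: "I \<subseteq> R" "0 \<in> I" "\<And>x y. x \<in> I \<Longrightarrow> y \<in> I \<Longrightarrow> x + y \<in> I" "\<And>x y. x \<in> R \<Longrightarrow> y \<in> I \<Longrightarrow> x * y \<in> I"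
    and "finite F" and gen: "\<And>x. \<exists>c. (\<forall>m. c m \<in> R) \<and> x = (\<Sum>m\<in>F. c m * m)"
    and one: "1 = (\<Sum>j\<in>J. b j * s j)" "\<And>j. j \<in> J \<Longrightarrow> b j \<in> I"
  shows "1 \<in> I"
proof -
  have sumI: "(\<Sum>j\<in>K. f j) \<in> I" if "\<And>j. j \<in> K \<Longrightarrow> f j \<in> I" for f and K :: "'s set"
    using that by (induction K rule: infinite_finite_induct) (auto simp: I)
  have Ir: "x * y \<in> I" if "x \<in> I" "y \<in> R" for x y
    using I(4)[OF that(2,1)] R(5)[OF that(2)] that(1) I(1) by auto
  \<comment> \<open>Generalised for the induction: \<open>F\<close> has to generate only the
    multiples by some \<open>1 - a\<close> with \<open>a\<close> in I. With no generators left,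
    \<open>1 - a\<close> is 0 and so 1 lies in I.\<close>
  have "1 \<in> I" if "a \<in> I" "\<And>x. \<exists>c. (\<forall>m. c m \<in> R) \<and> (1 - a) * x = (\<Sum>m\<in>F. c m * m)" for a
    using \<open>finite F\<close> that
  proof (induction F arbitrary: a)
    case empty
    from empty(2)[of 1] empty(1) show ?case by simp
  next
    case (insert m F)
    note aR = subsetD[OF I(1) \<open>a \<in> I\<close>]
    \<comment> \<open>Inserting \<open>1 = (\<Sum>j\<in>J. b j * s j)\<close> in front of
      \<open>x\<close> improves the coefficients from R to I. Only elements of R are commuted; the
      \<open>s j\<close> stay in place.\<close>
    have "\<exists>c. (\<forall>m. c m \<in> I) \<and> (1 - a) * x = (\<Sum>m\<in>insert m F. c m * m)" for x
    proof -
      have "\<forall>j. \<exists>c. (\<forall>m. c m \<in> R) \<and> (1 - a) * (s j * x) = (\<Sum>m\<in>insert m F. c m * m)"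
        using insert.prems(2) by blast
      then obtain c where c: "\<And>j m. c j m \<in> R"
        "\<And>j. (1 - a) * (s j * x) = (\<Sum>m\<in>insert m F. c j m * m)" by metis
      have "(1 - a) * x = (1 - a) * ((\<Sum>j\<in>J. b j * s j) * x)" using one(1) by simp
      also have "\<dots> = (\<Sum>j\<in>J. ((1 - a) * b j) * (s j * x))"
        by (simp add: sum_distrib_left sum_distrib_right mult.assoc)
      also have "\<dots> = (\<Sum>j\<in>J. b j * ((1 - a) * (s j * x)))"
      proof (intro sum.cong refl)
        fix j assume "j \<in> J"
        have "(1 - a) * b j = b j * (1 - a)"
          by (rule R(5)[OF R(2)[OF R(4) aR] subsetD[OF I(1) one(2)[OF \<open>j \<in> J\<close>]]])
        thus "((1 - a) * b j) * (s j * x) = b j * ((1 - a) * (s j * x))" by (simp add: mult.assoc)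
      qed
      also have "\<dots> = (\<Sum>j\<in>J. \<Sum>m\<in>insert m F. b j * c j m * m)"
        unfolding c(2) by (simp only: sum_distrib_left mult.assoc)
      also have "\<dots> = (\<Sum>m\<in>insert m F. (\<Sum>j\<in>J. b j * c j m) * m)"
        by (subst sum.swap) (simp only: sum_distrib_right)
      finally have "(1 - a) * x = (\<Sum>m\<in>insert m F. (\<Sum>j\<in>J. b j * c j m) * m)" .
      moreover have "(\<Sum>j\<in>J. b j * c j m) \<in> I" for m
        by (intro sumI Ir one(2) c(1))
      ultimately show ?thesis by (intro exI[of _ "\<lambda>m. \<Sum>j\<in>J. b j * c j m"]) simp
    qed
    then obtain e where e: "\<And>n. e n \<in> I" "(1 - a) * m = (\<Sum>n\<in>insert m F. e n * n)" by blast
    have eR: "e n \<in> R" for n using e(1) I(1) by blast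
    \<comment> \<open>Congruent to 1 modulo I, and \<open>u * m\<close> no longer involves the
      generator \<open>m\<close>.\<close>
    define u where "u = 1 - (a + e m)"
    have uR: "u \<in> R" unfolding u_def by (rule R(2)[OF R(4) R(1)[OF aR eR]])
    have um: "u * m = (\<Sum>n\<in>F. e n * n)"
      using e(2) insert.hyps by (simp add: u_def algebra_simps)
    \<comment> \<open>Chosen so that \<open>1 - a' = u * (1 - a)\<close>: the factor
      \<open>u\<close> removes \<open>m\<close> and changes \<open>a\<close> by an element of I
      only.\<close>
    define a' where "a' = a + (a + e m) * (1 - a)"
    have a': "1 - a' = u * (1 - a)" by (simp add: a'_def u_def algebra_simps)
    have "a' \<in> I"
      unfolding a'_def by (intro I(3) Ir insert.prems(1) e(1) R(2)[OF R(4) aR])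
    moreover have "\<exists>c. (\<forall>m. c m \<in> R) \<and> (1 - a') * x = (\<Sum>m\<in>F. c m * m)" for x
    proof -
      obtain d where d: "\<And>n. d n \<in> R" "(1 - a) * x = (\<Sum>n\<in>insert m F. d n * n)"
        using insert.prems(2) by blast
      have "(1 - a') * x = u * ((1 - a) * x)" by (simp add: a' mult.assoc)
      also have "\<dots> = (u * d m) * m + (\<Sum>n\<in>F. u * d n * n)"
        unfolding d(2) using insert.hyps by (simp add: distrib_left sum_distrib_left mult.assoc)
      also have "(u * d m) * m = d m * (u * m)"
        using R(5)[OF uR d(1)] by (simp add: mult.assoc)
      also have "\<dots> = (\<Sum>n\<in>F. d m * e n * n)" by (simp add: um sum_distrib_left mult.assoc)
      also have "\<dots> + (\<Sum>n\<in>F. u * d n * n) = (\<Sum>n\<in>F. (d m * e n + u * d n) * n)"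
        by (simp add: sum.distrib distrib_right)
      finally show ?thesis
        using R(1)[OF R(3)[OF d(1) eR] R(3)[OF uR d(1)]]
        by (intro exI[of _ "\<lambda>n. d m * e n + u * d n"]) simp
    qed
    ultimately show ?case by (rule insert.IH)
  qed
  from this[of 0] gen I(2) show ?thesis by simp
qed

section \<open>Generated subalgebras\<close>

definition generated :: "('k::field \<Rightarrow> 'a::{ring, monoid_mult} \<Rightarrow> 'a) \<Rightarrow> 'a set \<Rightarrow> 'a set" where
  "generated s X = \<Inter>{R. subalgebra s R \<and> X \<subseteq> R}"

context k_algebra
begin

lemma subalgebra_generated: "subalgebra scale (generated scale X)"
  unfolding generated_def subalgebra_def by (auto intro!: subspace_Inter)

lemma generated_superset: "X \<subseteq> generated scale X"
  unfolding generated_def by blast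

lemma generated_least: "subalgebra scale R \<Longrightarrow> X \<subseteq> R \<Longrightarrow> generated scale X \<subseteq> R"
  unfolding generated_def by blast

text \<open>The elements \<open>a\<close> that map R into itself by left multiplication form a
  subalgebra; once it contains X, applying it to 1 finishes.\<close>

lemma generated_left_induct:
  assumes "subspace R" "1 \<in> R" "\<And>x y. x \<in> X \<Longrightarrow> y \<in> R \<Longrightarrow> x * y \<in> R"
  shows "generated scale X \<subseteq> R"
proof -
  have "subspace {a. \<forall>y\<in>R. a * y \<in> R}"
    by (rule subspaceI)
       (simp_all add: subspace_0[OF assms(1)] subspace_add[OF assms(1)] subspace_scale[OF assms(1)]
         distrib_right scale_mult_left)
  hence "subalgebra scale {a. \<forall>y\<in>R. a * y \<in> R}"
    unfolding subalgebra_def by (simp add: mult.assoc)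
  moreover have "X \<subseteq> {a. \<forall>y\<in>R. a * y \<in> R}"
    using assms(3) by blast
  ultimately have "generated scale X \<subseteq> {a. \<forall>y\<in>R. a * y \<in> R}"
    by (rule generated_least)
  with assms(2) show ?thesis by (metis (no_types, lifting) mem_Collect_eq mult.right_neutral subset_iff)
qed

lemma subalgebra_centralizer: "subalgebra scale {a. \<forall>y\<in>Y. a * y = y * a}"
  unfolding subalgebra_def
proof (intro conjI subspaceI ballI CollectI)
  fix a b y assume ab: "a \<in> {a. \<forall>y\<in>Y. a * y = y * a}" "b \<in> {a. \<forall>y\<in>Y. a * y = y * a}" and "y \<in> Y"
  from ab \<open>y \<in> Y\<close> have a: "a * y = y * a" and b: "b * y = y * b" by blast+
  show "(a + b) * y = y * (a + b)" by (simp add: distrib_left distrib_right a b)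
  have "(a * b) * y = a * (y * b)" by (simp add: mult.assoc b)
  also have "\<dots> = y * (a * b)" by (simp add: mult.assoc[symmetric] a)
  finally show "(a * b) * y = y * (a * b)" .
next
  fix c a y assume "a \<in> {a. \<forall>y\<in>Y. a * y = y * a}" and "y \<in> Y"
  hence a: "a * y = y * a" by blast
  show "scale c a * y = y * scale c a" by (simp add: scale_mult_left scale_mult_right a)
qed simp_all

text \<open>Two passes through the centralizer: first X commutes with everything generated, then
  everything generated commutes with itself.\<close>

lemma generated_commute:
  assumes "\<And>x y. x \<in> X \<Longrightarrow> y \<in> X \<Longrightarrow> x * y = y * x"
    and "a \<in> generated scale X" "b \<in> generated scale X"
  shows "a * b = b * a"
proof -
  have "generated scale X \<subseteq> {a. \<forall>y\<in>X. a * y = y * a}"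
    using assms(1) by (intro generated_least subalgebra_centralizer) auto
  hence "X \<subseteq> {a. \<forall>y\<in>generated scale X. a * y = y * a}" by auto
  hence "generated scale X \<subseteq> {a. \<forall>y\<in>generated scale X. a * y = y * a}"
    by (intro generated_least subalgebra_centralizer)
  with assms show ?thesis by blast
qed

end

section \<open>Comatrices that preserve a form, and the Hopf subalgebra generated by
  coefficients\<close>

context hopf_algebra
begin

text \<open>Stated for an arbitrary matrix G because it serves both the preserved form on
  \<open>V\<close> and the Haar form \<open>h (k * l)\<close> of a coideal.\<close>

lemma antipode_form:
  assumes p: "comatrix E p" and i: "i \<in> E" and l: "l \<in> E"
    and G: "\<And>i j. i \<in> E \<Longrightarrow> j \<in> E \<Longrightarrow>
      (\<Sum>k\<in>E. \<Sum>l\<in>E. scale (G k l) (p k i * p l j)) = scale (G i j) 1"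
  shows "(\<Sum>k\<in>E. scale (G k l) (p k i)) = (\<Sum>m\<in>E. scale (G i m) (S (p m l)))"
proof -
  have "finite E" using p by (simp add: comatrix_def)
  have "(\<Sum>m\<in>E. scale (G i m) (S (p m l))) = (\<Sum>m\<in>E. scale (G i m) 1 * S (p m l))"
    by (simp add: scale_mult_left)
  also have "\<dots> = (\<Sum>m\<in>E. (\<Sum>k\<in>E. \<Sum>n\<in>E. scale (G k n) (p k i * p n m)) * S (p m l))"
    by (intro sum.cong refl) (simp add: G i)
  also have "\<dots> = (\<Sum>m\<in>E. \<Sum>k\<in>E. \<Sum>n\<in>E. scale (G k n) (p k i * (p n m * S (p m l))))"
    by (simp add: sum_distrib_right scale_mult_left mult.assoc)
  also have "\<dots> = (\<Sum>k\<in>E. \<Sum>n\<in>E. \<Sum>m\<in>E. scale (G k n) (p k i * (p n m * S (p m l))))"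
    by (subst sum.swap, subst (2) sum.swap) (rule refl)
  also have "\<dots> = (\<Sum>k\<in>E. \<Sum>n\<in>E. scale (G k n) (p k i * (\<Sum>m\<in>E. p n m * S (p m l))))"
    by (simp add: sum_distrib_left scale_sum_right)
  also have "\<dots> = (\<Sum>k\<in>E. \<Sum>n\<in>E. if n = l then scale (G k n) (p k i) else 0)"
    by (intro sum.cong refl) (simp add: comatrix_antipode_right[OF p _ l])
  also have "\<dots> = (\<Sum>k\<in>E. scale (G k l) (p k i))"
    using \<open>finite E\<close> l by simp
  finally show ?thesis ..
qed

text \<open>Solves the equation of \<open>antipode_form\<close> for the entries of S(p) without
  inverting G: a functional that vanishes on \<open>W\<close> but not at \<open>S (p m l)\<close>
  would give G a nonzero kernel vector.\<close>

lemma antipode_form_in_subspace: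
  assumes p: "comatrix E p" and m: "m \<in> E" and l: "l \<in> E"
    and G: "\<And>i j. i \<in> E \<Longrightarrow> j \<in> E \<Longrightarrow>
      (\<Sum>k\<in>E. \<Sum>l\<in>E. scale (G k l) (p k i * p l j)) = scale (G i j) 1"
    and nd: "\<And>c. (\<And>i. i \<in> E \<Longrightarrow> (\<Sum>m\<in>E. G i m * c m) = 0) \<Longrightarrow> (\<And>m. m \<in> E \<Longrightarrow> c m = 0)"
    and W: "subspace W" "\<And>i j. i \<in> E \<Longrightarrow> j \<in> E \<Longrightarrow> p i j \<in> W"
  shows "S (p m l) \<in> W"
proof (rule ccontr)
  assume "S (p m l) \<notin> W"
  then obtain f where f: "Vector_Spaces.linear scale (*) f" "\<And>w. w \<in> W \<Longrightarrow> f w = 0" "f (S (p m l)) = 1"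
    using separating_functional[OF vsQ W(1)] by blast
  have "(\<Sum>m\<in>E. G i m * f (S (p m l))) = 0" if "i \<in> E" for i
  proof -
    have "(\<Sum>m\<in>E. G i m * f (S (p m l))) = f (\<Sum>m\<in>E. scale (G i m) (S (p m l)))"
      by (simp add: lin_sum[OF f(1)] lin_scale[OF f(1)])
    also have "\<dots> = f (\<Sum>k\<in>E. scale (G k l) (p k i))"
      by (simp add: antipode_form[OF p that l G])
    also have "\<dots> = 0"
      using W that by (intro f(2) subspace_sum subspace_scale) auto
    finally show ?thesis .
  qed
  from nd[OF this m] f(3) show False by simp
qed

lemma comult_subalgebra:
  assumes P: "subalgebra scale P" and R: "subalgebra scale R"
  shows "subalgebra scale {x. \<Delta> x \<in> tensor_space scale scale P R}"
  unfolding subalgebra_def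
proof (intro conjI ballI)
  have "\<Delta> (x + y) = \<Delta> x + \<Delta> y" "\<Delta> (scale c x) = fscale c (\<Delta> x)" "\<Delta> 0 = 0" for c x y
    by (simp_all add: lin_add[OF comult_linear] lin_scale[OF comult_linear] lin_zero[OF comult_linear])
  thus "subspace {x. \<Delta> x \<in> tensor_space scale scale P R}"
    by (auto intro!: subspaceI simp: tensor_space_add tensor_space_scale tensor_space_zero)
  show "1 \<in> {x. \<Delta> x \<in> tensor_space scale scale P R}"
    using P R by (simp add: comult_one subalgebra_def tensor_in_tensor_space)
next
  fix x y
  assume "x \<in> {x. \<Delta> x \<in> tensor_space scale scale P R}" "y \<in> {x. \<Delta> x \<in> tensor_space scale scale P R}"
  then obtain xs ys where xs: "set xs \<subseteq> P \<times> R" "\<Delta> x = (\<Sum>(a, b)\<leftarrow>xs. tn a b)"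
    and ys: "set ys \<subseteq> P \<times> R" "\<Delta> y = (\<Sum>(a, b)\<leftarrow>ys. tn a b)"
    using tensor_space_list[OF vsQ, of P _ scale R] P unfolding subalgebra_def by (metis mem_Collect_eq)
  have "a * c \<in> P" "b * d \<in> R" if "(a, b) \<in> set xs" "(c, d) \<in> set ys" for a b c d
    using subsetD[OF xs(1) that(1)] subsetD[OF ys(1) that(2)] P R unfolding subalgebra_def by auto
  hence "\<Delta> (x * y) \<in> tensor_space scale scale P R"
    unfolding comult_mult_list[OF xs(2) ys(2)]
    by (auto intro!: tensor_space_sum_list tensor_in_tensor_space split: prod.splits)
  thus "x * y \<in> {x. \<Delta> x \<in> tensor_space scale scale P R}" by simp
qed

definition coeffs :: "'i set \<Rightarrow> ('i \<Rightarrow> 'i \<Rightarrow> 'q) \<Rightarrow> 'q set" where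
  "coeffs E p = {p i j | i j. i \<in> E \<and> j \<in> E}"

lemma comult_generated_coeffs:
  assumes p: "comatrix E p"
  shows "\<Delta> ` generated scale (coeffs E p) \<subseteq>
    tensor_space scale scale (generated scale (coeffs E p)) (generated scale (coeffs E p))"
proof -
  let ?P = "generated scale (coeffs E p)"
  have in_P: "p i j \<in> ?P" if "i \<in> E" "j \<in> E" for i j
    using that generated_superset[of "coeffs E p"] by (auto simp: coeffs_def)
  have "coeffs E p \<subseteq> {x. \<Delta> x \<in> tensor_space scale scale ?P ?P}"
  proof
    fix x assume "x \<in> coeffs E p"
    then obtain i j where ij: "x = p i j" "i \<in> E" "j \<in> E" by (auto simp: coeffs_def)
    hence "\<Delta> x = (\<Sum>k\<in>E. tn (p i k) (p k j))" using p by (simp add: comatrix_def)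
    also have "\<dots> \<in> tensor_space scale scale ?P ?P"
      using ij by (intro tensor_space_sum tensor_in_tensor_space in_P)
    finally show "x \<in> {x. \<Delta> x \<in> tensor_space scale scale ?P ?P}" by simp
  qed
  from generated_least[OF comult_subalgebra[OF subalgebra_generated subalgebra_generated] this]
  show ?thesis by blast
qed

text \<open>Words in the coefficients can be built by adding one coefficient at a time on the left,
  so \<open>antipode_comatrix_mult\<close> covers every product whose antipode is needed.\<close>

lemma hopf_subalgebra_generated:
  assumes p: "comatrix E p"
    and S: "\<And>i j. i \<in> E \<Longrightarrow> j \<in> E \<Longrightarrow> S (p i j) \<in> generated scale (coeffs E p)"
  shows "hopf_subalgebra scale \<Delta> S (generated scale (coeffs E p))"
proof -
  let ?P = "generated scale (coeffs E p)"
  have P: "subalgebra scale ?P" by (rule subalgebra_generated)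
  have "subspace {x. S x \<in> ?P}"
    using P unfolding subalgebra_def
    by (intro subspaceI) (simp_all add: lin_add[OF antipode_linear] lin_scale[OF antipode_linear]
        lin_zero[OF antipode_linear] subspace_0 subspace_add subspace_scale)
  moreover have "x * y \<in> {x. S x \<in> ?P}" if "x \<in> coeffs E p" "y \<in> {x. S x \<in> ?P}" for x y
    using that P S by (auto simp: coeffs_def antipode_comatrix_mult[OF p] subalgebra_def)
  ultimately have "?P \<subseteq> {x. S x \<in> ?P}"
    using P by (intro generated_left_induct) (auto simp: antipode_one subalgebra_def)
  with P comult_generated_coeffs[OF p] show ?thesis
    by (auto simp: hopf_subalgebra_def subcoalgebra_def subalgebra_def)
qed

section \<open>The Haar functional\<close>

text \<open>A normalised two-sided integral on Q. The first invariance makes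
  \<open>h (x * y)\<close> a preserved form; the second is what produces coinvariants in
  \<open>rigidity\<close>.\<close>

definition haar :: "('q \<Rightarrow> 'k) \<Rightarrow> bool" where
  "haar h \<longleftrightarrow> Vector_Spaces.linear scale (*) h \<and> h 1 = 1 \<and>
     (\<forall>x. sw (\<lambda>a b. scale (h a) b) x = scale (h x) 1) \<and>
     (\<forall>x. sw (\<lambda>a b. scale (h b) a) x = scale (h x) 1)"

lemma bil_functional_left:
  "Vector_Spaces.linear scale (*) h \<Longrightarrow> bilinear_on scale scale scale UNIV UNIV (\<lambda>a b. scale (h a) b)"
  by (intro bilinear_onQI vsQ linear_scaleR lin_comp[OF _ linear_scale_left])

lemma bil_functional_right:
  "Vector_Spaces.linear scale (*) h \<Longrightarrow> bilinear_on scale scale scale UNIV UNIV (\<lambda>a b. scale (h b) a)"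
  by (intro bilinear_onQI vsQ linear_scaleR lin_comp[OF _ linear_scale_left])

lemma subspace_sum_list:
  "subspace W \<Longrightarrow> (\<And>x. x \<in> set xs \<Longrightarrow> f x \<in> W) \<Longrightarrow> (\<Sum>x\<leftarrow>xs. f x) \<in> W"
  by (induction xs) (auto simp: subspace_0 subspace_add)

lemma subcoalgebra_span_Union:
  assumes "\<And>D. D \<in> \<D> \<Longrightarrow> subcoalgebra scale \<Delta> D"
  shows "subcoalgebra scale \<Delta> (span (\<Union>\<D>))"
proof -
  let ?W = "span (\<Union>\<D>)"
  have "subspace {x. \<Delta> x \<in> tensor_space scale scale ?W ?W}"
    by (auto intro!: subspaceI simp: lin_add[OF comult_linear] lin_scale[OF comult_linear]
        lin_zero[OF comult_linear] tensor_space_add tensor_space_scale tensor_space_zero)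
  moreover have "\<Union>\<D> \<subseteq> {x. \<Delta> x \<in> tensor_space scale scale ?W ?W}"
  proof safe
    fix x D assume "x \<in> D" "D \<in> \<D>"
    hence "\<Delta> x \<in> tensor_space scale scale D D" using assms[of D] by (auto simp: subcoalgebra_def)
    moreover have "D \<subseteq> ?W" using \<open>D \<in> \<D>\<close> span_superset[of "\<Union>\<D>"] by blast
    ultimately show "\<Delta> x \<in> tensor_space scale scale ?W ?W" using tensor_space_mono by blast
  qed
  ultimately have "?W \<subseteq> {x. \<Delta> x \<in> tensor_space scale scale ?W ?W}" by (rule span_minimal[rotated])
  thus ?thesis by (auto simp: subcoalgebra_def)
qed

lemma sw_functional_subcoalgebra:
  assumes "subcoalgebra scale \<Delta> D" "x \<in> D" "Vector_Spaces.linear scale (*) f"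
  shows "sw (\<lambda>a b. scale (f a) b) x \<in> D" and "(\<And>y. y \<in> D \<Longrightarrow> f y = 0) \<Longrightarrow> sw (\<lambda>a b. scale (f a) b) x = 0"
    and "(\<And>y. y \<in> D \<Longrightarrow> f y = 0) \<Longrightarrow> sw (\<lambda>a b. scale (f b) a) x = 0"
proof -
  have D: "subspace D" using assms(1) by (simp add: subcoalgebra_def)
  obtain xs where xs: "set xs \<subseteq> D \<times> D" "\<Delta> x = (\<Sum>(a, b)\<leftarrow>xs. tn a b)"
    using assms(1,2) tensor_space_list[OF vsQ D, of "\<Delta> x" scale D] by (auto simp: subcoalgebra_def)
  note eq = sw_list[OF vsQ bil_functional_left[OF assms(3)] xs(2)] sw_list[OF vsQ bil_functional_right[OF assms(3)] xs(2)]
  show "sw (\<lambda>a b. scale (f a) b) x \<in> D"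
    unfolding eq using xs(1) D by (intro subspace_sum_list) (auto intro: subspace_scale)
  have zero: "(\<Sum>x\<leftarrow>xs. g x) = 0" if "\<And>x. x \<in> set xs \<Longrightarrow> g x = (0 :: 'q)" for g
    using subspace_sum_list[OF subspace_single_0, of xs g] that by simp
  show "sw (\<lambda>a b. scale (f a) b) x = 0" if "\<And>y. y \<in> D \<Longrightarrow> f y = 0"
    unfolding eq using xs(1) that by (intro zero) auto
  show "sw (\<lambda>a b. scale (f b) a) x = 0" if "\<And>y. y \<in> D \<Longrightarrow> f y = 0"
    unfolding eq using xs(1) that by (intro zero) auto
qed

text \<open>If 1 is not in D, contract the first leg of \<Delta> 1 = 1 \<otimes> 1 with a functional
  that kills D and is 1 at 1: the contribution of \<open>x\<close> disappears and that of
  \<open>y\<close> stays in D'.\<close>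

lemma one_in_subcoalgebra_sum:
  assumes D: "subcoalgebra scale \<Delta> D" and D': "subcoalgebra scale \<Delta> D'"
    and xy: "x \<in> D" "y \<in> D'" "1 = x + y"
  shows "1 \<in> D \<or> 1 \<in> D'"
proof (rule disjCI, rule ccontr)
  assume "1 \<notin> D'" "1 \<notin> D"
  have "subspace D" using D by (simp add: subcoalgebra_def)
  from separating_functional[OF vsQ this \<open>1 \<notin> D\<close>] obtain f
    where f: "Vector_Spaces.linear scale (*) f" "\<And>w. w \<in> D \<Longrightarrow> f w = 0" "f 1 = 1" by blast
  let ?\<beta> = "\<lambda>a b. scale (f a) b"
  note bil = bil_functional_left[OF f(1)]
  have "1 = sw ?\<beta> 1"
    using sw_list[OF vsQ bil, of 1 "[(1, 1)]"] f(3) by (simp add: comult_one)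
  also have "\<dots> = sw ?\<beta> x + sw ?\<beta> y"
    unfolding xy(3) by (rule lin_add[OF linear_sw[OF vsQ bil]])
  also have "sw ?\<beta> x = 0" by (rule sw_functional_subcoalgebra(2)[OF D xy(1) f(1,2)])
  finally have "1 = sw ?\<beta> y" by simp
  with sw_functional_subcoalgebra(1)[OF D' xy(2) f(1)] \<open>1 \<notin> D'\<close> show False by simp
qed

text \<open>Keeps 1 outside the span of the simple subcoalgebras that avoid it, so that a functional
  can kill all of these and still be 1 at 1.\<close>

lemma one_in_sum_of_subcoalgebras:
  assumes "finite \<D>" "\<And>D. D \<in> \<D> \<Longrightarrow> subcoalgebra scale \<Delta> D" "1 \<in> span (\<Union>\<D>)"
  shows "\<exists>D\<in>\<D>. 1 \<in> D"
  using assms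
proof (induction \<D>)
  case empty
  thus ?case using one_neq_zero by simp
next
  case (insert D \<D>)
  have D: "subspace D" using insert.prems(1) by (auto simp: subcoalgebra_def)
  have sub: "subcoalgebra scale \<Delta> (span (\<Union>\<D>))"
    using insert.prems(1) by (intro subcoalgebra_span_Union) auto
  obtain x y where "x \<in> D" "y \<in> span (\<Union>\<D>)" "1 = x + y"
    using insert.prems(2) D by (auto simp: span_Un span_eq_iff[THEN iffD2])
  hence "1 \<in> D \<or> 1 \<in> span (\<Union>\<D>)"
    using one_in_subcoalgebra_sum insert.prems(1) sub by blast
  with insert.IH insert.prems(1) show ?case by auto
qed

lemma span_Union_finite:
  assumes "x \<in> span (\<Union>\<D>)"
  obtains \<F> where "finite \<F>" "\<F> \<subseteq> \<D>" "x \<in> span (\<Union>\<F>)"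
proof -
  obtain t r where "finite t" "t \<subseteq> \<Union>\<D>" and x: "x = (\<Sum>a\<in>t. scale (r a) a)"
    using assms unfolding span_explicit by auto
  obtain \<F> where "finite \<F>" "\<F> \<subseteq> \<D>" "t \<subseteq> \<Union>\<F>"
    using \<open>finite t\<close> \<open>t \<subseteq> \<Union>\<D>\<close> by (rule finite_subset_Union)
  moreover have "x \<in> span (\<Union>\<F>)"
    unfolding x using \<open>t \<subseteq> \<Union>\<F>\<close> by (intro span_sum span_scale span_base) auto
  ultimately show thesis by (intro that)
qed

text \<open>The Haar functional kills all simple subcoalgebras except the one spanned by \<open>1\<close>.\<close>

lemma haar_exists:
  assumes "cosemisimple scale \<Delta>"
  obtains h where "haar h"
proof -
  define \<D> where "\<D> = {D. simple_subcoalgebra scale \<Delta> D \<and> 1 \<notin> D}"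
  have sub: "subcoalgebra scale \<Delta> D" if "D \<in> \<D>" for D
    using that by (simp add: \<D>_def simple_subcoalgebra_def)
  have "1 \<notin> span (\<Union>\<D>)"
  proof
    assume "1 \<in> span (\<Union>\<D>)"
    then obtain \<F> where \<F>: "finite \<F>" "\<F> \<subseteq> \<D>" "1 \<in> span (\<Union>\<F>)" by (rule span_Union_finite)
    hence "\<exists>D\<in>\<F>. 1 \<in> D" using sub by (intro one_in_sum_of_subcoalgebras) auto
    with \<F>(2) show False by (auto simp: \<D>_def)
  qed
  from separating_functional[OF vsQ subspace_span this] obtain h
    where h: "Vector_Spaces.linear scale (*) h" "\<And>w. w \<in> span (\<Union>\<D>) \<Longrightarrow> h w = 0" "h 1 = 1" by blast
  \<comment> \<open>Both invariance conditions are linear in \<open>x\<close>, so by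
    co-semisimplicity they need checking on simple subcoalgebras only.\<close>
  let ?X = "{x. sw (\<lambda>a b. scale (h a) b) x = scale (h x) 1 \<and> sw (\<lambda>a b. scale (h b) a) x = scale (h x) 1}"
  note lin = linear_sw[OF vsQ bil_functional_left[OF h(1)]] linear_sw[OF vsQ bil_functional_right[OF h(1)]] h(1)
  have "subspace ?X"
    by (intro subspaceI) (simp_all add: lin[THEN lin_add] lin[THEN lin_scale] lin[THEN lin_zero] scale_left_distrib)
  moreover have "D \<subseteq> ?X" if D: "simple_subcoalgebra scale \<Delta> D" for D
  proof (cases "1 \<in> D")
    case False
    hence "D \<in> \<D>" using D by (simp add: \<D>_def)
    hence "h y = 0" if "y \<in> D" for y
      using that by (intro h(2) span_base) auto
    with sw_functional_subcoalgebra(2,3)[OF sub[OF \<open>D \<in> \<D>\<close>] _ h(1)] show ?thesis by auto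
  next
    case True
    have one: "1 \<in> ?X"
      using sw_list[OF vsQ bil_functional_left[OF h(1)], of 1 "[(1, 1)]"]
        sw_list[OF vsQ bil_functional_right[OF h(1)], of 1 "[(1, 1)]"] h(3) by (simp add: comult_one)
    \<comment> \<open>The line through 1 is a nonzero subcoalgebra of the simple D, hence equal to
      it.\<close>
    have "subcoalgebra scale \<Delta> (span {1})"
    proof -
      have "\<Delta> (scale c 1) \<in> tensor_space scale scale (span {1}) (span {1})" for c
        by (simp add: lin_scale[OF comult_linear] comult_one tensor_space_scale tensor_in_tensor_space span_base)
      with subspace_span[of "{1}"] show ?thesis by (auto simp: subcoalgebra_def span_singleton)
    qed
    moreover have "span {1} \<subseteq> D"
      using True D by (intro span_minimal) (auto simp: simple_subcoalgebra_def subcoalgebra_def)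
    moreover have "span {1} \<noteq> {0}" using one_neq_zero span_base[of 1 "{1}"] by auto
    ultimately have "span {1} = D" using D unfolding simple_subcoalgebra_def by blast
    moreover have "span {1} \<subseteq> ?X" using one \<open>subspace ?X\<close> by (intro span_minimal) auto
    ultimately show ?thesis by simp
  qed
  ultimately have "span (\<Union>{D. simple_subcoalgebra scale \<Delta> D}) \<subseteq> ?X" by (intro span_minimal) auto
  hence "haar h"
    using assms h(1,3) unfolding cosemisimple_def haar_def by auto
  thus thesis by (rule that)
qed

section \<open>Commutative coideal subalgebras\<close>

text \<open>A right coideal: a subcomodule of Q for \<Delta> read as a right coaction of Q on
  itself.\<close>

definition coideal :: "'q set \<Rightarrow> bool" where
  "coideal B \<longleftrightarrow> subspace B \<and> (\<forall>b\<in>B. \<Delta> b \<in> tensor_space scale scale B UNIV)"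

lemma coideal_comatrix:
  assumes fin: "fin_dim scale UNIV" and B: "coideal B"
  obtains E p where "E \<subseteq> B" "span E = B" "independent E" "comatrix E p"
    "\<And>e. e \<in> E \<Longrightarrow> \<Delta> e = (\<Sum>i\<in>E. tn i (p i e))"
proof -
  obtain X where X: "finite X" "span X = UNIV" using fin by (auto simp: fin_dim_def)
  obtain E where E: "E \<subseteq> B" "independent E" "B \<subseteq> span E" using maximal_independent_subset by blast
  have sE: "span E = B" using E(1,3) B by (intro span_subspace) (auto simp: coideal_def)
  have "finite E" using independent_span_bound[OF X(1) E(2)] X(2) by simp
  have "\<exists>c. \<Delta> e = (\<Sum>i\<in>E. tn i (c i))" if "e \<in> E" for e
  proof -
    have "\<Delta> e \<in> tensor_space scale scale (span E) UNIV"
      using that B E(1) unfolding sE coideal_def by blast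
    thus ?thesis
      using tensor_space_span_rep[OF vsQ vsQ \<open>finite E\<close> subspace_UNIV] by metis
  qed
  then obtain c where c: "\<And>e. e \<in> E \<Longrightarrow> \<Delta> e = (\<Sum>i\<in>E. tn i (c e i))" by metis
  define p where "p = (\<lambda>i e. c e i)"
  have p: "\<Delta> e = (\<Sum>i\<in>E. tn i (p i e))" if "e \<in> E" for e
    using c[OF that] by (simp add: p_def)
  have "comatrix E p"
    by (rule comatrix_of_comodule[OF vsQ \<open>finite E\<close> E(2) comult_linear comult_in p coassoc counit_right])
  with E sE p show thesis by (intro that)
qed

lemma haar_linear: "haar h \<Longrightarrow> Vector_Spaces.linear scale (*) h"
  by (simp add: haar_def)

lemma functional_mult_zero_on_span:
  assumes hl: "Vector_Spaces.linear scale (*) h" and "\<And>x. x \<in> X \<Longrightarrow> h (y * x) = 0" "z \<in> span X"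
  shows "h (y * z) = 0"
proof -
  have "subspace {z. h (y * z) = 0}"
    by (intro subspaceI) (simp_all add: distrib_left scale_mult_right lin_add[OF hl] lin_scale[OF hl] lin_zero[OF hl])
  hence "span X \<subseteq> {z. h (y * z) = 0}" using assms(2) by (intro span_minimal) auto
  with assms(3) show ?thesis by blast
qed

lemma sw_mult_sum:
  assumes "vector_space s3" "bilinear_on scale scale s3 UNIV UNIV \<beta>"
    and "finite I" "finite J"
    and "\<Delta> x = (\<Sum>i\<in>I. tn (a i) (b i))" "\<Delta> y = (\<Sum>j\<in>J. tn (c j) (d j))"
  shows "sw \<beta> (x * y) = (\<Sum>i\<in>I. \<Sum>j\<in>J. \<beta> (a i * c j) (b i * d j))"
proof -
  have D: "\<Delta> (x * y) = (\<Sum>z\<in>I \<times> J. tn (a (fst z) * c (snd z)) (b (fst z) * d (snd z)))"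
    unfolding comult_mult_sum[OF assms(3-6)] by (simp add: sum.cartesian_product case_prod_unfold)
  show ?thesis
    unfolding sw_sum[OF assms(1,2) D] by (simp add: sum.cartesian_product case_prod_unfold)
qed

text \<open>Invariance of \<open>h\<close> at a product of basis elements. With this,
  \<open>h (x * y)\<close> takes over on a coideal the role that the preserved form has on
  \<open>V\<close>.\<close>

lemma haar_invariant_form:
  assumes h: "haar h" and p: "comatrix E p" and \<Delta>E: "\<And>e. e \<in> E \<Longrightarrow> \<Delta> e = (\<Sum>i\<in>E. tn i (p i e))"
    and ij: "i \<in> E" "j \<in> E"
  shows "(\<Sum>k\<in>E. \<Sum>l\<in>E. scale (h (k * l)) (p k i * p l j)) = scale (h (i * j)) 1"
proof -
  have fin: "finite E" using p by (simp add: comatrix_def)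
  from h sw_mult_sum[OF vsQ bil_functional_left[OF haar_linear[OF h]] fin fin \<Delta>E[OF ij(1)] \<Delta>E[OF ij(2)]]
  show ?thesis by (simp add: haar_def)
qed

text \<open>The radical I is an ideal of B because B is commutative, and a subcomodule because the
  form is invariant. Counit and antipode put 1 into I Q if I is not zero; Q is finitely generated
  over B, so \<open>nakayama\<close> gives 1 in I, contradicting \<open>h 1 = 1\<close>.\<close>

lemma haar_nondegenerate:
  assumes fin: "fin_dim scale UNIV" and h: "haar h"
    and B: "subalgebra scale B" "coideal B" and comm: "\<And>x y. x \<in> B \<Longrightarrow> y \<in> B \<Longrightarrow> x * y = y * x"
    and b: "b \<in> B" "\<And>y. y \<in> B \<Longrightarrow> h (b * y) = 0"
  shows "b = 0"
proof (rule ccontr)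
  assume "b \<noteq> 0"
  note hl = haar_linear[OF h]
  have Bsub: "subspace B" and B1: "1 \<in> B" and Bm: "\<And>x y. x \<in> B \<Longrightarrow> y \<in> B \<Longrightarrow> x * y \<in> B"
    using B(1) by (auto simp: subalgebra_def)
  obtain E p where E: "E \<subseteq> B" "span E = B" "independent E" and p: "comatrix E p"
    and \<Delta>E: "\<And>e. e \<in> E \<Longrightarrow> \<Delta> e = (\<Sum>i\<in>E. tn i (p i e))" using coideal_comatrix[OF fin B(2)] by metis
  have finE: "finite E" using p by (simp add: comatrix_def)
  obtain X where X: "finite X" "span X = UNIV" using fin by (auto simp: fin_dim_def)
  obtain T where "T \<subseteq> UNIV" and T: "independent T" and "UNIV \<subseteq> span T" using maximal_independent_subset by blast
  hence sT: "span T = UNIV" by auto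
  have finT: "finite T" using independent_span_bound[OF X(1) T] X(2) by simp
  define I where "I = {x \<in> B. \<forall>y\<in>B. h (x * y) = 0}"
  \<comment> \<open>I is a subcomodule. By \<open>antipode_form\<close>, orthogonality of
    \<open>x\<close> to B turns into a linear relation between the second legs \<open>t k\<close>
    (\<open>tG\<close>). Expanding the \<open>t k\<close> in a basis T of Q rearranges \<Delta> x so
    that this relation says that the first legs \<open>d \<tau>\<close> are in the radical.\<close>
  have \<Delta>I: "\<exists>c. (\<forall>\<tau>\<in>T. c \<tau> \<in> I) \<and> \<Delta> x = (\<Sum>\<tau>\<in>T. tn (c \<tau>) \<tau>)" if "x \<in> I" for x
  proof -
    have x: "x \<in> span E" "\<And>y. y \<in> B \<Longrightarrow> h (x * y) = 0" using that E(2) by (auto simp: I_def)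
    obtain c where c: "x = (\<Sum>a\<in>E. scale (c a) a)" using x(1) span_finite[OF finE] by auto
    define t where "t = (\<lambda>k. \<Sum>a\<in>E. scale (c a) (p k a))"
    have \<Delta>x: "\<Delta> x = (\<Sum>k\<in>E. tn k (t k))"
    proof -
      have "\<Delta> x = (\<Sum>a\<in>E. \<Sum>k\<in>E. fscale (c a) (tn k (p k a)))"
        by (simp add: c lin_sum[OF comult_linear] lin_scale[OF comult_linear] \<Delta>E
            module.scale_sum_right[OF module_fscale])
      also have "\<dots> = (\<Sum>k\<in>E. \<Sum>a\<in>E. fscale (c a) (tn k (p k a)))" by (rule sum.swap)
      also have "\<dots> = (\<Sum>k\<in>E. tn k (t k))"
        by (simp add: t_def lin_sum[OF linear_tensor_right[OF vsQ]] lin_scale[OF linear_tensor_right[OF vsQ]])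
      finally show ?thesis .
    qed
    have tG: "(\<Sum>k\<in>E. scale (h (k * l)) (t k)) = 0" if "l \<in> E" for l
    proof -
      have "(\<Sum>k\<in>E. scale (h (k * l)) (t k)) = (\<Sum>a\<in>E. scale (c a) (\<Sum>k\<in>E. scale (h (k * l)) (p k a)))"
        unfolding t_def scale_sum_right by (subst sum.swap) (simp add: mult.commute)
      also have "\<dots> = (\<Sum>a\<in>E. scale (c a) (\<Sum>m\<in>E. scale (h (a * m)) (S (p m l))))"
        by (intro sum.cong refl arg_cong[where f = "scale _"]
            antipode_form[OF p _ that haar_invariant_form[OF h p \<Delta>E]])
      also have "\<dots> = (\<Sum>m\<in>E. scale (h (x * m)) (S (p m l)))"
        unfolding c sum_distrib_right scale_mult_left lin_sum[OF hl] lin_scale[OF hl] scale_sum_right scale_sum_left scale_scale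
        by (rule sum.swap)
      also have "\<dots> = 0" using x(2) E(1) by (intro sum.neutral) auto
      finally show ?thesis .
    qed
    define r where "r = representation T"
    have r: "(\<Sum>\<tau>\<in>T. scale (r y \<tau>) \<tau>) = y" for y
      unfolding r_def using sum_representation_eq[OF T _ finT order_refl, of y] sT by simp
    have rlin: "Vector_Spaces.linear scale (*) (\<lambda>y. r y \<tau>)" for \<tau>
      unfolding r_def using T sT
      by (simp add: linear_iff_add_scale[OF vsQ vector_space_mult] representation_add representation_scale)
    define d where "d = (\<lambda>\<tau>. \<Sum>k\<in>E. scale (r (t k) \<tau>) k)"
    have dB: "d \<tau> \<in> B" for \<tau>
      unfolding d_def using E(1) by (intro subspace_sum[OF Bsub] subspace_scale[OF Bsub]) auto
    have "h (d \<tau> * y) = 0" if "y \<in> B" for \<tau> y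
    proof (rule functional_mult_zero_on_span[OF hl])
      show "h (d \<tau> * l) = 0" if "l \<in> E" for l
      proof -
        have "h (d \<tau> * l) = (\<Sum>k\<in>E. h (k * l) * r (t k) \<tau>)"
          by (simp add: d_def sum_distrib_right scale_mult_left lin_sum[OF hl] lin_scale[OF hl] mult.commute)
        also have "\<dots> = r (\<Sum>k\<in>E. scale (h (k * l)) (t k)) \<tau>"
          by (simp add: lin_sum[OF rlin] lin_scale[OF rlin])
        also have "\<dots> = 0" using tG[OF that] lin_zero[OF rlin] by simp
        finally show ?thesis .
      qed
    qed (use that E(2) in simp)
    hence "\<forall>\<tau>\<in>T. d \<tau> \<in> I" using dB by (simp add: I_def)
    moreover have "\<Delta> x = (\<Sum>\<tau>\<in>T. tn (d \<tau>) \<tau>)"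
    proof -
      have "\<Delta> x = (\<Sum>k\<in>E. tn k (\<Sum>\<tau>\<in>T. scale (r (t k) \<tau>) \<tau>))" by (simp add: \<Delta>x r)
      also have "\<dots> = (\<Sum>k\<in>E. \<Sum>\<tau>\<in>T. fscale (r (t k) \<tau>) (tn k \<tau>))"
        by (simp add: lin_sum[OF linear_tensor_right[OF vsQ]] lin_scale[OF linear_tensor_right[OF vsQ]])
      also have "\<dots> = (\<Sum>\<tau>\<in>T. \<Sum>k\<in>E. fscale (r (t k) \<tau>) (tn k \<tau>))" by (rule sum.swap)
      also have "\<dots> = (\<Sum>\<tau>\<in>T. tn (d \<tau>) \<tau>)"
        by (simp add: d_def lin_sum[OF linear_tensor_left[OF vsQ]] lin_scale[OF linear_tensor_left[OF vsQ]])
      finally show ?thesis .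
    qed
    ultimately show ?thesis by blast
  qed
  have "b \<in> I" using b by (simp add: I_def)
  \<comment> \<open>Otherwise applying \<epsilon> to the first legs of \<Delta> b, which lie in I,
    would give b = 0.\<close>
  have "\<exists>x\<in>I. \<epsilon> x \<noteq> 0"
  proof (rule ccontr)
    assume *: "\<not> (\<exists>x\<in>I. \<epsilon> x \<noteq> 0)"
    obtain c where c: "\<forall>\<tau>\<in>T. c \<tau> \<in> I" "\<Delta> b = (\<Sum>\<tau>\<in>T. tn (c \<tau>) \<tau>)" using \<Delta>I[OF \<open>b \<in> I\<close>] by blast
    have "b = (\<Sum>\<tau>\<in>T. scale (\<epsilon> (c \<tau>)) \<tau>)"
      using counit_left[of b] unfolding sw_sum[OF vsQ bil_counit_left c(2)] ..
    also have "\<dots> = 0" using * c(1) by (intro sum.neutral) auto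
    finally show False using \<open>b \<noteq> 0\<close> by simp
  qed
  then obtain x where x: "x \<in> I" "\<epsilon> x \<noteq> 0" by blast
  obtain c where c: "\<forall>\<tau>\<in>T. c \<tau> \<in> I" "\<Delta> x = (\<Sum>\<tau>\<in>T. tn (c \<tau>) \<tau>)" using \<Delta>I[OF x(1)] by blast
  \<comment> \<open>The right antipode axiom exhibits a nonzero multiple of 1 as an element of I
    Q.\<close>
  have "(\<Sum>\<tau>\<in>T. c \<tau> * S \<tau>) = scale (\<epsilon> x) 1"
    using antipode_right[of x] unfolding sw_sum[OF vsQ bil_antipode_right c(2)] .
  hence "scale (inverse (\<epsilon> x)) (\<Sum>\<tau>\<in>T. c \<tau> * S \<tau>) = 1" using x(2) by simp
  hence one: "1 = (\<Sum>\<tau>\<in>T. c \<tau> * S (scale (inverse (\<epsilon> x)) \<tau>))"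
    by (simp add: scale_sum_right lin_scale[OF antipode_linear] scale_mult_right)
  have rep: "\<exists>c. (\<forall>m. c m \<in> B) \<and> x = (\<Sum>m\<in>T. c m * m)" for x
  proof -
    obtain c where "x = (\<Sum>m\<in>T. scale (c m) m)" using sT span_finite[OF finT] by auto
    thus ?thesis
      using subspace_scale[OF Bsub B1]
      by (intro exI[of _ "\<lambda>m. scale (c m) 1"]) (simp add: scale_mult_left)
  qed
  have "1 \<in> I"
  proof (rule nakayama[where R = B and F = T, OF _ _ _ B1 _ _ _ _ _ finT rep one])
    show "u * v \<in> I" if "u \<in> B" "v \<in> I" for u v
    proof -
      have "h (u * v * y) = 0" if "y \<in> B" for y
        using that \<open>u \<in> B\<close> \<open>v \<in> I\<close> Bm[of u y] comm[of u v] by (simp add: I_def mult.assoc)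
      thus ?thesis using that Bm by (simp add: I_def)
    qed
    show "u + v \<in> I" if "u \<in> I" "v \<in> I" for u v
      using that subspace_add[OF Bsub] by (simp add: I_def distrib_right lin_add[OF hl])
    show "0 \<in> I" using subspace_0[OF Bsub] by (simp add: I_def lin_zero[OF hl])
    show "I \<subseteq> B" by (auto simp: I_def)
  qed (use Bm comm c(1) Bsub in \<open>auto intro: subspace_add subspace_diff\<close>)
  hence "h (1 * 1) = 0" using B1 unfolding I_def by blast
  thus False using h by (simp add: haar_def)
qed

text \<open>\<open>L\<close> records the values \<open>h (x * a)\<close> as coordinates in
  \<open>E\<close>. On B it is injective by nondegeneracy and then surjective by a dimension count;
  the preimages of the basis vectors form the dual basis.\<close>

lemma haar_dual_basis:
  assumes fin: "fin_dim scale UNIV" and h: "haar h"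
    and B: "subalgebra scale B" "coideal B" and comm: "\<And>x y. x \<in> B \<Longrightarrow> y \<in> B \<Longrightarrow> x * y = y * x"
    and E: "E \<subseteq> B" "span E = B" "independent E" "finite E"
  obtains d where "\<And>a. a \<in> E \<Longrightarrow> d a \<in> B"
    "\<And>a b. a \<in> E \<Longrightarrow> b \<in> E \<Longrightarrow> h (d a * b) = (if a = b then 1 else 0)"
proof -
  note hl = haar_linear[OF h]
  have Bsub: "subspace B" using B(1) by (simp add: subalgebra_def)
  define L where "L = (\<lambda>x. \<Sum>a\<in>E. scale (h (x * a)) a)"
  have L: "Vector_Spaces.linear scale scale L"
    unfolding L_def
    by (simp add: linear_iff_add_scale vsQ distrib_right scale_mult_left lin_add[OF hl] lin_scale[OF hl]
        scale_left_distrib sum.distrib scale_sum_right)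
  interpret L: Vector_Spaces.linear scale scale L by (rule L)
  have ker: "x = 0" if "x \<in> B" "L x = 0" for x
  proof (rule haar_nondegenerate[OF fin h B comm that(1)])
    fix y assume "y \<in> B"
    have "h (x * a) = 0" if "a \<in> E" for a
      using independentD[OF E(3,4) order_refl _ that, of "\<lambda>a. h (x * a)"] \<open>L x = 0\<close> by (simp add: L_def)
    thus "h (x * y) = 0"
      using functional_mult_zero_on_span[OF hl, of E x y] \<open>y \<in> B\<close> E(2) by simp
  qed
  have inj: "inj_on L (span E)"
    using ker L.inj_on_iff_eq_0[OF subspace_span[of E]] E(2) by auto
  have indep: "independent (L ` E)" by (rule L.independent_injective_image[OF E(3) inj])
  have card: "card (L ` E) = card E" using inj span_superset by (intro card_image) (blast intro: inj_on_subset)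
  have LE: "L x \<in> span E" for x
    unfolding L_def by (intro span_sum span_scale span_base)
  have "E \<subseteq> span (L ` E)"
  proof
    fix a assume "a \<in> E"
    show "a \<in> span (L ` E)"
    proof (rule ccontr)
      assume a: "a \<notin> span (L ` E)"
      hence "independent (insert a (L ` E))" using indep by (simp add: independent_insertI)
      moreover have "insert a (L ` E) \<subseteq> span E" using LE \<open>a \<in> E\<close> by (auto intro: span_base)
      ultimately have "card (insert a (L ` E)) \<le> card E" using independent_span_bound[OF E(4)] by blast
      moreover have "a \<notin> L ` E" using a span_superset by blast
      ultimately show False using card E(4) by simp
    qed
  qed
  hence "\<exists>x\<in>B. L x = a" if "a \<in> E" for a
    using that E(2) unfolding L.span_image by blast
  then obtain d where d: "\<And>a. a \<in> E \<Longrightarrow> d a \<in> B" "\<And>a. a \<in> E \<Longrightarrow> L (d a) = a" by metis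
  have "h (d a * b) = (if a = b then 1 else 0)" if "a \<in> E" "b \<in> E" for a b
  proof -
    have "(\<Sum>b\<in>E. scale (h (d a * b) - (if a = b then 1 else 0)) b) = L (d a) - (\<Sum>b\<in>E. if b = a then b else 0)"
      unfolding L_def sum_subtractf[symmetric] by (intro sum.cong) (auto simp: scale_left_diff_distrib)
    also have "\<dots> = 0" using that(1) E(4) by (simp add: d(2))
    finally show ?thesis using independentD[OF E(3,4) order_refl _ that(2)] by fastforce
  qed
  with d(1) show thesis by (rule that)
qed

text \<open>The Haar form of P is invariant and nondegenerate, so
  \<open>antipode_form_in_subspace\<close> applies to the coefficients of P as a comodule over
  itself, and by the counit these coefficients span P.\<close>

lemma antipode_coideal_subalgebra:
  assumes fin: "fin_dim scale UNIV" and h: "haar h" and P: "subalgebra scale P"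
    and cop: "\<Delta> ` P \<subseteq> tensor_space scale scale P P" and comm: "\<And>x y. x \<in> P \<Longrightarrow> y \<in> P \<Longrightarrow> x * y = y * x"
    and x: "x \<in> P"
  shows "S x \<in> P"
proof -
  note hl = haar_linear[OF h]
  have Psub: "subspace P" using P by (simp add: subalgebra_def)
  have coid: "coideal P"
    using Psub cop tensor_space_mono[of P P P UNIV] by (force simp: coideal_def)
  obtain E p where E: "E \<subseteq> P" "span E = P" "independent E" and p: "comatrix E p"
    and \<Delta>E: "\<And>e. e \<in> E \<Longrightarrow> \<Delta> e = (\<Sum>i\<in>E. tn i (p i e))" using coideal_comatrix[OF fin coid] by metis
  have finE: "finite E" using p by (simp add: comatrix_def)
  obtain d where d: "\<And>a. a \<in> E \<Longrightarrow> d a \<in> P"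
    "\<And>a b. a \<in> E \<Longrightarrow> b \<in> E \<Longrightarrow> h (d a * b) = (if a = b then 1 else 0)"
    using haar_dual_basis[OF fin h P coid comm E finE] by metis
  \<comment> \<open>Since \<Delta> maps P into P \<otimes> P, uniqueness of coefficients places the
    second legs in P as well.\<close>
  have pP: "p i e \<in> P" if "i \<in> E" "e \<in> E" for i e
  proof -
    have "\<Delta> e \<in> tensor_space scale scale (span E) P"
      using cop E that(2) by auto
    then obtain c where c: "\<And>i. c i \<in> P" "\<Delta> e = (\<Sum>i\<in>E. tn i (c i))"
      using tensor_space_span_rep[OF vsQ vsQ finE Psub] by metis
    hence "p i e = c i"
      using tensor_coeff_unique[OF vsQ vsQ finE E(3) that(1), of "\<lambda>i. p i e" c] \<Delta>E[OF that(2)] by simp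
    with c(1) show ?thesis by simp
  qed
  have "S (p i j) \<in> P" if ij: "i \<in> E" "j \<in> E" for i j
  proof (rule antipode_form_in_subspace[OF p ij haar_invariant_form[OF h p \<Delta>E] _ Psub pP])
    fix c m assume c: "\<And>i. i \<in> E \<Longrightarrow> (\<Sum>m\<in>E. h (i * m) * c m) = 0" and m: "m \<in> E"
    define y where "y = (\<Sum>m\<in>E. scale (c m) m)"
    have yP: "y \<in> P" unfolding y_def using E(1) by (intro subspace_sum[OF Psub] subspace_scale[OF Psub]) auto
    have "h (y * z) = 0" if "z \<in> P" for z
    proof (rule functional_mult_zero_on_span[OF hl])
      show "h (y * l) = 0" if "l \<in> E" for l
      proof -
        \<comment> \<open>The kernel condition has \<open>y\<close> on the right,
          \<open>haar_nondegenerate\<close> has it on the left; commutativity of P mediates.\<close>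
        have "h (y * l) = h (l * y)" using that E(1) Psub comm[of l y] yP by auto
        also have "\<dots> = (\<Sum>m\<in>E. h (l * m) * c m)"
          by (simp add: y_def sum_distrib_left scale_mult_right lin_sum[OF hl] lin_scale[OF hl] mult.commute[of "c _"])
        finally show ?thesis using c[OF that] by simp
      qed
    qed (use that E(2) in simp)
    with yP have "y = 0" by (intro haar_nondegenerate[OF fin h P coid comm])
    with m show "c m = 0" unfolding y_def by (intro independentD[OF E(3) finE order_refl])
  qed
  moreover have "x \<in> span {p i j | i j. i \<in> E \<and> j \<in> E}"
  proof -
    have "e \<in> span {p i j | i j. i \<in> E \<and> j \<in> E}" if "e \<in> E" for e
    proof -
      have "e = (\<Sum>i\<in>E. scale (\<epsilon> i) (p i e))"
        using counit_left[of e] unfolding sw_sum[OF vsQ bil_counit_left \<Delta>E[OF that]] ..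
      also have "\<dots> \<in> span {p i j | i j. i \<in> E \<and> j \<in> E}"
        using that by (intro span_sum span_scale span_base) blast
      finally show ?thesis .
    qed
    hence "span E \<subseteq> span {p i j | i j. i \<in> E \<and> j \<in> E}" by (intro span_minimal) auto
    with x E(2) show ?thesis by blast
  qed
  moreover have "subspace {x. S x \<in> P}"
    by (intro subspaceI) (simp_all add: lin_add[OF antipode_linear] lin_scale[OF antipode_linear]
        lin_zero[OF antipode_linear] subspace_0[OF Psub] subspace_add[OF Psub] subspace_scale[OF Psub])
  ultimately show ?thesis using span_minimal[of "{p i j | i j. i \<in> E \<and> j \<in> E}" "{x. S x \<in> P}"] by blast
qed

section \<open>Infinitesimal rigidity of commutative coideal subalgebras\<close>

text \<open>
  A pair \<open>(a, a')\<close> stands for \<open>a + a' t\<close> in the dual numbers over the Hopf algebra, where \<open>t\<^sup>2 = 0\<close>.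
\<close>

inductive_set dual_alg :: "('q \<times> 'q) set \<Rightarrow> ('q \<times> 'q) set" for X where
  gen: "z \<in> X \<Longrightarrow> z \<in> dual_alg X"
| one: "(1, 0) \<in> dual_alg X"
| add: "(a, a') \<in> dual_alg X \<Longrightarrow> (b, b') \<in> dual_alg X \<Longrightarrow> (a + b, a' + b') \<in> dual_alg X"
| scale: "(a, a') \<in> dual_alg X \<Longrightarrow> (scale c a, scale c a') \<in> dual_alg X"
| mult: "(a, a') \<in> dual_alg X \<Longrightarrow> (b, b') \<in> dual_alg X \<Longrightarrow> (a * b, a * b' + a' * b) \<in> dual_alg X"

lemma dual_alg_sum:
  assumes "\<And>i. i \<in> I \<Longrightarrow> (f i, g i) \<in> dual_alg X"
  shows "(\<Sum>i\<in>I. scale (c i) (f i), \<Sum>i\<in>I. scale (c i) (g i)) \<in> dual_alg X"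
  using assms
proof (induction I rule: infinite_finite_induct)
  case (insert i I)
  thus ?case by (simp add: dual_alg.add dual_alg.scale)
qed (use dual_alg.scale[OF dual_alg.one, of 0] in simp_all)

definition dual_commute :: "'q \<times> 'q \<Rightarrow> 'q \<times> 'q \<Rightarrow> bool" where
  "dual_commute x y \<longleftrightarrow> fst x * fst y = fst y * fst x \<and>
     fst x * snd y + snd x * fst y = fst y * snd x + snd y * fst x"

lemma dual_commute_sym: "dual_commute x y \<Longrightarrow> dual_commute y x"
  by (auto simp: dual_commute_def add.commute)

lemma dual_alg_commute_gen:
  assumes "\<And>y. y \<in> X \<Longrightarrow> dual_commute y z" "x \<in> dual_alg X"
  shows "dual_commute x z"
  using assms(2)
proof induction
  case (gen x)
  thus ?case by (rule assms(1))
next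
  case one
  show ?case by (simp add: dual_commute_def)
next
  case (add a a' b b')
  thus ?case by (simp add: dual_commute_def distrib_left distrib_right add_ac)
next
  case (scale a a' c)
  thus ?case by (simp add: dual_commute_def scale_mult_left scale_mult_right flip: scale_right_distrib)
next
  case (mult a a' b b')
  obtain u u' where z: "z = (u, u')" by force
  from mult.IH have a: "a * u = u * a" "a * u' + a' * u = u * a' + u' * a"
    and b: "b * u = u * b" "b * u' + b' * u = u * b' + u' * b" by (simp_all add: z dual_commute_def)
  have "a * b * u = u * (a * b)" by (metis a(1) b(1) mult.assoc)
  moreover have "a * b * u' + (a * b' + a' * b) * u = u * (a * b' + a' * b) + u' * (a * b)"
  proof -
    have "a * b * u' + (a * b' + a' * b) * u = a * (b * u' + b' * u) + a' * (b * u)"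
      by (simp add: distrib_left distrib_right mult.assoc add_ac)
    also have "\<dots> = (a * u) * b' + (a * u' + a' * u) * b"
      unfolding b by (simp add: distrib_left distrib_right mult.assoc add_ac)
    also have "\<dots> = u * (a * b' + a' * b) + u' * (a * b)"
      unfolding a by (simp add: distrib_left distrib_right mult.assoc add_ac)
    finally show ?thesis .
  qed
  ultimately show ?case by (simp add: z dual_commute_def)
qed

lemma dual_alg_commute:
  assumes "\<And>x y. x \<in> X \<Longrightarrow> y \<in> X \<Longrightarrow> dual_commute x y" "x \<in> dual_alg X" "y \<in> dual_alg X"
  shows "dual_commute x y"
proof (rule dual_alg_commute_gen[OF _ assms(2)])
  fix z assume "z \<in> X"
  have "dual_commute y z" by (rule dual_alg_commute_gen[OF assms(1)[OF _ \<open>z \<in> X\<close>] assms(3)])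
  thus "dual_commute z y" by (rule dual_commute_sym)
qed

text \<open>The condition \<Delta> x \<in> Y \<otimes> Q for a dual number x, with \<Delta> extended
  linearly in t. A single list serves both components: the second legs are shared and carry no
  t.\<close>

definition dual_comult :: "('q \<times> 'q) set \<Rightarrow> 'q \<times> 'q \<Rightarrow> bool" where
  "dual_comult Y x \<longleftrightarrow> (\<exists>ys. (\<forall>y\<in>set ys. fst y \<in> Y) \<and>
     \<Delta> (fst x) = (\<Sum>(y, r)\<leftarrow>ys. tn (fst y) r) \<and> \<Delta> (snd x) = (\<Sum>(y, r)\<leftarrow>ys. tn (snd y) r))"

lemma dual_comultI:
  "(\<And>y r. (y, r) \<in> set ys \<Longrightarrow> y \<in> Y) \<Longrightarrow> \<Delta> (fst x) = (\<Sum>(y, r)\<leftarrow>ys. tn (fst y) r) \<Longrightarrow>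
   \<Delta> (snd x) = (\<Sum>(y, r)\<leftarrow>ys. tn (snd y) r) \<Longrightarrow> dual_comult Y x"
  unfolding dual_comult_def by force

lemma dual_comultE:
  assumes "dual_comult Y x"
  obtains ys where "\<And>y r. (y, r) \<in> set ys \<Longrightarrow> y \<in> Y" "\<Delta> (fst x) = (\<Sum>(y, r)\<leftarrow>ys. tn (fst y) r)"
    "\<Delta> (snd x) = (\<Sum>(y, r)\<leftarrow>ys. tn (snd y) r)"
  using assms unfolding dual_comult_def by force

lemma dual_alg_comult:
  assumes X: "\<And>x. x \<in> X \<Longrightarrow> dual_comult (dual_alg X) x" and x: "x \<in> dual_alg X"
  shows "dual_comult (dual_alg X) x"
  using x
proof induction
  case (gen x)
  thus ?case by (rule X)
next
  case one
  have "\<Delta> 0 = 0" "tn 0 1 = 0"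
    by (rule lin_zero[OF comult_linear], rule lin_zero[OF linear_tensor_left[OF vsQ]])
  thus ?case
    by (intro dual_comultI[where ys = "[((1, 0), 1)]"]) (simp_all add: dual_alg.one comult_one)
next
  case (add a a' b b')
  from add.IH obtain ys where ys: "\<And>y r. (y, r) \<in> set ys \<Longrightarrow> y \<in> dual_alg X"
    "\<Delta> a = (\<Sum>(y, r)\<leftarrow>ys. tn (fst y) r)" "\<Delta> a' = (\<Sum>(y, r)\<leftarrow>ys. tn (snd y) r)"
    by (metis dual_comultE fst_conv snd_conv)
  from add.IH obtain zs where zs: "\<And>y r. (y, r) \<in> set zs \<Longrightarrow> y \<in> dual_alg X"
    "\<Delta> b = (\<Sum>(y, r)\<leftarrow>zs. tn (fst y) r)" "\<Delta> b' = (\<Sum>(y, r)\<leftarrow>zs. tn (snd y) r)"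
    by (metis dual_comultE fst_conv snd_conv)
  show ?case
  proof (rule dual_comultI[where ys = "ys @ zs"])
    show "y \<in> dual_alg X" if "(y, r) \<in> set (ys @ zs)" for y r
    proof -
      from that have "(y, r) \<in> set ys \<or> (y, r) \<in> set zs" by simp
      thus ?thesis using ys(1) zs(1) by blast
    qed
  qed (simp_all only: fst_conv snd_conv lin_add[OF comult_linear] ys zs map_append sum_list_append)
next
  case (scale a a' c)
  from scale.IH obtain ys where ys: "\<And>y r. (y, r) \<in> set ys \<Longrightarrow> y \<in> dual_alg X"
    "\<Delta> a = (\<Sum>(y, r)\<leftarrow>ys. tn (fst y) r)" "\<Delta> a' = (\<Sum>(y, r)\<leftarrow>ys. tn (snd y) r)"
    by (metis dual_comultE fst_conv snd_conv)
  have fs: "fscale c (\<Sum>p\<leftarrow>xs. tn (F (fst p)) (snd p)) = (\<Sum>p\<leftarrow>xs. tn (scale c (F (fst p))) (snd p))"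
    for xs :: "(('q \<times> 'q) \<times> 'q) list" and F
    by (induction xs) (auto simp: lin_scale[OF linear_tensor_left[OF vsQ]] fscale_def fun_eq_iff distrib_left)
  show ?case
  proof (rule dual_comultI[where ys = "map (\<lambda>(y, r). ((scale c (fst y), scale c (snd y)), r)) ys"])
    show "y \<in> dual_alg X" if "(y, r) \<in> set (map (\<lambda>(y, r). ((scale c (fst y), scale c (snd y)), r)) ys)" for y r
      using that ys(1) by (auto intro!: dual_alg.scale)
  qed (simp_all add: lin_scale[OF comult_linear] ys fs[of fst] fs[of snd] comp_def case_prod_unfold)
next
  case (mult a a' b b')
  from mult.IH obtain ys where ys: "\<And>y r. (y, r) \<in> set ys \<Longrightarrow> y \<in> dual_alg X"
    "\<Delta> a = (\<Sum>(y, r)\<leftarrow>ys. tn (fst y) r)" "\<Delta> a' = (\<Sum>(y, r)\<leftarrow>ys. tn (snd y) r)"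
    by (metis dual_comultE fst_conv snd_conv)
  from mult.IH obtain zs where zs: "\<And>y r. (y, r) \<in> set zs \<Longrightarrow> y \<in> dual_alg X"
    "\<Delta> b = (\<Sum>(y, r)\<leftarrow>zs. tn (fst y) r)" "\<Delta> b' = (\<Sum>(y, r)\<leftarrow>zs. tn (snd y) r)"
    by (metis dual_comultE fst_conv snd_conv)
  let ?m = "\<lambda>y z. (fst y * fst z, fst y * snd z + snd y * fst z)"
  let ?ms = "concat (map (\<lambda>(y, r). map (\<lambda>(z, s). (?m y z, r * s)) zs) ys)"
  have *: "\<Delta> (u * v) = (\<Sum>(y, r)\<leftarrow>ys. \<Sum>(z, s)\<leftarrow>zs. tn (F y * G z) (r * s))"
    if "\<Delta> u = (\<Sum>(y, r)\<leftarrow>ys. tn (F y) r)" "\<Delta> v = (\<Sum>(y, r)\<leftarrow>zs. tn (G y) r)" for u v F G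
    using comult_mult_list[of u "map (\<lambda>(y, r). (F y, r)) ys" v "map (\<lambda>(y, r). (G y, r)) zs"] that
    by (simp add: comp_def case_prod_unfold)
  show ?case
  proof (rule dual_comultI[where ys = ?ms])
    show "y \<in> dual_alg X" if "(y, r) \<in> set ?ms" for y r
      using that ys(1) zs(1) by (force intro!: dual_alg.mult)
    show "\<Delta> (fst (a * b, a * b' + a' * b)) = (\<Sum>(y, r)\<leftarrow>?ms. tn (fst y) r)"
      by (simp add: *[OF ys(2) zs(2)] sum_list_map_concat comp_def case_prod_unfold)
    have "\<Delta> (a * b' + a' * b) = (\<Sum>(y, r)\<leftarrow>ys. \<Sum>(z, s)\<leftarrow>zs. tn (fst y * snd z) (r * s)) +
       (\<Sum>(y, r)\<leftarrow>ys. \<Sum>(z, s)\<leftarrow>zs. tn (snd y * fst z) (r * s))"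
      unfolding lin_add[OF comult_linear] *[OF ys(2) zs(3)] *[OF ys(3) zs(2)] ..
    also have "\<dots> = (\<Sum>(y, r)\<leftarrow>?ms. tn (snd y) r)"
      by (simp only: sum_list_map_concat list.map_comp comp_def case_prod_unfold sum_list_addf[symmetric]
          lin_add[OF linear_tensor_left[OF vsQ]] fst_conv snd_conv)
    finally show "\<Delta> (snd (a * b, a * b' + a' * b)) = (\<Sum>(y, r)\<leftarrow>?ms. tn (snd y) r)" by simp
  qed
qed

lemma dual_comult_indexed:
  assumes "dual_comult Y x"
  obtains n :: nat and f g r where "\<And>k. k < n \<Longrightarrow> (f k, g k) \<in> Y"
    "\<Delta> (fst x) = (\<Sum>k<n. tn (f k) (r k))" "\<Delta> (snd x) = (\<Sum>k<n. tn (g k) (r k))"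
proof -
  obtain ys where ys: "\<And>y r. (y, r) \<in> set ys \<Longrightarrow> y \<in> Y" "\<Delta> (fst x) = (\<Sum>(y, r)\<leftarrow>ys. tn (fst y) r)"
    "\<Delta> (snd x) = (\<Sum>(y, r)\<leftarrow>ys. tn (snd y) r)" using assms by (rule dual_comultE) blast
  show thesis
  proof (rule that[of "length ys" "\<lambda>k. fst (fst (ys ! k))" "\<lambda>k. snd (fst (ys ! k))" "\<lambda>k. snd (ys ! k)"])
    fix k assume "k < length ys"
    hence "(fst (ys ! k), snd (ys ! k)) \<in> set ys" by simp
    from ys(1)[OF this] show "(fst (fst (ys ! k)), snd (fst (ys ! k))) \<in> Y" by simp
  qed (simp_all add: ys sum_list_sum_nth case_prod_unfold atLeast0LessThan)
qed

text \<open>An element of B has many lifts to the dual algebra, and only modulo the centralizer Z is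
  b' a function of b. Modulo Z it is a derivation of B, which the dual bases show to be inner and
  then zero.\<close>

lemma rigidity:
  assumes fin: "fin_dim scale UNIV" and h: "haar h" and char0: "\<And>n. n > 0 \<Longrightarrow> (of_nat n :: 'k) \<noteq> 0"
    and comm: "\<And>x y. x \<in> X \<Longrightarrow> y \<in> X \<Longrightarrow> dual_commute x y"
    and comul: "\<And>x. x \<in> X \<Longrightarrow> dual_comult (dual_alg X) x"
    and bd: "(b, b') \<in> dual_alg X" and cd: "(c, c') \<in> dual_alg X"
  shows "b' * c = c * b'"
proof -
  note hl = haar_linear[OF h]
  define D where "D = dual_alg X"
  define B where "B = fst ` D"
  have DB: "x \<in> B" if "(x, y) \<in> D" for x y using that unfolding B_def by force
  have D_comm: "dual_commute x y" if "x \<in> D" "y \<in> D" for x y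
    using dual_alg_commute[OF comm] that by (simp add: D_def)
  have Bcomm: "x * y = y * x" if "x \<in> B" "y \<in> B" for x y
  proof -
    obtain u v where "(x, u) \<in> D" "(y, v) \<in> D" using \<open>x \<in> B\<close> \<open>y \<in> B\<close> by (auto simp: B_def)
    from D_comm[OF this] show ?thesis by (simp add: dual_commute_def)
  qed
  have Bsub: "subspace B"
  proof (rule subspaceI)
    show "0 \<in> B" using dual_alg_sum[of "{}" _ _ X] by (force simp: B_def D_def image_iff)
    show "x + y \<in> B" if "x \<in> B" "y \<in> B" for x y
      using that dual_alg.add[of _ _ X] by (force simp: B_def D_def image_iff)
    show "scale c x \<in> B" if "x \<in> B" for c x
      using that dual_alg.scale[of _ _ X] by (force simp: B_def D_def image_iff)
  qed
  have Bmult: "x * y \<in> B" if "x \<in> B" "y \<in> B" for x y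
    using that dual_alg.mult[of _ _ X] by (force simp: B_def D_def image_iff)
  have B1: "1 \<in> B" using dual_alg.one[of X] by (force simp: B_def D_def image_iff)
  have Balg: "subalgebra scale B" using Bsub B1 Bmult by (simp add: subalgebra_def)
  have lift: "\<exists>n f g r. (\<forall>k<n. (f k, g k) \<in> D) \<and>
      \<Delta> x = (\<Sum>k<n::nat. tn (f k) (r k)) \<and> \<Delta> y = (\<Sum>k<n. tn (g k) (r k))" if "(x, y) \<in> D" for x y
  proof -
    have "dual_comult D (x, y)" using dual_alg_comult[OF comul] that by (simp add: D_def)
    then obtain n :: nat and f g r where "\<And>k. k < n \<Longrightarrow> (f k, g k) \<in> D"
      "\<Delta> (fst (x, y)) = (\<Sum>k<n. tn (f k) (r k))" "\<Delta> (snd (x, y)) = (\<Sum>k<n. tn (g k) (r k))"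
      by (rule dual_comult_indexed) blast
    thus ?thesis by (intro exI[of _ n] exI[of _ f] exI[of _ g] exI[of _ r]) simp
  qed
  have coid: "coideal B"
    unfolding coideal_def
  proof (intro conjI ballI Bsub)
    fix x assume "x \<in> B"
    then obtain y where "(x, y) \<in> D" by (auto simp: B_def)
    from lift[OF this] obtain n f g r where "\<forall>k<n. (f k, g k) \<in> D" "\<Delta> x = (\<Sum>k<n::nat. tn (f k) (r k))" by blast
    thus "\<Delta> x \<in> tensor_space scale scale B UNIV"
      using DB by (auto intro!: tensor_space_sum tensor_in_tensor_space)
  qed
  obtain E p where E: "E \<subseteq> B" "span E = B" "independent E" and p: "comatrix E p"
    and \<Delta>E: "\<And>e. e \<in> E \<Longrightarrow> \<Delta> e = (\<Sum>i\<in>E. tn i (p i e))" using coideal_comatrix[OF fin coid] by metis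
  have finE: "finite E" using p by (simp add: comatrix_def)
  obtain d where dB: "\<And>a. a \<in> E \<Longrightarrow> d a \<in> B"
    and hd: "\<And>a b. a \<in> E \<Longrightarrow> b \<in> E \<Longrightarrow> h (d a * b) = (if a = b then 1 else 0)"
    using haar_dual_basis[OF fin h Balg coid Bcomm E finE] by metis
  have nondeg: "x = y" if "x \<in> B" "y \<in> B" "\<And>a. a \<in> E \<Longrightarrow> h (x * a) = h (y * a)" for x y
  proof -
    have "h ((x - y) * z) = 0" if "z \<in> B" for z
      using functional_mult_zero_on_span[OF hl, of E "x - y" z] that E(2) \<open>\<And>a. a \<in> E \<Longrightarrow> h (x * a) = h (y * a)\<close>
      by (simp add: left_diff_distrib lin_diff[OF hl])
    with haar_nondegenerate[OF fin h Balg coid Bcomm, of "x - y"] that(1,2) show ?thesis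
      by (simp add: subspace_diff[OF Bsub])
  qed
  have expand_d: "x = (\<Sum>a\<in>E. scale (h (x * a)) (d a))" if "x \<in> B" for x
  proof (rule nondeg[OF that])
    show "(\<Sum>a\<in>E. scale (h (x * a)) (d a)) \<in> B"
      using dB by (intro subspace_sum[OF Bsub] subspace_scale[OF Bsub])
    fix b assume b: "b \<in> E"
    have "h ((\<Sum>a\<in>E. scale (h (x * a)) (d a)) * b) = (\<Sum>a\<in>E. if a = b then h (x * a) else 0)"
      unfolding sum_distrib_right scale_mult_left lin_sum[OF hl] lin_scale[OF hl]
      by (intro sum.cong refl) (simp add: hd b)
    thus "h (x * b) = h ((\<Sum>a\<in>E. scale (h (x * a)) (d a)) * b)" using b finE by simp
  qed
  have expand_E: "x = (\<Sum>a\<in>E. scale (h (x * d a)) a)" if "x \<in> B" for x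
  proof -
    obtain u where u: "x = (\<Sum>a\<in>E. scale (u a) a)" using \<open>x \<in> B\<close> unfolding E(2)[symmetric] span_finite[OF finE] by auto
    have "h (x * d b) = u b" if b: "b \<in> E" for b
    proof -
      have "h (x * d b) = h (d b * x)" using Bcomm[OF \<open>x \<in> B\<close> dB[OF b]] by simp
      also have "\<dots> = (\<Sum>a\<in>E. if a = b then u a else 0)"
        unfolding u sum_distrib_left scale_mult_right lin_sum[OF hl] lin_scale[OF hl]
        by (intro sum.cong refl) (simp add: hd b)
      finally show ?thesis using b finE by simp
    qed
    thus ?thesis using u by simp
  qed
  define Z where "Z = {z. \<forall>y\<in>B. z * y = y * z}"
  have Zalg: "subalgebra scale Z" unfolding Z_def by (rule subalgebra_centralizer)
  have Zsub: "subspace Z" and Zmult: "\<And>x y. x \<in> Z \<Longrightarrow> y \<in> Z \<Longrightarrow> x * y \<in> Z"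
    and Zone: "1 \<in> Z" using Zalg by (auto simp: subalgebra_def)
  have BZ: "x \<in> Z" if "x \<in> B" for x using that Bcomm by (simp add: Z_def)
  \<comment> \<open>Both lifts commute with a lift of \<open>u\<close>; subtracting the two
    t-coefficients leaves the commutator of \<open>y - y'\<close> with \<open>u\<close>.\<close>
  have diff_Z: "y - y' \<in> Z" if "(x, y) \<in> D" "(x, y') \<in> D" for x y y'
    unfolding Z_def
  proof (intro CollectI ballI)
    fix u assume "u \<in> B"
    then obtain v where "(u, v) \<in> D" by (auto simp: B_def)
    with that D_comm have "dual_commute (x, y) (u, v)" "dual_commute (x, y') (u, v)" by blast+
    hence "x * v + y * u = u * y + v * x" "x * v + y' * u = u * y' + v * x"
      by (simp_all add: dual_commute_def)
    hence "(x * v + y * u) - (x * v + y' * u) = (u * y + v * x) - (u * y' + v * x)" by simp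
    thus "(y - y') * u = u * (y - y')" by (simp add: left_diff_distrib right_diff_distrib)
  qed
  have "\<exists>y. (d a, y) \<in> D" if "a \<in> E" for a using dB[OF that] by (auto simp: B_def)
  then obtain d' where d': "\<And>a. a \<in> E \<Longrightarrow> (d a, d' a) \<in> D" by metis
  \<comment> \<open>All data for one basis element at once: \<open>d a\<close> and
    \<open>d' a\<close> get the same second legs \<open>r a k\<close>, so that the matrix
    \<open>q\<close> below describes both coproducts.\<close>
  define C where "C = (\<lambda>a n f g r. (\<forall>k<n. (f k, g k) \<in> D) \<and>
      \<Delta> (d a) = (\<Sum>k<n::nat. tn (f k) (r k)) \<and> \<Delta> (d' a) = (\<Sum>k<n. tn (g k) (r k)))"
  have "\<forall>a\<in>E. \<exists>n f g r. C a n f g r"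
    unfolding C_def using lift[OF d'] by blast
  from bchoice[OF this] obtain n where "\<forall>a\<in>E. \<exists>f g r. C a (n a) f g r" ..
  from bchoice[OF this] obtain f where "\<forall>a\<in>E. \<exists>g r. C a (n a) (f a) g r" ..
  from bchoice[OF this] obtain g where "\<forall>a\<in>E. \<exists>r. C a (n a) (f a) (g a) r" ..
  from bchoice[OF this] obtain r where C: "\<forall>a\<in>E. C a (n a) (f a) (g a) (r a)" ..
  have fg: "(f a k, g a k) \<in> D" if "a \<in> E" "k < n a" for a k using C that by (simp add: C_def)
  have \<Delta>d: "\<Delta> (d a) = (\<Sum>k<n a. tn (f a k) (r a k))" if "a \<in> E" for a using C that by (simp add: C_def)
  have \<Delta>d': "\<Delta> (d' a) = (\<Sum>k<n a. tn (g a k) (r a k))" if "a \<in> E" for a using C that by (simp add: C_def)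
  \<comment> \<open>By \<open>expand_d\<close> this is the coefficient of \<open>d i\<close> in
    \<Delta> (d a). It equals \<open>S (p a i)\<close> because the dual basis transforms
    contragrediently.\<close>
  define q where "q = (\<lambda>i a. \<Sum>k<n a. scale (h (f a k * i)) (r a k))"
  have q_S: "q i a = S (p a i)" if "i \<in> E" "a \<in> E" for i a
  proof -
    \<comment> \<open>Invariance of \<open>h\<close> at \<open>d a * b\<close>: the matrix with
      entries \<open>q j a\<close> is, up to transposition, a left inverse of \<open>p\<close>,
      hence equal to S(p).\<close>
    have 1: "(\<Sum>j\<in>E. q j a * p j b) = (if a = b then 1 else 0)" if b: "b \<in> E" for b
    proof -
      have "(\<Sum>j\<in>E. q j a * p j b) = (\<Sum>k<n a. \<Sum>j\<in>E. scale (h (f a k * j)) (r a k * p j b))"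
        unfolding q_def sum_distrib_right scale_mult_left by (rule sum.swap)
      also have "\<dots> = sw (\<lambda>a b. scale (h a) b) (d a * b)"
        by (rule sw_mult_sum[OF vsQ bil_functional_left[OF hl] _ finE \<Delta>d[OF \<open>a \<in> E\<close>] \<Delta>E[OF b], symmetric]) simp
      also have "\<dots> = (if a = b then 1 else 0)" using h hd[OF \<open>a \<in> E\<close> b] by (simp add: haar_def)
      finally show ?thesis .
    qed
    have "q i a = (\<Sum>j\<in>E. if j = i then q j a else 0)" using that finE by simp
    also have "\<dots> = (\<Sum>j\<in>E. q j a * (\<Sum>b\<in>E. p j b * S (p b i)))"
      by (intro sum.cong refl) (simp add: comatrix_antipode_right[OF p _ that(1)])
    also have "\<dots> = (\<Sum>b\<in>E. (\<Sum>j\<in>E. q j a * p j b) * S (p b i))"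
      unfolding sum_distrib_left sum_distrib_right mult.assoc by (rule sum.swap)
    also have "\<dots> = (\<Sum>b\<in>E. if b = a then S (p b i) else 0)"
      by (intro sum.cong refl) (simp add: 1)
    also have "\<dots> = S (p a i)" using that finE by simp
    finally show ?thesis .
  qed
  text \<open>
    The sum of the \<open>a \<otimes> d a\<close> is coinvariant, hence so is its image under the product map (\<open>u = d\<close>);
    for \<open>u = d'\<close> this holds modulo the centralizer of \<open>B\<close>.
  \<close>
  have coinvariant: "scale (h (\<Sum>a\<in>E. a * u a)) 1 - (\<Sum>a\<in>E. a * u a) \<in> W"
    if W: "subspace W" "\<And>x y. x \<in> B \<Longrightarrow> y \<in> W \<Longrightarrow> x * y \<in> W"
      and \<Delta>u: "\<And>a. a \<in> E \<Longrightarrow> \<Delta> (u a) = (\<Sum>k<n a. tn (v a k) (r a k))"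
      and v: "\<And>a k. a \<in> E \<Longrightarrow> k < n a \<Longrightarrow> v a k - (\<Sum>i\<in>E. scale (h (f a k * i)) (u i)) \<in> W" for u v W
  proof -
    let ?\<beta> = "\<lambda>a b. scale (h b) a"
    let ?e = "\<lambda>a k. \<Sum>i\<in>E. scale (h (f a k * i)) (u i)"
    note bil = bil_functional_right[OF hl]
    have "scale (h (\<Sum>a\<in>E. a * u a)) 1 = sw ?\<beta> (\<Sum>a\<in>E. a * u a)"
      using h by (simp add: haar_def)
    also have "\<dots> = (\<Sum>a\<in>E. sw ?\<beta> (a * u a))" by (rule lin_sum[OF linear_sw[OF vsQ bil]])
    also have "\<dots> = (\<Sum>a\<in>E. \<Sum>j\<in>E. \<Sum>k<n a. scale (h (p j a * r a k)) (j * v a k))"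
      by (intro sum.cong refl sw_mult_sum[OF vsQ bil finE finite_lessThan \<Delta>E \<Delta>u])
    finally have 1: "scale (h (\<Sum>a\<in>E. a * u a)) 1 =
      (\<Sum>a\<in>E. \<Sum>j\<in>E. \<Sum>k<n a. scale (h (p j a * r a k)) (j * v a k))" .
    \<comment> \<open>If \<open>v\<close> is replaced by its expansion \<open>?e\<close>, the sum
      over \<open>a\<close> becomes the matrix product p S(p) = 1 and leaves the sum of the
      \<open>a * u a\<close>. The error \<open>v - ?e\<close> stays in \<open>W\<close>.\<close>
    have "(\<Sum>k<n a. scale (h (p j a * r a k)) (j * ?e a k)) = (\<Sum>i\<in>E. scale (h (p j a * q i a)) (j * u i))"
      for a j
    proof -
      have "(\<Sum>k<n a. scale (h (p j a * r a k)) (j * ?e a k)) =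
         (\<Sum>k<n a. \<Sum>i\<in>E. scale (h (p j a * r a k) * h (f a k * i)) (j * u i))"
        by (simp add: sum_distrib_left scale_mult_right scale_sum_right)
      also have "\<dots> = (\<Sum>i\<in>E. \<Sum>k<n a. scale (h (p j a * r a k) * h (f a k * i)) (j * u i))" by (rule sum.swap)
      also have "\<dots> = (\<Sum>i\<in>E. scale (h (p j a * q i a)) (j * u i))"
        by (simp add: q_def sum_distrib_left scale_mult_right lin_sum[OF hl] lin_scale[OF hl] scale_sum_left mult.commute)
      finally show ?thesis .
    qed
    hence "(\<Sum>a\<in>E. \<Sum>j\<in>E. \<Sum>k<n a. scale (h (p j a * r a k)) (j * ?e a k)) =
       (\<Sum>a\<in>E. \<Sum>j\<in>E. \<Sum>i\<in>E. scale (h (p j a * q i a)) (j * u i))" by simp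
    also have "\<dots> = (\<Sum>j\<in>E. \<Sum>i\<in>E. \<Sum>a\<in>E. scale (h (p j a * q i a)) (j * u i))"
      by (subst sum.swap, subst (2) sum.swap) (rule refl)
    also have "\<dots> = (\<Sum>j\<in>E. \<Sum>i\<in>E. scale (h (\<Sum>a\<in>E. p j a * q i a)) (j * u i))"
      by (simp add: scale_sum_left lin_sum[OF hl])
    also have "\<dots> = (\<Sum>j\<in>E. \<Sum>i\<in>E. if i = j then j * u i else 0)"
    proof (intro sum.cong refl)
      fix j i assume ji: "j \<in> E" "i \<in> E"
      have "(\<Sum>a\<in>E. p j a * q i a) = (\<Sum>a\<in>E. p j a * S (p a i))"
        by (intro sum.cong refl) (simp add: q_S ji)
      thus "scale (h (\<Sum>a\<in>E. p j a * q i a)) (j * u i) = (if i = j then j * u i else 0)"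
        using h by (simp add: comatrix_antipode_right[OF p ji] haar_def lin_zero[OF hl])
    qed
    also have "\<dots> = (\<Sum>a\<in>E. a * u a)" using finE by simp
    finally have 2: "(\<Sum>a\<in>E. a * u a) =
      (\<Sum>a\<in>E. \<Sum>j\<in>E. \<Sum>k<n a. scale (h (p j a * r a k)) (j * ?e a k))" ..
    have "scale (h (\<Sum>a\<in>E. a * u a)) 1 - (\<Sum>a\<in>E. a * u a) =
      (\<Sum>a\<in>E. \<Sum>j\<in>E. \<Sum>k<n a. scale (h (p j a * r a k)) (j * (v a k - ?e a k)))"
      unfolding 1 by (subst 2) (simp only: sum_subtractf[symmetric] scale_right_diff_distrib[symmetric] right_diff_distrib)
    also have "\<dots> \<in> W"
      using E(1) by (intro subspace_sum[OF W(1)] subspace_scale[OF W(1)] W(2) v) auto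
    finally show ?thesis .
  qed
  define w where "w = (\<Sum>a\<in>E. a * d' a)"
  have "scale (h w) 1 - w \<in> Z"
    unfolding w_def
  proof (rule coinvariant[OF Zsub _ \<Delta>d'])
    show "x * y \<in> Z" if "x \<in> B" "y \<in> Z" for x y using that BZ Zmult by blast
    fix a k assume ak: "a \<in> E" "k < n a"
    \<comment> \<open>Two lifts of \<open>f a k\<close> are compared: \<open>g a k\<close>, which
      comes from the coproduct of \<open>d' a\<close>, and the combination of the
      \<open>d' i\<close> that lifts its expansion in the dual basis.\<close>
    have "(\<Sum>i\<in>E. scale (h (f a k * i)) (d i), \<Sum>i\<in>E. scale (h (f a k * i)) (d' i)) \<in> D"
      unfolding D_def by (rule dual_alg_sum) (use d' in \<open>simp add: D_def\<close>)
    hence "(f a k, \<Sum>i\<in>E. scale (h (f a k * i)) (d' i)) \<in> D"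
      using expand_d[OF DB[OF fg[OF ak]]] by simp
    from diff_Z[OF fg[OF ak] this]
    show "g a k - (\<Sum>i\<in>E. scale (h (f a k * i)) (d' i)) \<in> Z" .
  qed
  from subspace_diff[OF Zsub subspace_scale[OF Zsub Zone, of "h w"] this] have wZ: "w \<in> Z" by simp
  define m where "m = (\<Sum>a\<in>E. a * d a)"
  have "scale (h m) 1 - m \<in> {0}"
    unfolding m_def
  proof (rule coinvariant[OF subspace_single_0 _ \<Delta>d])
    fix a k assume ak: "a \<in> E" "k < n a"
    show "f a k - (\<Sum>i\<in>E. scale (h (f a k * i)) (d i)) \<in> {0}"
      using expand_d[OF DB[OF fg[OF ak]]] by simp
  qed simp_all
  hence m: "m = scale (h m) 1" by simp
  have "h m = (\<Sum>a\<in>E. h (d a * a))"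
    unfolding m_def lin_sum[OF hl] using Bcomm dB E(1) by (intro sum.cong) auto
  also have "\<dots> = of_nat (card E)" by (simp add: hd)
  finally have hm: "h m = of_nat (card E)" .
  have "E \<noteq> {}" using E(2) B1 one_neq_zero by auto
  hence "h m \<noteq> 0" using char0 finE hm by (simp add: card_gt_0_iff)
  have bB: "b \<in> B" and cB: "c \<in> B" and bD: "(b, b') \<in> D" using bd cd DB by (auto simp: D_def)
  \<comment> \<open>In B \<otimes> B, multiplying the sum of the x \<otimes> d x by b on the left or
    on the right gives the same. Its t-coefficient uses two lifts of \<open>d x * b\<close>, the
    product of the lifts of \<open>d x\<close> and \<open>b\<close> and the lift of its expansion
    \<open>?e x\<close>, which agree modulo Z.\<close>
  have "b * w - (m * b' + w * b) \<in> Z"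
  proof -
    let ?e = "\<lambda>x. \<Sum>a\<in>E. scale (h (d x * b * a)) (d' a)"
    have "b * w = (\<Sum>a\<in>E. (b * a) * d' a)" by (simp add: w_def sum_distrib_left mult.assoc)
    also have "\<dots> = (\<Sum>a\<in>E. \<Sum>x\<in>E. scale (h (d x * b * a)) (x * d' a))"
    proof (intro sum.cong refl)
      fix a assume a: "a \<in> E"
      hence baB: "b * a \<in> B" using Bmult bB E(1) by blast
      have "b * a = (\<Sum>x\<in>E. scale (h (d x * b * a)) x)"
      proof -
        have "d x * b * a = b * a * d x" if "x \<in> E" for x
          using Bcomm[OF dB[OF that] baB] by (simp only: mult.assoc)
        thus ?thesis by (subst expand_E[OF baB]) (simp cong: sum.cong)
      qed
      hence "(b * a) * d' a = (\<Sum>x\<in>E. scale (h (d x * b * a)) x) * d' a" by simp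
      thus "(b * a) * d' a = (\<Sum>x\<in>E. scale (h (d x * b * a)) (x * d' a))"
        by (simp only: sum_distrib_right scale_mult_left)
    qed
    also have "\<dots> = (\<Sum>x\<in>E. x * ?e x)"
      by (subst sum.swap) (simp only: sum_distrib_left scale_mult_right)
    finally have 1: "b * w = (\<Sum>x\<in>E. x * ?e x)" .
    have 2: "m * b' + w * b = (\<Sum>x\<in>E. x * (d x * b' + d' x * b))"
      by (simp add: m_def w_def sum_distrib_right distrib_left sum.distrib mult.assoc)
    have "?e x - (d x * b' + d' x * b) \<in> Z" if x: "x \<in> E" for x
    proof (rule diff_Z)
      show "(d x * b, d x * b' + d' x * b) \<in> D"
        using dual_alg.mult d'[OF x] bD unfolding D_def by blast
      have "(\<Sum>a\<in>E. scale (h (d x * b * a)) (d a), ?e x) \<in> D"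
        unfolding D_def by (rule dual_alg_sum) (use d' in \<open>simp add: D_def\<close>)
      thus "(d x * b, ?e x) \<in> D" using expand_d[OF Bmult[OF dB[OF x] bB]] by simp
    qed
    hence "(\<Sum>x\<in>E. x * (?e x - (d x * b' + d' x * b))) \<in> Z"
      using E(1) BZ by (intro subspace_sum[OF Zsub] Zmult) auto
    thus ?thesis unfolding 1 2 by (simp only: right_diff_distrib sum_subtractf)
  qed
  moreover have "b * w = w * b" using wZ bB by (simp add: Z_def)
  ultimately have "- (m * b') \<in> Z" by simp
  hence "scale (h m) b' \<in> Z" using subspace_neg[OF Zsub] m by (metis minus_minus mult_1_left scale_mult_left)
  hence "scale (inverse (h m)) (scale (h m) b') \<in> Z" by (rule subspace_scale[OF Zsub])
  hence "b' \<in> Z" using \<open>h m \<noteq> 0\<close> by simp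
  with cB show ?thesis by (simp add: Z_def)
qed

end

section \<open>Quadratic independence\<close>

lemma bilinear_on_mult: "k_algebra s \<Longrightarrow> bilinear_on s s s U W (*)"
  by (auto simp: bilinear_on_def distrib_left distrib_right k_algebra.scale_mult_left k_algebra.scale_mult_right)

lemma commutators_induct:
  assumes "t \<in> commutators s V" "module.subspace fscale R"
    and "\<And>v w. v \<in> V \<Longrightarrow> w \<in> V \<Longrightarrow> tensor s s v w - tensor s s w v \<in> R"
  shows "t \<in> R"
proof -
  have "{tensor s s v w - tensor s s w v | v w. v \<in> V \<and> w \<in> V} \<subseteq> R" using assms(3) by blast
  from module.span_minimal[OF module_fscale this assms(2)] assms(1)
  show ?thesis unfolding commutators_def by (rule subsetD)
qed

text \<open>Injectivity is assumed on cosets; comparing the cosets of \<open>t\<close> and 0 brings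
  it down to tensors.\<close>

lemma quadratic_kernel:
  fixes s :: "'k::field \<Rightarrow> 'a::{comm_ring, comm_monoid_mult} \<Rightarrow> 'a"
  assumes alg: "k_algebra s" and V: "module.subspace s V" and qi: "quadratically_independent s V"
    and t: "t \<in> tensor_space s s V V" and zero: "tensor_lift s s V V (*) t = 0"
  shows "t \<in> commutators s V"
proof -
  interpret k_algebra s by fact
  note prems = vector_space_axioms vector_space_axioms vector_space_axioms V V bilinear_on_mult[OF alg]
  let ?T = "tensor_space s s V V" and ?m = "tensor_lift s s V V (*)"
  let ?R = "{(t, t'). t \<in> ?T \<and> t' \<in> ?T \<and> t - t' \<in> commutators s V}"
  have zeroT: "0 \<in> ?T" by (rule tensor_space_zero)
  have zeroC: "0 \<in> commutators s V" unfolding commutators_def by (rule module.span_zero[OF module_fscale])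
  have diff: "?m (x - y) = ?m x - ?m y" if "x \<in> ?T" "y \<in> ?T" for x y
  proof -
    have "x - y \<in> ?T" using that by (rule module.subspace_diff[OF module_fscale subspace_tensor_space])
    from tensor_lift_add[OF prems this that(2)] show ?thesis by simp
  qed
  have comm0: "?m x = 0" if "x \<in> commutators s V" for x
  proof -
    have sub: "module.subspace fscale {x \<in> ?T. ?m x = 0}"
      by (intro module.subspaceI[OF module_fscale])
         (simp_all add: tensor_space_zero tensor_space_add tensor_space_scale tensor_lift_zero[OF prems]
           tensor_lift_add[OF prems] tensor_lift_scale[OF prems])
    have "x \<in> {x \<in> ?T. ?m x = 0}"
    proof (rule commutators_induct[OF that sub])
      fix v w assume vw: "v \<in> V" "w \<in> V"
      hence "tensor s s v w \<in> ?T" "tensor s s w v \<in> ?T" by (simp_all add: tensor_in_tensor_space)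
      thus "tensor s s v w - tensor s s w v \<in> {x \<in> ?T. ?m x = 0}"
        using vw by (simp add: diff tensor_lift_tensor[OF prems] mult.commute
            module.subspace_diff[OF module_fscale subspace_tensor_space])
    qed
    thus ?thesis by simp
  qed
  \<comment> \<open>\<open>sym_square_mult\<close> is defined by \<open>the_elem\<close>, so the
    product must be shown constant on the coset before its value can be named.\<close>
  have img: "sym_square_mult s V (?R `` {x}) = 0" if x: "x \<in> ?T" "?m x = 0" for x
  proof -
    have "?m y = 0" if "y \<in> ?R `` {x}" for y
    proof -
      from that have "y \<in> ?T" "?m (x - y) = 0" by (auto intro: comm0)
      with diff[OF x(1) \<open>y \<in> ?T\<close>] x(2) show ?thesis by simp
    qed
    moreover have "x \<in> ?R `` {x}" using x zeroC by simp
    ultimately have "?m ` (?R `` {x}) = {0}" by (auto simp: image_iff intro!: bexI[of _ x])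
    thus ?thesis unfolding sym_square_mult_def by simp
  qed
  have "?R `` {x} \<in> sym_square s V" if "x \<in> ?T" for x
    unfolding sym_square_def using that by (rule quotientI)
  note cls = this
  have "sym_square_mult s V (?R `` {t}) = sym_square_mult s V (?R `` {0})"
    unfolding img[OF t zero] img[OF zeroT tensor_lift_zero[OF prems]] ..
  from inj_onD[OF qi[unfolded quadratically_independent_def] this cls[OF t] cls[OF zeroT]]
  have "?R `` {t} = ?R `` {0}" .
  moreover have "t \<in> ?R `` {t}" using t zeroC by simp
  ultimately have "0 - t \<in> commutators s V" by blast
  hence "- (0 - t) \<in> commutators s V"
    unfolding commutators_def by (rule module.span_neg[OF module_fscale])
  thus ?thesis by simp
qed

text \<open>The relation puts the tensor with coefficients \<open>c k l\<close> among the
  commutators, where every symmetric bilinear form vanishes. The symmetrised product of the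
  coordinate functionals at \<open>k\<close> and \<open>l\<close> reads off
  \<open>c k l + c l k\<close>.\<close>

lemma quadratic_relation_coefficients:
  fixes s :: "'k::field \<Rightarrow> 'a::{comm_ring, comm_monoid_mult} \<Rightarrow> 'a"
  assumes alg: "k_algebra s" and qi: "quadratically_independent s (module.span s E)"
    and E: "finite E" "\<not> module.dependent s E"
    and zero: "(\<Sum>k\<in>E. \<Sum>l\<in>E. s (c k l) (k * l)) = 0" and kl: "k \<in> E" "l \<in> E"
  shows "c k l + c l k = 0"
proof -
  interpret k_algebra s by fact
  interpret vector_space_pair s "(*) :: 'k \<Rightarrow> 'k \<Rightarrow> 'k"
    using vector_space_axioms vector_space_mult by (simp add: vector_space_pair_def)
  let ?V = "span E"
  note prems = vector_space_axioms vector_space_axioms vector_space_axioms subspace_span[of E]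
    subspace_span[of E] bilinear_on_mult[OF alg]
  define t where "t = (\<Sum>k\<in>E. \<Sum>l\<in>E. tensor s s (s (c k l) k) l)"
  have in_T: "tensor s s (s (c k l) k) l \<in> tensor_space s s ?V ?V" if "k \<in> E" "l \<in> E" for k l
    using that by (intro tensor_in_tensor_space span_scale span_base)
  have "tensor_lift s s ?V ?V (*) t = (\<Sum>k\<in>E. \<Sum>l\<in>E. s (c k l) (k * l))"
  proof -
    have "tensor_lift s s ?V ?V (*) t = (\<Sum>k\<in>E. tensor_lift s s ?V ?V (*) (\<Sum>l\<in>E. tensor s s (s (c k l) k) l))"
      unfolding t_def by (rule tensor_lift_sum[OF prems]) (intro tensor_space_sum in_T)
    also have "\<dots> = (\<Sum>k\<in>E. \<Sum>l\<in>E. s (c k l) k * l)"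
      by (intro sum.cong refl tensor_lift_sum_tensor[OF prems] span_scale span_base)
    finally show ?thesis by (simp add: scale_mult_left)
  qed
  hence "tensor_lift s s ?V ?V (*) t = 0" unfolding zero .
  moreover have "t \<in> tensor_space s s ?V ?V" unfolding t_def by (intro tensor_space_sum in_T)
  ultimately have tC: "t \<in> commutators s ?V" using quadratic_kernel[OF alg subspace_span qi] by blast
  have "\<exists>x. Vector_Spaces.linear s (*) x \<and> (\<forall>y\<in>E. x y = (if y = k then 1 else 0))" for k
    using linear_independent_extend[OF E(2), of "\<lambda>y. if y = k then 1 else 0"] by auto
  from choice[OF allI[OF this]] obtain x
    where "\<forall>k. Vector_Spaces.linear s (*) (x k) \<and> (\<forall>y\<in>E. x k y = (if y = k then 1 else 0))" ..
  hence x: "\<And>k. Vector_Spaces.linear s (*) (x k)"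
    "\<And>k y. y \<in> E \<Longrightarrow> x k y = (if y = k then 1 else 0)" by auto
  define \<beta> where "\<beta> = (\<lambda>u v. x k u * x l v + x l u * x k v)"
  have \<beta>: "bilinear_on s s (*) UNIV UNIV \<beta>"
    unfolding bilinear_on_def \<beta>_def lin_add[OF x(1)] lin_scale[OF x(1)]
    by (intro conjI allI ballI) (simp_all only: distrib_left distrib_right mult_ac add_ac)
  have sub: "module.subspace fscale {t. t \<beta> = 0}"
    by (intro module.subspaceI[OF module_fscale]) (simp_all add: fscale_def)
  have "t \<in> {t. t \<beta> = 0}"
    by (rule commutators_induct[OF tC sub]) (simp add: tensor_def \<beta> \<beta>_def algebra_simps)
  hence "0 = t \<beta>" by simp
  also have "t \<beta> = (\<Sum>k'\<in>E. \<Sum>l'\<in>E. \<beta> (s (c k' l') k') l')"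
  proof -
    have app: "(\<Sum>i\<in>I. F i) \<beta> = (\<Sum>i\<in>I. F i \<beta>)" for I :: "'a set" and F :: "'a \<Rightarrow> ('a, 'a, 'k) tensor"
      by (induction I rule: infinite_finite_induct) auto
    show ?thesis unfolding t_def app by (simp add: tensor_def \<beta>)
  qed
  also have "\<dots> = (\<Sum>k'\<in>E. \<Sum>l'\<in>E. (if l' = l then (if k' = k then c k' l' else 0) else 0) +
      (if l' = k then (if k' = l then c k' l' else 0) else 0))"
    by (intro sum.cong refl) (simp add: \<beta>_def lin_scale[OF x(1)] x(2))
  also have "\<dots> = c k l + c l k"
    using E(1) kl by (simp add: sum.distrib)
  finally show ?thesis by simp
qed

section \<open>The coefficient comatrix of the coaction\<close>

context hopf_coaction
begin

lemma coaction_subalgebra: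
  assumes P: "subalgebra scaleQ P"
  shows "subalgebra scaleA {a. \<alpha> a \<in> tensor_space scaleA scaleQ UNIV P}"
  unfolding subalgebra_def
proof (intro conjI ballI)
  show "A.subspace {a. \<alpha> a \<in> tensor_space scaleA scaleQ UNIV P}"
    by (intro A.subspaceI) (simp_all add: lin_add[OF coaction_linear] lin_scale[OF coaction_linear]
        lin_zero[OF coaction_linear] tensor_space_add tensor_space_scale tensor_space_zero)
  show "1 \<in> {a. \<alpha> a \<in> tensor_space scaleA scaleQ UNIV P}"
    using P by (simp add: coaction_one subalgebra_def tensor_in_tensor_space)
next
  fix x y
  assume "x \<in> {a. \<alpha> a \<in> tensor_space scaleA scaleQ UNIV P}" "y \<in> {a. \<alpha> a \<in> tensor_space scaleA scaleQ UNIV P}"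
  hence x: "\<alpha> x \<in> tensor_space scaleA scaleQ UNIV P" and y: "\<alpha> y \<in> tensor_space scaleA scaleQ UNIV P" by auto
  obtain xs where xs: "set xs \<subseteq> UNIV \<times> P" "\<alpha> x = (\<Sum>(a, b)\<leftarrow>xs. tensor scaleA scaleQ a b)"
    using tensor_space_list[OF A.vector_space_axioms A.subspace_UNIV x] by blast
  obtain ys where ys: "set ys \<subseteq> UNIV \<times> P" "\<alpha> y = (\<Sum>(a, b)\<leftarrow>ys. tensor scaleA scaleQ a b)"
    using tensor_space_list[OF A.vector_space_axioms A.subspace_UNIV y] by blast
  have "b * d \<in> P" if "(a, b) \<in> set xs" "(c, d) \<in> set ys" for a b c d
    using subsetD[OF xs(1) that(1)] subsetD[OF ys(1) that(2)] P unfolding subalgebra_def by auto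
  hence "\<alpha> (x * y) \<in> tensor_space scaleA scaleQ UNIV P"
    unfolding coaction_mult xs ys tensor_mult_tensor_list[OF A.k_algebra_axioms Q.k_algebraQ]
    by (auto intro!: tensor_space_sum_list tensor_in_tensor_space split: prod.splits)
  thus "x * y \<in> {a. \<alpha> a \<in> tensor_space scaleA scaleQ UNIV P}" by simp
qed

text \<open>The common end of both cases. As \<alpha> is multiplicative, the elements mapped into A
  \<otimes> P form a subalgebra; it contains V, hence everything, and inner faithfulness gives P =
  Q.\<close>

lemma commutative_if_coefficients_commute:
  fixes x y :: 'q
  assumes gen: "generates_algebra scaleA V" and inner: "inner_faithful scaleA scaleQ \<Delta> S \<alpha>"
    and E: "A.span E = V" and q: "Q.comatrix E q"
    and \<alpha>E: "\<And>v. v \<in> E \<Longrightarrow> \<alpha> v = (\<Sum>u\<in>E. tensor scaleA scaleQ u (q u v))"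
    and comm: "\<And>i j k l. i \<in> E \<Longrightarrow> j \<in> E \<Longrightarrow> k \<in> E \<Longrightarrow> l \<in> E \<Longrightarrow> q i j * q k l = q k l * q i j"
    and S: "\<And>i j. i \<in> E \<Longrightarrow> j \<in> E \<Longrightarrow> S (q i j) \<in> generated scaleQ (Q.coeffs E q)"
  shows "x * y = y * x"
proof -
  let ?P = "generated scaleQ (Q.coeffs E q)"
  have P: "subalgebra scaleQ ?P" by (rule Q.subalgebra_generated)
  let ?R = "{a. \<alpha> a \<in> tensor_space scaleA scaleQ UNIV ?P}"
  have R: "subalgebra scaleA ?R" by (rule coaction_subalgebra[OF P])
  have "E \<subseteq> ?R"
  proof
    fix v assume "v \<in> E"
    hence "q u v \<in> ?P" if "u \<in> E" for u
      using that Q.generated_superset[of "Q.coeffs E q"] by (auto simp: Q.coeffs_def)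
    thus "v \<in> ?R" by (simp add: \<alpha>E[OF \<open>v \<in> E\<close>] tensor_space_sum tensor_in_tensor_space)
  qed
  hence "V \<subseteq> ?R" using R unfolding E[symmetric] by (intro A.span_minimal) (simp_all add: subalgebra_def)
  with R have "\<Inter>{R. subalgebra scaleA R \<and> V \<subseteq> R} \<subseteq> ?R" by (intro Inter_lower) simp
  hence "UNIV \<subseteq> ?R" unfolding gen[unfolded generates_algebra_def] .
  hence "range \<alpha> \<subseteq> tensor_space scaleA scaleQ UNIV ?P" by blast
  with inner Q.hopf_subalgebra_generated[OF q S] have "?P = UNIV" unfolding inner_faithful_def by blast
  moreover have "x * y = y * x" if "x \<in> ?P" "y \<in> ?P"
    by (rule Q.generated_commute[OF _ that]) (auto simp: Q.coeffs_def comm)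
  ultimately show ?thesis by simp
qed

lemma coefficient_comatrix:
  assumes V: "A.subspace V" "fin_dim scaleA V" and \<alpha>V: "\<alpha> ` V \<subseteq> tensor_space scaleA scaleQ V UNIV"
  obtains E q where "E \<subseteq> V" "finite E" "A.independent E" "A.span E = V" "Q.comatrix E q"
    "\<And>v. v \<in> E \<Longrightarrow> \<alpha> v = (\<Sum>u\<in>E. tensor scaleA scaleQ u (q u v))"
proof -
  obtain X where X: "finite X" "A.span X = V" using V(2) by (auto simp: fin_dim_def)
  obtain E where E: "E \<subseteq> V" "A.independent E" "V \<subseteq> A.span E" using A.maximal_independent_subset by blast
  have sE: "A.span E = V" using E(1,3) V(1) by (rule A.span_subspace)
  have fE: "finite E" using A.independent_span_bound[OF X(1) E(2)] X(2) E(1) by simp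
  have "\<exists>c. \<alpha> v = (\<Sum>u\<in>E. tensor scaleA scaleQ u (c u))" if "v \<in> E" for v
  proof -
    have "\<alpha> v \<in> tensor_space scaleA scaleQ (A.span E) UNIV"
      using that \<alpha>V E(1) unfolding sE by blast
    thus ?thesis
      using tensor_space_span_rep[OF A.vector_space_axioms Q.vector_space_axioms fE Q.subspace_UNIV] by metis
  qed
  then obtain c where c: "\<And>v. v \<in> E \<Longrightarrow> \<alpha> v = (\<Sum>u\<in>E. tensor scaleA scaleQ u (c v u))" by metis
  have "Q.comatrix E (\<lambda>u v. c v u)"
    by (rule Q.comatrix_of_comodule[OF A.vector_space_axioms fE E(2) coaction_linear coaction_in c
          coaction_coassoc coaction_counit])
  with E(1,2) fE sE c show thesis by (intro that)
qed

end

text \<open>A functional \<open>f\<close> on the second legs turns the equality of \<alpha> (i * j)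
  and \<alpha> (j * i) into a quadratic relation in A with scalar coefficients. As \<open>f\<close>
  is arbitrary, the conclusion returns to Q.\<close>

lemma quadratic_comatrix_relation:
  fixes scaleA :: "'k::field \<Rightarrow> 'a::{comm_ring, comm_monoid_mult} \<Rightarrow> 'a"
    and scaleQ :: "'k \<Rightarrow> 'q::{ring, monoid_mult} \<Rightarrow> 'q"
  assumes co: "hopf_coaction scaleA scaleQ \<Delta> \<epsilon> S \<alpha>"
    and qi: "quadratically_independent scaleA (module.span scaleA E)"
    and E: "finite E" "\<not> module.dependent scaleA E"
    and \<alpha>E: "\<And>v. v \<in> E \<Longrightarrow> \<alpha> v = (\<Sum>u\<in>E. tensor scaleA scaleQ u (q u v))"
    and ijkl: "i \<in> E" "j \<in> E" "k \<in> E" "l \<in> E"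
  shows "q k i * q l j + q l i * q k j = q k j * q l i + q l j * q k i"
proof -
  interpret hopf_coaction scaleA scaleQ \<Delta> \<epsilon> S \<alpha> by fact
  note vs = A.vector_space_axioms Q.vector_space_axioms
  \<comment> \<open>The coefficient of \<open>k * l\<close> in \<alpha> (i * j) - \<alpha> (j * i).
    Since \<open>k * l = l * k\<close> in A, what is forced to vanish is
    \<open>d k l + d l k\<close>.\<close>
  define d where "d = (\<lambda>k l. q k i * q l j - q k j * q l i)"
  have \<alpha>mult: "\<alpha> (v * w) = (\<Sum>x\<in>E \<times> E. tensor scaleA scaleQ (fst x * snd x) (q (fst x) v * q (snd x) w))"
    if "v \<in> E" "w \<in> E" for v w
    unfolding coaction_mult \<alpha>E[OF that(1)] \<alpha>E[OF that(2)]
      tensor_mult_sum_tensor[OF A.k_algebra_axioms Q.k_algebraQ E(1) E(1)]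
    by (simp add: sum.cartesian_product case_prod_unfold)
  have "f (q k i * q l j + q l i * q k j) = f (q k j * q l i + q l j * q k i)"
    if f: "Vector_Spaces.linear scaleQ (*) f" for f
  proof -
    define \<beta> where "\<beta> = (\<lambda>a q. scaleA (f q) a)"
    have \<beta>: "bilinear_on scaleA scaleQ scaleA UNIV UNIV \<beta>"
      by (auto simp: bilinear_on_def \<beta>_def lin_add[OF f] lin_scale[OF f] A.scale_right_distrib
          A.scale_left_distrib mult.commute)
    have tlift: "tlift scaleA scaleQ \<beta> (\<alpha> (v * w)) = (\<Sum>k\<in>E. \<Sum>l\<in>E. scaleA (f (q k v * q l w)) (k * l))"
      if "v \<in> E" "w \<in> E" for v w
      unfolding \<alpha>mult[OF that] tensor_lift_sum_tensor[OF vs vs(1) A.subspace_UNIV Q.subspace_UNIV \<beta> UNIV_I UNIV_I]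
      by (simp add: \<beta>_def sum.cartesian_product case_prod_unfold)
    have "(\<Sum>k\<in>E. \<Sum>l\<in>E. scaleA (f (d k l)) (k * l)) =
        tlift scaleA scaleQ \<beta> (\<alpha> (i * j)) - tlift scaleA scaleQ \<beta> (\<alpha> (j * i))"
      unfolding tlift[OF ijkl(1,2)] tlift[OF ijkl(2,1)] d_def lin_diff[OF f] A.scale_left_diff_distrib
      by (simp only: sum_subtractf)
    also have "\<dots> = 0" by (simp add: mult.commute)
    finally have "f (d k l) + f (d l k) = 0"
      using quadratic_relation_coefficients[OF A.k_algebra_axioms qi E, of "\<lambda>k l. f (d k l)"] ijkl by blast
    thus ?thesis by (simp add: d_def lin_add[OF f] lin_diff[OF f] algebra_simps)
  qed
  thus ?thesis by (rule eq_if_functionals_eq[OF vs(2)])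
qed

section \<open>Invariant forms\<close>

text \<open>Invariance in matrix form, q^T G q = G. All lifts are taken over \<open>V\<close>, since
  bilinearity of \<open>B\<close> is available there only.\<close>

lemma (in hopf_coaction) preserved_form_relation:
  assumes B: "bilinear_form_on scaleA V B" and pres: "preserves_form scaleA scaleQ \<alpha> V B"
    and V: "A.subspace V" and E: "E \<subseteq> V"
    and \<alpha>E: "\<And>v. v \<in> E \<Longrightarrow> \<alpha> v = (\<Sum>u\<in>E. tensor scaleA scaleQ u (q u v))"
    and ij: "i \<in> E" "j \<in> E"
  shows "(\<Sum>k\<in>E. \<Sum>l\<in>E. scaleQ (B k l) (q k i * q l j)) = scaleQ (B i j) 1"
proof -
  note vs = A.vector_space_axioms Q.vector_space_axioms
  note bil = B[unfolded bilinear_form_on_def]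
  note tls = tensor_lift_sum_tensor[OF vs vs(2) V Q.subspace_UNIV]
  have inner: "tensor_lift scaleA scaleQ V UNIV (\<lambda>b0 b1. scaleQ (B a0 b0) (a1 * b1)) (\<alpha> j) =
      (\<Sum>l\<in>E. scaleQ (B a0 l) (a1 * q l j))" if "a0 \<in> V" for a0 a1
  proof -
    have "bilinear_on scaleA scaleQ scaleQ V UNIV (\<lambda>b0 b1. scaleQ (B a0 b0) (a1 * b1))"
      using that by (auto simp: bilinear_on_def bilinear_onD[OF bil] Q.scale_left_distrib
          Q.scale_right_distrib distrib_left Q.scale_mult_right mult.commute)
    thus ?thesis unfolding \<alpha>E[OF ij(2)] by (rule tls) (use E in auto)
  qed
  have "bilinear_on scaleA scaleQ scaleQ V UNIV
     (\<lambda>a0 a1. tensor_lift scaleA scaleQ V UNIV (\<lambda>b0 b1. scaleQ (B a0 b0) (a1 * b1)) (\<alpha> j))"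
  proof -
    have "bilinear_on scaleA scaleQ scaleQ V UNIV (\<lambda>a0 a1. \<Sum>l\<in>E. scaleQ (B a0 l) (a1 * q l j))"
      unfolding bilinear_on_def
    proof (intro conjI ballI allI)
      fix u u' w w' c assume u: "u \<in> V"
      have 1: "B (u + u') l = B u l + B u' l" if "l \<in> E" "u' \<in> V" for l
        using bilinear_onD(1)[OF bil u subsetD[OF E that(1)] that(2)] .
      have 2: "B (scaleA c u) l = c * B u l" if "l \<in> E" for l
        using bilinear_onD(3)[OF bil u subsetD[OF E that]] .
      show "(\<Sum>l\<in>E. scaleQ (B (u + u') l) (w * q l j)) =
          (\<Sum>l\<in>E. scaleQ (B u l) (w * q l j)) + (\<Sum>l\<in>E. scaleQ (B u' l) (w * q l j))" if "u' \<in> V"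
        unfolding sum.distrib[symmetric] Q.scale_left_distrib[symmetric]
        by (intro sum.cong refl) (simp add: 1 that)
      show "(\<Sum>l\<in>E. scaleQ (B u l) ((w + w') * q l j)) =
          (\<Sum>l\<in>E. scaleQ (B u l) (w * q l j)) + (\<Sum>l\<in>E. scaleQ (B u l) (w' * q l j))"
        by (simp add: distrib_right Q.scale_right_distrib sum.distrib)
      show "(\<Sum>l\<in>E. scaleQ (B (scaleA c u) l) (w * q l j)) = scaleQ c (\<Sum>l\<in>E. scaleQ (B u l) (w * q l j))"
        unfolding Q.scale_sum_right by (intro sum.cong refl) (simp add: 2)
      show "(\<Sum>l\<in>E. scaleQ (B u l) (scaleQ c w * q l j)) = scaleQ c (\<Sum>l\<in>E. scaleQ (B u l) (w * q l j))"
        by (simp add: Q.scale_sum_right Q.scale_mult_left mult.commute)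
    qed
    thus ?thesis using A.subspace_add[OF V] A.subspace_scale[OF V] by (simp add: bilinear_on_def inner)
  qed
  hence "tensor_lift scaleA scaleQ V UNIV
      (\<lambda>a0 a1. tensor_lift scaleA scaleQ V UNIV (\<lambda>b0 b1. scaleQ (B a0 b0) (a1 * b1)) (\<alpha> j)) (\<alpha> i) =
      (\<Sum>k\<in>E. tensor_lift scaleA scaleQ V UNIV (\<lambda>b0 b1. scaleQ (B k b0) (q k i * b1)) (\<alpha> j))"
    unfolding \<alpha>E[OF ij(1)] by (rule tls) (use E in auto)
  also have "\<dots> = (\<Sum>k\<in>E. \<Sum>l\<in>E. scaleQ (B k l) (q k i * q l j))"
    using E by (intro sum.cong refl inner) auto
  finally have "tensor_lift scaleA scaleQ V UNIV
      (\<lambda>a0 a1. tensor_lift scaleA scaleQ V UNIV (\<lambda>b0 b1. scaleQ (B a0 b0) (a1 * b1)) (\<alpha> j)) (\<alpha> i) =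
      (\<Sum>k\<in>E. \<Sum>l\<in>E. scaleQ (B k l) (q k i * q l j))" .
  from trans[OF this[symmetric] pres[unfolded preserves_form_def, rule_format, OF subsetD[OF E ij(1)] subsetD[OF E ij(2)]]]
  show ?thesis .
qed

lemma (in hopf_algebra) comatrix_commute_if_form:
  assumes two: "\<And>x :: 'q. x + x = 0 \<Longrightarrow> x = 0"
    and q: "comatrix E q"
    and rel: "\<And>i j k l. i \<in> E \<Longrightarrow> j \<in> E \<Longrightarrow> k \<in> E \<Longrightarrow> l \<in> E \<Longrightarrow>
      q k i * q l j + q l i * q k j = q k j * q l i + q l j * q k i"
    and form: "\<And>i j. i \<in> E \<Longrightarrow> j \<in> E \<Longrightarrow>
      (\<Sum>k\<in>E. \<Sum>l\<in>E. scale (G k l) (q k i * q l j)) = scale (G i j) 1"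
    and nd: "\<And>c k. (\<And>j. j \<in> E \<Longrightarrow> (\<Sum>k\<in>E. c k * G k j) = 0) \<Longrightarrow> k \<in> E \<Longrightarrow> c k = 0"
    and abcd: "a \<in> E" "b \<in> E" "c \<in> E" "d \<in> E"
  shows "q c a * q d b = q d b * q c a"
proof -
  define r where "r = (\<lambda>i j. S (q i j))"
  \<comment> \<open>S reverses products, so applying it to \<open>rel\<close> gives a relation
    between the entries of S(q).\<close>
  have r_rel: "r l j * r k i - r l i * r k j + (r k j * r l i - r k i * r l j) = 0"
    if "i \<in> E" "j \<in> E" "k \<in> E" "l \<in> E" for i j k l
  proof -
    have "S (q k i * q l j + q l i * q k j) = S (q k j * q l i + q l j * q k i)"
      by (simp add: rel that)
    thus ?thesis
      by (simp add: lin_add[OF antipode_linear] antipode_comatrix_mult[OF q] that r_def algebra_simps)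
  qed
  \<comment> \<open>The matrix q^T G = G S(q) has two readings: the second carries
    \<open>r_rel\<close> over to Y, the first carries the result back to q.\<close>
  define Y where "Y = (\<lambda>a j. \<Sum>c\<in>E. scale (G c j) (q c a))"
  have Y: "Y a j = (\<Sum>l\<in>E. scale (G a l) (r l j))" if "a \<in> E" "j \<in> E" for a j
    unfolding Y_def r_def by (rule antipode_form[OF q that form])
  have prod: "(\<Sum>l\<in>E. scale (u l) (F l)) * (\<Sum>k\<in>E. scale (v k) (H k)) =
      (\<Sum>l\<in>E. \<Sum>k\<in>E. scale (u l * v k) (F l * H k))" for u v F H
    by (simp add: sum_distrib_left sum_distrib_right scale_mult_left scale_mult_right scale_sum_right mult.commute)
       (rule sum.swap)
  \<comment> \<open>The same product summed in the other order, so that all four terms of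
    \<open>Y_rel\<close> appear against the same scalars.\<close>
  have prod': "(\<Sum>l\<in>E. scale (u l) (F l)) * (\<Sum>k\<in>E. scale (v k) (H k)) =
      (\<Sum>k\<in>E. \<Sum>l\<in>E. scale (v k * u l) (F l * H k))" for u v F H
    unfolding prod by (subst sum.swap) (simp add: mult.commute)
  have Y_rel: "Y a j * Y b i - Y a i * Y b j + (Y b j * Y a i - Y b i * Y a j) = 0"
    if "i \<in> E" "j \<in> E" for i j
  proof -
    have "Y a j * Y b i - Y a i * Y b j + (Y b j * Y a i - Y b i * Y a j) =
       (\<Sum>l\<in>E. \<Sum>k\<in>E. scale (G a l * G b k)
          (r l j * r k i - r l i * r k j + (r k j * r l i - r k i * r l j)))"
      unfolding Y[OF abcd(1) that(1)] Y[OF abcd(1) that(2)] Y[OF abcd(2) that(1)] Y[OF abcd(2) that(2)]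
      unfolding prod[of "\<lambda>l. G a l"] prod'[of "\<lambda>l. G b l"]
      by (simp only: scale_right_distrib scale_right_diff_distrib sum.distrib sum_subtractf)
    also have "\<dots> = 0" by (intro sum.neutral ballI) (simp add: r_rel that)
    finally show ?thesis .
  qed
  \<comment> \<open>This is [q_ca, q_db] - [q_da, q_cb]. Its vanishing exchanges row indices,
    whereas \<open>rel\<close> exchanges column indices.\<close>
  define W where "W = (\<lambda>c d. q c a * q d b - q d a * q c b + (q c b * q d a - q d b * q c a))"
  have W_sum: "(\<Sum>c\<in>E. \<Sum>d\<in>E. scale (G c j * G d i) (W c d)) = 0" if "i \<in> E" "j \<in> E" for i j
  proof -
    have "(\<Sum>c\<in>E. \<Sum>d\<in>E. scale (G c j * G d i) (W c d)) =
        Y a j * Y b i - Y a i * Y b j + (Y b j * Y a i - Y b i * Y a j)"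
      unfolding Y_def W_def prod[of "\<lambda>c. G c j"] prod'[of "\<lambda>c. G c i"]
      by (simp only: scale_right_distrib scale_right_diff_distrib sum.distrib sum_subtractf)
    with Y_rel[OF that] show ?thesis by simp
  qed
  have "f (W c d) = f 0" if f: "Vector_Spaces.linear scale (*) f" for f
  proof -
    have "(\<Sum>c\<in>E. (\<Sum>d\<in>E. f (W c d) * G d i) * G c j) = 0" if "i \<in> E" "j \<in> E" for i j
    proof -
      have "(\<Sum>c\<in>E. (\<Sum>d\<in>E. f (W c d) * G d i) * G c j) = f (\<Sum>c\<in>E. \<Sum>d\<in>E. scale (G c j * G d i) (W c d))"
        by (simp add: lin_sum[OF f] lin_scale[OF f] sum_distrib_left sum_distrib_right mult_ac)
      also have "\<dots> = 0" by (simp add: W_sum that lin_zero[OF f])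
      finally show ?thesis .
    qed
    \<comment> \<open>G is cancelled once for each of the two row indices.\<close>
    hence "(\<Sum>d\<in>E. f (W c d) * G d i) = 0" if "i \<in> E" for i
      using nd[of "\<lambda>c. \<Sum>d\<in>E. f (W c d) * G d i"] abcd(3) that by blast
    hence "f (W c d) = 0" using nd[of "f \<circ> W c"] abcd(4) by simp
    thus ?thesis by (simp add: lin_zero[OF f])
  qed
  hence "W c d = 0" by (rule eq_if_functionals_eq[OF vsQ])
  moreover have "(q c a * q d b - q d b * q c a) + (q c a * q d b - q d b * q c a) =
      W c d + ((q c a * q d b + q d a * q c b) - (q c b * q d a + q d b * q c a))"
    by (simp add: W_def algebra_simps)
  ultimately have "(q c a * q d b - q d b * q c a) + (q c a * q d b - q d b * q c a) = 0"
    by (simp add: rel[OF abcd])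
  from two[OF this] show ?thesis by simp
qed

theorem theorem1p1:
  fixes scaleA :: "'k::alg_closed_field \<Rightarrow> 'a::{comm_ring, comm_monoid_mult} \<Rightarrow> 'a"
    and scaleQ :: "'k \<Rightarrow> 'q::{ring, monoid_mult} \<Rightarrow> 'q"
    and V :: "'a set"
    and \<Delta> :: "'q \<Rightarrow> ('q, 'q, 'k) tensor"
    and \<epsilon> :: "'q \<Rightarrow> 'k"
    and S :: "'q \<Rightarrow> 'q"
    and \<alpha> :: "'a \<Rightarrow> ('a, 'q, 'k) tensor"
  assumes "CHAR('k) \<noteq> 2"
    and "k_algebra scaleA"
    and "module.subspace scaleA V" and "fin_dim scaleA V"
    and "generates_algebra scaleA V"
    and "quadratically_independent scaleA V"
    and "hopf_algebra scaleQ \<Delta> \<epsilon> S"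
    and "hopf_coaction scaleA scaleQ \<Delta> \<epsilon> S \<alpha>"
    and "inner_faithful scaleA scaleQ \<Delta> S \<alpha>"
    and "\<alpha> ` V \<subseteq> tensor_space scaleA scaleQ V UNIV"
    and "(\<exists>B. bilinear_form_on scaleA V B \<and> nondegenerate_on V B \<and>
              preserves_form scaleA scaleQ \<alpha> V B) \<or>
         (CHAR('k) = 0 \<and> cosemisimple scaleQ \<Delta> \<and> fin_dim scaleQ UNIV)"
  shows "\<forall>x y :: 'q. x * y = y * x"
proof -
  note V = assms(3,4) and qi = assms(6) and co = assms(8)
  interpret hopf_coaction scaleA scaleQ \<Delta> \<epsilon> S \<alpha> by fact
  obtain E q where E: "E \<subseteq> V" "finite E" "A.independent E" "A.span E = V" and q: "Q.comatrix E q"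
    and \<alpha>E: "\<And>v. v \<in> E \<Longrightarrow> \<alpha> v = (\<Sum>u\<in>E. tensor scaleA scaleQ u (q u v))"
    using coefficient_comatrix[OF V assms(10)] by blast
  let ?P = "generated scaleQ (Q.coeffs E q)"
  have rel: "q k i * q l j + q l i * q k j = q k j * q l i + q l j * q k i"
    if "i \<in> E" "j \<in> E" "k \<in> E" "l \<in> E" for i j k l
    by (rule quadratic_comatrix_relation[OF co _ E(2,3) \<alpha>E that]) (use qi E(4) in simp_all)
  have "\<not> CHAR('k) dvd 2"
  proof
    assume "CHAR('k) dvd 2"
    hence "CHAR('k) = 1 \<or> CHAR('k) = 2" using prime_nat_iff two_is_prime_nat by blast
    with assms(1) show False by simp
  qed
  hence two_k: "(2 :: 'k) \<noteq> 0" using of_nat_eq_0_iff_char_dvd[of 2, where ?'a = 'k] by simp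
  have two: "x = 0" if "x + x = 0" for x :: 'q
  proof -
    have "scaleQ 2 x = x + x" using Q.scale_left_distrib[of 1 1 x] by simp
    with that two_k show ?thesis by simp
  qed
  note conclude = commutative_if_coefficients_commute[OF assms(5,9) E(4) q \<alpha>E]
  have Psub: "Q.subspace ?P" using Q.subalgebra_generated[of "Q.coeffs E q"] by (simp add: subalgebra_def)
  have qP: "q i j \<in> ?P" if "i \<in> E" "j \<in> E" for i j
    using that Q.generated_superset[of "Q.coeffs E q"] by (auto simp: Q.coeffs_def)
  from assms(11) show ?thesis
  proof (elim disjE exE conjE)
    fix B assume B: "bilinear_form_on scaleA V B" "nondegenerate_on V B" "preserves_form scaleA scaleQ \<alpha> V B"
    note bil = B(1)[unfolded bilinear_form_on_def]
    have form: "(\<Sum>k\<in>E. \<Sum>l\<in>E. scaleQ (B k l) (q k i * q l j)) = scaleQ (B i j) 1"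
      if "i \<in> E" "j \<in> E" for i j
      by (rule preserved_form_relation[OF B(1,3) V(1) E(1) \<alpha>E that])
    have sum_V: "(\<Sum>k\<in>E. scaleA (c k) k) \<in> V" for c
      using E(1) by (intro A.subspace_sum[OF V(1)] A.subspace_scale[OF V(1)]) auto
    have zero_c: "c k = 0" if "(\<Sum>k\<in>E. scaleA (c k) k) = 0" "k \<in> E" for c k
      using A.independentD[OF E(3,2) order_refl that] .
    \<comment> \<open>Stated for subsets of \<open>E\<close>, so that the induction can keep partial
      sums in \<open>V\<close>, where \<open>B\<close> is bilinear.\<close>
    have B_left: "B (\<Sum>k\<in>K. scaleA (c k) k) w = (\<Sum>k\<in>K. c k * B k w)"
      and B_right: "B w (\<Sum>k\<in>K. scaleA (c k) k) = (\<Sum>k\<in>K. B w k * c k)"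
      if "K \<subseteq> E" "w \<in> V" for K c w
    proof -
      have "finite K" using that(1) E(2) by (rule finite_subset)
      hence "B (\<Sum>k\<in>K. scaleA (c k) k) w = (\<Sum>k\<in>K. c k * B k w) \<and>
        B w (\<Sum>k\<in>K. scaleA (c k) k) = (\<Sum>k\<in>K. B w k * c k)"
        using that(1)
      proof induction
        case empty
        show ?case
          using bilinear_onD(3)[OF bil A.subspace_0[OF V(1)] that(2), of 0]
            bilinear_onD(4)[OF bil that(2) A.subspace_0[OF V(1)], of 0] by simp
      next
        case (insert k K)
        have "k \<in> V" "scaleA (c k) k \<in> V" "(\<Sum>k\<in>K. scaleA (c k) k) \<in> V"
          using insert.prems E(1) A.subspace_scale[OF V(1)]
          by (auto intro!: A.subspace_sum[OF V(1)])
        with insert that(2) show ?case by (simp add: bilinear_onD[OF bil] mult.commute)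
      qed
      thus "B (\<Sum>k\<in>K. scaleA (c k) k) w = (\<Sum>k\<in>K. c k * B k w)"
        "B w (\<Sum>k\<in>K. scaleA (c k) k) = (\<Sum>k\<in>K. B w k * c k)" by auto
    qed
    have V_rep: "\<exists>c. v = (\<Sum>k\<in>E. scaleA (c k) k)" if "v \<in> V" for v
      using that A.span_finite[OF E(2)] unfolding E(4) by auto
    \<comment> \<open>The form need not be symmetric, and its two kernels serve different ends: the
      left one to cancel G in \<open>Q.comatrix_commute_if_form\<close>, the right one to solve for
      S(q).\<close>
    have nd_left: "c k = 0" if c: "\<And>j. j \<in> E \<Longrightarrow> (\<Sum>k\<in>E. c k * B k j) = 0" and k: "k \<in> E" for c k
    proof -
      let ?v = "\<Sum>k\<in>E. scaleA (c k) k"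
      have "B ?v j = 0" if "j \<in> E" for j
        using c[OF that] B_left[OF order_refl, of j c] that E(1) by auto
      hence "B ?v w = 0" if "w \<in> V" for w
        using V_rep[OF that] B_right[OF order_refl sum_V] by auto
      hence "?v = 0" using B(2) sum_V by (auto simp: nondegenerate_on_def)
      thus ?thesis using k by (rule zero_c)
    qed
    have nd_right: "c k = 0" if c: "\<And>i. i \<in> E \<Longrightarrow> (\<Sum>k\<in>E. B i k * c k) = 0" and k: "k \<in> E" for c k
    proof -
      let ?v = "\<Sum>k\<in>E. scaleA (c k) k"
      have "B i ?v = 0" if "i \<in> E" for i
        using c[OF that] B_right[OF order_refl, of i c] that E(1) by auto
      hence "B w ?v = 0" if "w \<in> V" for w
        using V_rep[OF that] B_left[OF order_refl sum_V] by auto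
      hence "?v = 0" using B(2) sum_V by (auto simp: nondegenerate_on_def)
      thus ?thesis using k by (rule zero_c)
    qed
    have "x * y = y * x" for x y :: 'q
    proof (rule conclude)
      show "q i j * q k l = q k l * q i j" if "i \<in> E" "j \<in> E" "k \<in> E" "l \<in> E" for i j k l
        by (rule Q.comatrix_commute_if_form[where G = B and E = E and q = q]) (fact two q rel form nd_left that)+
      show "S (q i j) \<in> ?P" if "i \<in> E" "j \<in> E" for i j
        by (rule Q.antipode_form_in_subspace[where G = B and E = E and p = q]) (fact q that form nd_right Psub qP)+
    qed
    thus ?thesis by blast
  next
    assume char0: "CHAR('k) = 0" and ss: "cosemisimple scaleQ \<Delta>" and fin: "fin_dim scaleQ UNIV"
    obtain h where h: "Q.haar h" using Q.haar_exists[OF ss] .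
    have of_nat: "(of_nat n :: 'k) \<noteq> 0" if "n > 0" for n
      using that char0 of_nat_eq_0_iff_char_dvd[of n, where ?'a = 'k] by simp
    \<comment> \<open>With equal row indices \<open>rel\<close> says that twice the commutator
      vanishes.\<close>
    have row: "q k i * q k j = q k j * q k i" if "i \<in> E" "j \<in> E" "k \<in> E" for i j k
      using two[of "q k i * q k j - q k j * q k i"] rel[OF that(1,2,3,3)] by (simp add: algebra_simps)
    have comm: "q i j * q k l = q k l * q i j" if ijkl: "i \<in> E" "j \<in> E" "k \<in> E" "l \<in> E" for i j k l
    proof -
      \<comment> \<open>Rows \<open>k\<close> and \<open>i\<close> as dual numbers. Column
        \<open>j\<close> has t-part \<open>q i j\<close> and column \<open>l\<close> has constant
        part \<open>q k l\<close>, the two elements that \<open>Q.rigidity\<close> makes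
        commute.\<close>
      define X where "X = (\<lambda>m. (q k m, q i m)) ` E"
      show ?thesis
      proof (rule Q.rigidity[OF fin h of_nat])
        show "Q.dual_commute x y" if "x \<in> X" "y \<in> X" for x y
          using that row rel ijkl by (auto simp: X_def Q.dual_commute_def)
        show "Q.dual_comult (Q.dual_alg X) x" if x: "x \<in> X" for x
        proof -
          obtain m where m: "m \<in> E" "x = (q k m, q i m)" using x by (auto simp: X_def)
          obtain es where es: "distinct es" "set es = E" using finite_distinct_list[OF E(2)] by blast
          have \<Delta>q: "\<Delta> (q n m) = (\<Sum>e\<leftarrow>es. Q.tn (q n e) (q e m))" if "n \<in> E" for n
            using q that m(1) unfolding Q.comatrix_def es(2)[symmetric] sum.distinct_set_conv_list[OF es(1)]
            by simp
          show ?thesis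
          \<comment> \<open>The coproducts of entries in the same column have the same second legs
            \<open>q e m\<close>, whatever the row; this is the sharing that
            \<open>dual_comult\<close> asks for.\<close>
          proof (rule Q.dual_comultI[where ys = "map (\<lambda>e. ((q k e, q i e), q e m)) es"])
            show "y \<in> Q.dual_alg X" if "(y, r) \<in> set (map (\<lambda>e. ((q k e, q i e), q e m)) es)" for y r
              using that es(2) by (auto simp: X_def intro!: Q.dual_alg.gen)
          qed (simp_all add: m \<Delta>q ijkl comp_def)
        qed
        show "(q k j, q i j) \<in> Q.dual_alg X" "(q k l, q i l) \<in> Q.dual_alg X"
          using ijkl by (auto simp: X_def intro!: Q.dual_alg.gen)
      qed
    qed
    have "x * y = y * x" for x y :: 'q
    proof (rule conclude)
      show "S (q i j) \<in> ?P" if "i \<in> E" "j \<in> E" for i j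
      proof (rule Q.antipode_coideal_subalgebra[OF fin h Q.subalgebra_generated Q.comult_generated_coeffs[OF q] _ qP[OF that]])
        show "x * y = y * x" if "x \<in> ?P" "y \<in> ?P" for x y
          by (rule Q.generated_commute[OF _ that]) (auto simp: Q.coeffs_def comm)
      qed
    qed (blast intro: comm)+
    thus ?thesis by blast
  qed
qed

end
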